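(* For every integer $n\geq 1$, the ordered configuration space $F(\mathbb{CP}^n,2)$ of two distinct points in complex projective $n$-space satisfies \[cat(F(\mathbb{CP}^n,2))=2n.\]
   Context: For a topological space $X$ and $k\geq 1$, the ordered configuration space of $k$ distinct points of $X$ is $F(X,k)=\{(x_1,\ldots,x_k)\in X^k \mid x_i\neq x_j \text{ for all } i\neq j\}$, topologised as a subspace of the Cartesian power $X^k$. The Lusternik-Schnirelmann category $cat(X)$ of a topological space $X$ is the (non-reduced) category: the least integer $m$ such that $X$ can be covered by $m$ open sets, each of which is contractible within $X$ (i.e. its inclusion into $X$ is null-homotopic). With this convention a contractible space has category $1$. *)

theory Defs
  imports "HOL-Analysis.Analysis" "HOL-Library.Extended_Nat"
begin

definition quotient_topology :: "'a topology \<Rightarrow> ('a \<times> 'a) set \<Rightarrow> 'a set topology" where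
  "quotient_topology X r =
     topology (\<lambda>U. U \<subseteq> topspace X // r \<and> openin X (\<Union>U))"

lemma quotient_Union_Int:
  assumes "equiv A r" "S \<subseteq> A // r" "T \<subseteq> A // r"
  shows "\<Union>(S \<inter> T) = \<Union>S \<inter> \<Union>T"
  using quotient_disj[OF assms(1)] assms(2,3) by fast

lemma openin_quotient_topology:
  assumes "equiv (topspace X) r"
  shows "openin (quotient_topology X r) U \<longleftrightarrow> U \<subseteq> topspace X // r \<and> openin X (\<Union>U)"
proof -
  have "istopology (\<lambda>U. U \<subseteq> topspace X // r \<and> openin X (\<Union>U))"
    unfolding istopology_def
  proof (intro conjI allI impI)
    fix S T
    assume "S \<subseteq> topspace X // r \<and> openin X (\<Union>S)" "T \<subseteq> topspace X // r \<and> openin X (\<Union>T)"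
    then show "openin X (\<Union>(S \<inter> T))"
      by (simp add: quotient_Union_Int[OF assms] openin_Int)
  next
    fix \<K> assume *: "\<forall>K\<in>\<K>. K \<subseteq> topspace X // r \<and> openin X (\<Union>K)"
    have "\<Union>(\<Union>\<K>) = \<Union>(Union ` \<K>)" by blast
    then show "openin X (\<Union>(\<Union>\<K>))" using * by (metis (no_types, lifting) imageE openin_Union)
  qed blast+
  then show ?thesis
    by (simp add: quotient_topology_def topology_inverse')
qed

lemma topspace_quotient_topology:
  assumes "equiv (topspace X) r"
  shows "topspace (quotient_topology X r) = topspace X // r"
proof -
  have "openin (quotient_topology X r) (topspace X // r)"
    using assms by (simp add: openin_quotient_topology Union_quotient)
  then show ?thesis
    using assms by (metis openin_quotient_topology openin_subset openin_topspace subset_antisym)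
qed

lemma quotient_map_quotient_topology:
  assumes "equiv (topspace X) r"
  shows "quotient_map X (quotient_topology X r) (\<lambda>x. r `` {x})"
proof -
  have "{x \<in> topspace X. r `` {x} \<in> U} = \<Union>U" if "U \<subseteq> topspace X // r" for U
  proof (intro equalityI subsetI)
    fix x assume "x \<in> {x \<in> topspace X. r `` {x} \<in> U}"
    then show "x \<in> \<Union>U" using equiv_class_self[OF assms] by blast
  next
    fix x assume "x \<in> \<Union>U"
    then obtain C where C: "C \<in> U" "x \<in> C" by blast
    with that obtain y where y: "y \<in> topspace X" "C = r `` {y}" by (blast elim: quotientE)
    with C have "(y, x) \<in> r" by simp
    then have "r `` {x} = C" "x \<in> topspace X"
      using y equiv_class_eq[OF assms] assms by (auto dest: equiv_class_eq_iff[THEN iffD1])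
    with C show "x \<in> {x \<in> topspace X. r `` {x} \<in> U}" by simp
  qed
  then show ?thesis
    unfolding quotient_map_def topspace_quotient_topology[OF assms]
    by (auto simp: openin_quotient_topology[OF assms] quotient_def)
qed

text \<open>
  The space \<open>\<complex>\<^sup>n\<^sup>+\<^sup>1 - {0}\<close>, with coordinates indexed by \<open>0, \<dots>, n\<close>; as in every
  product topology of the library, vectors are extensional functions
  (equal to \<open>undefined\<close> at indices beyond \<open>n\<close>).
\<close>

definition punctured_complex_space :: "nat \<Rightarrow> (nat \<Rightarrow> complex) topology" where
  "punctured_complex_space n =
     subtopology (product_topology (\<lambda>_. euclidean) {..n}) {v. \<exists>i\<le>n. v i \<noteq> 0}"

definition proportional :: "nat \<Rightarrow> ((nat \<Rightarrow> complex) \<times> (nat \<Rightarrow> complex)) set" where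
  "proportional n =
     {(v, w). v \<in> topspace (punctured_complex_space n) \<and>
              w \<in> topspace (punctured_complex_space n) \<and>
              (\<exists>c. c \<noteq> 0 \<and> (\<forall>i\<le>n. w i = c * v i))}"

lemma equiv_proportional:
  "equiv (topspace (punctured_complex_space n)) (proportional n)"
proof (rule equivI)
  show "refl_on (topspace (punctured_complex_space n)) (proportional n)"
    by (auto simp: refl_on_def proportional_def intro: exI[of _ 1])
  show "sym (proportional n)"
  proof (rule symI)
    fix v w assume *: "(v, w) \<in> proportional n"
    then obtain c where "c \<noteq> 0" "\<forall>i\<le>n. w i = c * v i" by (auto simp: proportional_def)
    then have "inverse c \<noteq> 0 \<and> (\<forall>i\<le>n. v i = inverse c * w i)" by simp
    with * show "(w, v) \<in> proportional n" unfolding proportional_def by blast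
  qed
  show "trans (proportional n)"
  proof (rule transI)
    fix u v w assume *: "(u, v) \<in> proportional n" "(v, w) \<in> proportional n"
    then obtain c d where "c \<noteq> 0" "\<forall>i\<le>n. v i = c * u i" "d \<noteq> 0" "\<forall>i\<le>n. w i = d * v i"
      by (auto simp: proportional_def)
    then have "d * c \<noteq> 0 \<and> (\<forall>i\<le>n. w i = (d * c) * u i)" by simp
    with * show "(u, w) \<in> proportional n" unfolding proportional_def by blast
  qed
qed (auto simp: proportional_def)

definition complex_projective_space :: "nat \<Rightarrow> (nat \<Rightarrow> complex) set topology" where
  "complex_projective_space n =
     quotient_topology (punctured_complex_space n) (proportional n)"

lemma quotient_map_complex_projective_space:
  "quotient_map (punctured_complex_space n) (complex_projective_space n)
     (\<lambda>v. proportional n `` {v})"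
  unfolding complex_projective_space_def
  by (rule quotient_map_quotient_topology[OF equiv_proportional])

definition configuration_space :: "'a topology \<Rightarrow> nat \<Rightarrow> (nat \<Rightarrow> 'a) topology" where
  "configuration_space X k =
     subtopology (product_topology (\<lambda>_. X) {1..k})
       {x. \<forall>i\<in>{1..k}. \<forall>j\<in>{1..k}. i \<noteq> j \<longrightarrow> x i \<noteq> x j}"

definition contractible_within :: "'a topology \<Rightarrow> 'a set \<Rightarrow> bool" where
  "contractible_within X U \<longleftrightarrow>
     (\<exists>a\<in>topspace X. homotopic_with (\<lambda>_. True) (subtopology X U) X id (\<lambda>_. a))"

text \<open>
  The category is valued in \<open>enat\<close>, so that it is \<open>\<infinity>\<close> (\<open>Inf {}\<close>) when no finite
  categorical cover exists. The sets of a cover may repeat; this does not affect the infimum.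
\<close>

definition LS_category :: "'a topology \<Rightarrow> enat" where
  "LS_category X =
     Inf {enat m | m. \<exists>U :: nat \<Rightarrow> 'a set.
            (\<forall>i<m. openin X (U i) \<and> contractible_within X (U i)) \<and>
            (\<Union>i<m. U i) = topspace X}"

lemma LS_category_contractible:
  assumes "contractible_space X" "topspace X \<noteq> {}"
  shows "LS_category X = 1"
proof (rule antisym)
  obtain a where a: "homotopic_with (\<lambda>_. True) X X id (\<lambda>_. a)"
    using assms(1) by (auto simp: contractible_space_def)
  then have "a \<in> topspace X"
    using assms(2) by (auto dest!: homotopic_with_imp_continuous_maps simp: continuous_map_def)
  with a have "contractible_within X (topspace X)" by (auto simp: contractible_within_def)
  then show "LS_category X \<le> 1"
    unfolding LS_category_def one_enat_def
    by (intro Inf_lower CollectI exI[of _ 1] exI[of _ "\<lambda>_. topspace X"]) auto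
  show "1 \<le> LS_category X"
    unfolding LS_category_def
  proof (rule Inf_greatest, clarify)
    fix m and U :: "nat \<Rightarrow> 'a set" assume "(\<Union>i<m. U i) = topspace X"
    with assms(2) have "m \<noteq> 0" by (metis UN_empty lessThan_0)
    then show "1 \<le> enat m" by (simp add: one_enat_def Suc_le_eq)
  qed
qed

end

theory Submission
  imports Defs "HOL-Homology.Homology"
begin

text \<open>
  Upper bound: around the pair of coordinate lines \<open>(e\<^sub>i, e\<^sub>j)\<close> there is a contractible chart, the
  set where \<open>v\<^sub>i (v\<^sub>i w\<^sub>j - v\<^sub>j w\<^sub>i) \<noteq> 0\<close>. The Schubert cells of a given dimension lie in
  pairwise disjoint open subsets of such charts, and the dimensions are \<open>0, \<dots>, 2n - 1\<close>.

  Lower bound: let \<open>2n - 1\<close> categorical open sets cover. The tautological line bundles \<open>L\<^sub>1, L\<^sub>2\<close>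
  are trivial over each of them, so the sum of \<open>n\<close> copies of \<open>L\<^sub>1\<^sup>*\<close> and \<open>n - 1\<close> copies of
  \<open>L\<^sub>2\<^sup>*\<close> has a nowhere vanishing section \<open>s\<close> over a compact space of pairs of
  orthogonal lines. The section \<open>s\<^sub>0 = (v\<^sub>0, \<dots>, v\<^sub>n\<^sub>-\<^sub>1, w\<^sub>0, \<dots>, w\<^sub>n\<^sub>-\<^sub>2)\<close> vanishes only at the
  centre of the top cell, and on the boundary of that cell it is homotopic to the inclusion
  \<open>S\<^sup>4\<^sup>n\<^sup>-\<^sup>3 \<subseteq> \<complex>\<^sup>2\<^sup>n\<^sup>-\<^sup>1 - {0}\<close>. The boundary is mapped to a set of real dimension at
  most \<open>4n - 4\<close>, so after a small perturbation the segment from \<open>s\<close> to \<open>s\<^sub>0\<close> avoids zero there.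
  As \<open>s\<close> extends over the cell, the inclusion of the sphere would be null-homotopic.
\<close>

section \<open>Coordinates on the configuration space\<close>

text \<open>The lower bound is the cup-length estimate carried out with sections:
  \<open>s\<^sub>0\<close> has a single nondegenerate zero, so the Euler class of the sum of the
  \<open>2n - 1\<close> line bundles is nonzero. There are as many summands as sets in the supposed
  cover; the \<open>i\<close>-th bundle receives a section supported in the \<open>i\<close>-th set,
  and covering rules out a common zero. The obstacle is that \<open>s\<close> is merely continuous,
  and on the boundary of the cell nothing keeps it from pointing opposite to
  \<open>s\<^sub>0\<close>. General position repairs this only if the perturbed \<open>s\<close> is
  still a section over pairs of lines, since the drop in dimension is visible in the image of the
  boundary, not on the boundary sphere itself. So \<open>s\<close> is replaced by a Lipschitz
  section and then changed by constant multiples of coordinate sections. Real dimension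
  \<open>4n - 4\<close>, plus one for the position on the segment, is less than
  \<open>4n - 2\<close>, the real dimension of the fibre. For the upper bound, a disjoint union of
  charts contracts to one point because a single configuration lies in all charts.\<close>

lemma continuous_map_field_mult:
  fixes f :: "'a \<Rightarrow> 'b::real_normed_algebra"
  shows "\<lbrakk>continuous_map X euclidean f; continuous_map X euclidean g\<rbrakk>
    \<Longrightarrow> continuous_map X euclidean (\<lambda>x. f x * g x)"
  by (simp add: continuous_map_atin tendsto_mult)

lemma continuous_map_field_divide:
  fixes f :: "'a \<Rightarrow> 'b::real_normed_field"
  shows "\<lbrakk>continuous_map X euclidean f; continuous_map X euclidean g; \<And>x. x \<in> topspace X \<Longrightarrow> g x \<noteq> 0\<rbrakk>
    \<Longrightarrow> continuous_map X euclidean (\<lambda>x. f x / g x)"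
  by (simp add: continuous_map_atin tendsto_divide)

lemma continuous_map_cnj:
  "continuous_map X euclidean f \<Longrightarrow> continuous_map X euclidean (\<lambda>x. cnj (f x))"
  by (simp add: continuous_map_atin tendsto_cnj)

lemma continuous_map_Re:
  "continuous_map X euclidean f \<Longrightarrow> continuous_map X euclidean (\<lambda>x. Re (f x))"
  by (simp add: continuous_map_atin tendsto_Re)

text \<open>Complex valued although real, so that it can divide complex coordinates.\<close>

definition sqnorm :: "nat \<Rightarrow> (nat \<Rightarrow> complex) \<Rightarrow> complex" where
  "sqnorm n v = (\<Sum>k\<le>n. v k * cnj (v k))"

definition nonzero :: "nat \<Rightarrow> (nat \<Rightarrow> complex) \<Rightarrow> bool" where
  "nonzero n v \<longleftrightarrow> (\<exists>k\<le>n. v k \<noteq> 0)"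

definition scaled :: "nat \<Rightarrow> complex \<Rightarrow> (nat \<Rightarrow> complex) \<Rightarrow> (nat \<Rightarrow> complex) \<Rightarrow> bool" where
  "scaled n c v w \<longleftrightarrow> (\<forall>k\<le>n. w k = c * v k)"

text \<open>Restriction turns an arbitrary function into a point of the extensional product, so
  homogeneous coordinates need not be extensional.\<close>

definition proj_point :: "nat \<Rightarrow> (nat \<Rightarrow> complex) \<Rightarrow> (nat \<Rightarrow> complex) set" where
  "proj_point n v = proportional n `` {restrict v {..n}}"

lemma sqnorm_eq: "sqnorm n v = of_real (\<Sum>k\<le>n. (cmod (v k))\<^sup>2)"
  by (simp add: sqnorm_def complex_norm_square[symmetric] del: of_real_power)

lemma sqnorm_eq_0_iff: "sqnorm n v = 0 \<longleftrightarrow> \<not> nonzero n v"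
proof -
  have "(\<Sum>k\<le>n. (cmod (v k))\<^sup>2) = 0 \<longleftrightarrow> (\<forall>k\<in>{..n}. (cmod (v k))\<^sup>2 = 0)"
    by (rule sum_nonneg_eq_0_iff) auto
  then show ?thesis unfolding sqnorm_eq of_real_eq_0_iff by (auto simp: nonzero_def)
qed

lemma topspace_punctured:
  "topspace (punctured_complex_space n) = {v \<in> extensional {..n}. nonzero n v}"
  by (auto simp: punctured_complex_space_def nonzero_def PiE_def)

lemma restrict_in_punctured_iff:
  "restrict v {..n} \<in> topspace (punctured_complex_space n) \<longleftrightarrow> nonzero n v"
  by (auto simp: topspace_punctured nonzero_def)

lemma proj_point_eq_iff:
  assumes "nonzero n v" "nonzero n w"
  shows "proj_point n v = proj_point n w \<longleftrightarrow> (\<exists>c. c \<noteq> 0 \<and> scaled n c v w)"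
proof -
  have "proj_point n v = proj_point n w \<longleftrightarrow> (restrict v {..n}, restrict w {..n}) \<in> proportional n"
    unfolding proj_point_def using assms
    by (intro eq_equiv_class_iff[OF equiv_proportional]) (auto simp: restrict_in_punctured_iff)
  also have "\<dots> \<longleftrightarrow> (\<exists>c. c \<noteq> 0 \<and> scaled n c v w)"
    using assms by (auto simp: proportional_def restrict_in_punctured_iff scaled_def)
  finally show ?thesis .
qed

lemma topspace_CP: "topspace (complex_projective_space n) = proj_point n ` {v. nonzero n v}"
proof -
  have "topspace (complex_projective_space n) = (\<lambda>v. proportional n `` {v}) ` topspace (punctured_complex_space n)"
    using quotient_imp_surjective_map[OF quotient_map_complex_projective_space] by simp
  also have "\<dots> = proj_point n ` {v. nonzero n v}"
  proof (intro equalityI subsetI)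
    fix C assume "C \<in> (\<lambda>v. proportional n `` {v}) ` topspace (punctured_complex_space n)"
    then obtain v where v: "v \<in> topspace (punctured_complex_space n)" "C = proportional n `` {v}" by auto
    then have "restrict v {..n} = v" by (simp add: topspace_punctured extensional_restrict)
    with v show "C \<in> proj_point n ` {v. nonzero n v}"
      by (auto simp: proj_point_def topspace_punctured intro!: image_eqI[of _ _ v])
  next
    fix C assume "C \<in> proj_point n ` {v. nonzero n v}"
    then show "C \<in> (\<lambda>v. proportional n `` {v}) ` topspace (punctured_complex_space n)"
      by (auto simp: proj_point_def restrict_in_punctured_iff)
  qed
  finally show ?thesis .
qed

lemma continuous_map_proj_point:
  assumes "\<And>k. k \<le> n \<Longrightarrow> continuous_map X euclidean (\<lambda>x. f x k)"
    and "\<And>x. x \<in> topspace X \<Longrightarrow> nonzero n (f x)"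
  shows "continuous_map X (complex_projective_space n) (\<lambda>x. proj_point n (f x))"
proof -
  have "continuous_map X (punctured_complex_space n) (\<lambda>x. restrict (f x) {..n})"
    unfolding punctured_complex_space_def continuous_map_in_subtopology
    using assms by (force simp: continuous_map_componentwise nonzero_def)
  then show ?thesis unfolding proj_point_def
    using continuous_map_compose[OF _ quotient_imp_continuous_map[OF quotient_map_complex_projective_space]]
    by (auto simp: o_def)
qed

text \<open>Entries of the orthogonal projection onto a line; they serve as global coordinates.\<close>

definition proj_entry :: "nat \<Rightarrow> nat \<Rightarrow> nat \<Rightarrow> (nat \<Rightarrow> complex) \<Rightarrow> complex" where
  "proj_entry n k l v = v k * cnj (v l) / sqnorm n v"

definition line_entry :: "nat \<Rightarrow> nat \<Rightarrow> nat \<Rightarrow> (nat \<Rightarrow> complex) set \<Rightarrow> complex" where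
  "line_entry n k l C = proj_entry n k l (SOME v. v \<in> C)"

lemma sqnorm_scaled: "scaled n c v w \<Longrightarrow> sqnorm n w = c * cnj c * sqnorm n v"
  by (simp add: sqnorm_def scaled_def sum_distrib_left mult.assoc mult.left_commute)

lemma proj_entry_scaled:
  assumes "scaled n c v w" "c \<noteq> 0" "k \<le> n" "l \<le> n"
  shows "proj_entry n k l w = proj_entry n k l v"
  unfolding proj_entry_def sqnorm_scaled[OF assms(1)] using assms by (simp add: scaled_def)

lemma line_entry_proj_point:
  assumes "nonzero n v" "k \<le> n" "l \<le> n"
  shows "line_entry n k l (proj_point n v) = proj_entry n k l v"
proof -
  have "restrict v {..n} \<in> proj_point n v"
    unfolding proj_point_def using assms restrict_in_punctured_iff
    by (intro equiv_class_self[OF equiv_proportional]) auto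
  then have "(SOME w. w \<in> proj_point n v) \<in> proj_point n v" by (rule someI[of "\<lambda>w. w \<in> proj_point n v"])
  then obtain c where "c \<noteq> 0" "scaled n c v (SOME w. w \<in> proj_point n v)"
    by (auto simp: proj_point_def proportional_def scaled_def)
  then show ?thesis using assms proj_entry_scaled unfolding line_entry_def by metis
qed

text \<open>Continuity on the quotient is continuity after composing with the quotient map, where
  the entry is a quotient of polynomials in the coordinates and their conjugates.\<close>

lemma continuous_map_line_entry:
  assumes "k \<le> n" "l \<le> n"
  shows "continuous_map (complex_projective_space n) euclidean (line_entry n k l)"
proof (rule continuous_compose_quotient_map[OF quotient_map_complex_projective_space])
  have pr: "continuous_map (punctured_complex_space n) euclidean (\<lambda>v. v j)" if "j \<le> n" for j
    unfolding punctured_complex_space_def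
    using that by (intro continuous_map_from_subtopology continuous_map_product_projection) auto
  have cn: "continuous_map (punctured_complex_space n) euclidean (\<lambda>v. cnj (v j))" if "j \<le> n" for j
    by (rule continuous_map_cnj[OF pr[OF that]])
  have "continuous_map (punctured_complex_space n) euclidean (\<lambda>v. proj_entry n k l v)"
    unfolding proj_entry_def sqnorm_def
    using assms sqnorm_eq_0_iff[of n]
    by (intro continuous_map_field_divide continuous_map_field_mult continuous_map_sum pr cn)
       (auto simp: topspace_punctured sqnorm_def)
  then show "continuous_map (punctured_complex_space n) euclidean (line_entry n k l \<circ> (\<lambda>v. proportional n `` {v}))"
  proof (rule continuous_map_eq)
    fix v assume "v \<in> topspace (punctured_complex_space n)"
    then have "restrict v {..n} = v" "nonzero n v" by (auto simp: topspace_punctured extensional_restrict)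
    then show "proj_entry n k l v = (line_entry n k l \<circ> (\<lambda>v. proportional n `` {v})) v"
      using line_entry_proj_point[OF _ assms, of v] by (simp add: proj_point_def)
  qed
qed

definition indep :: "nat \<Rightarrow> (nat \<Rightarrow> complex) \<Rightarrow> (nat \<Rightarrow> complex) \<Rightarrow> bool" where
  "indep n v w \<longleftrightarrow> (\<exists>i\<le>n. \<exists>j\<le>n. v i * w j \<noteq> v j * w i)"

definition conf :: "nat \<Rightarrow> (nat \<Rightarrow> complex) \<Rightarrow> (nat \<Rightarrow> complex) \<Rightarrow> nat \<Rightarrow> (nat \<Rightarrow> complex) set" where
  "conf n v w = (\<lambda>i\<in>{1..2}. if i = 1 then proj_point n v else proj_point n w)"

lemma indep_nonzero: "indep n v w \<Longrightarrow> nonzero n v \<and> nonzero n w"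
  unfolding indep_def nonzero_def by (metis mult_zero_left mult_zero_right)

text \<open>If all 2 by 2 minors vanish, the ratio at one index with \<open>v i \<noteq> 0\<close>
  is the proportionality factor at every index.\<close>

lemma indep_iff:
  assumes "nonzero n v" "nonzero n w"
  shows "indep n v w \<longleftrightarrow> proj_point n v \<noteq> proj_point n w"
proof
  assume "indep n v w"
  then show "proj_point n v \<noteq> proj_point n w"
    using proj_point_eq_iff[OF assms] by (auto simp: indep_def scaled_def)
next
  assume ne: "proj_point n v \<noteq> proj_point n w"
  show "indep n v w"
  proof (rule ccontr)
    assume "\<not> indep n v w"
    then have eq: "v i * w j = v j * w i" if "i \<le> n" "j \<le> n" for i j using that by (auto simp: indep_def)
    obtain i where i: "i \<le> n" "v i \<noteq> 0" using assms by (auto simp: nonzero_def)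
    obtain j where j: "j \<le> n" "w j \<noteq> 0" using assms by (auto simp: nonzero_def)
    have "w i \<noteq> 0" using eq[OF i(1) j(1)] i j by auto
    then have "w i / v i \<noteq> 0 \<and> scaled n (w i / v i) v w"
      using i eq[OF i(1)] by (auto simp: scaled_def field_simps)
    then show False using ne proj_point_eq_iff[OF assms] by blast
  qed
qed

lemma atLeastAtMost_1_2: "{1..2::nat} = {1, 2}" by auto

lemma topspace_conf:
  "topspace (configuration_space (complex_projective_space n) 2) = {conf n v w | v w. indep n v w}"
proof (intro equalityI subsetI)
  fix x assume "x \<in> topspace (configuration_space (complex_projective_space n) 2)"
  then have x: "x \<in> extensional {1..2}" "x 1 \<in> topspace (complex_projective_space n)"
    "x 2 \<in> topspace (complex_projective_space n)" "x 1 \<noteq> x 2"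
    by (auto simp: configuration_space_def PiE_def)
  then obtain v w where vw: "nonzero n v" "x 1 = proj_point n v" "nonzero n w" "x 2 = proj_point n w"
    by (auto simp: topspace_CP)
  then have "x = conf n v w" using x(1) unfolding conf_def atLeastAtMost_1_2
    by (auto simp: fun_eq_iff extensional_def)
  moreover have "indep n v w" using vw x(4) indep_iff by metis
  ultimately show "x \<in> {conf n v w | v w. indep n v w}" by blast
next
  fix x assume "x \<in> {conf n v w | v w. indep n v w}"
  then obtain v w where x: "x = conf n v w" and i: "indep n v w" by blast
  then have "nonzero n v" "nonzero n w" "proj_point n v \<noteq> proj_point n w" using indep_nonzero indep_iff by blast+
  then show "x \<in> topspace (configuration_space (complex_projective_space n) 2)"
    unfolding x configuration_space_def conf_def atLeastAtMost_1_2
    by (auto simp: topspace_CP)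
qed

lemma conf_simps [simp]: "conf n v w 1 = proj_point n v" "conf n v w (Suc 0) = proj_point n v" "conf n v w 2 = proj_point n w"
  by (auto simp: conf_def)

lemma conf_eq_iff:
  assumes "indep n v w" "indep n v' w'"
  shows "conf n v w = conf n v' w' \<longleftrightarrow>
    (\<exists>a b. a \<noteq> 0 \<and> b \<noteq> 0 \<and> scaled n a v v' \<and> scaled n b w w')"
proof -
  have "conf n v w = conf n v' w' \<longleftrightarrow> proj_point n v = proj_point n v' \<and> proj_point n w = proj_point n w'"
    by (metis conf_def conf_simps(2,3) conf_simps(1))
  then show ?thesis using assms indep_nonzero proj_point_eq_iff by metis
qed

text \<open>The way to build maps into the configuration space: continuous homogeneous coordinates
  that stay independent.\<close>

lemma continuous_map_conf:
  assumes "\<And>k. k \<le> n \<Longrightarrow> continuous_map X euclidean (\<lambda>x. f x k)"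
    and "\<And>k. k \<le> n \<Longrightarrow> continuous_map X euclidean (\<lambda>x. g x k)"
    and "\<And>x. x \<in> topspace X \<Longrightarrow> indep n (f x) (g x)"
  shows "continuous_map X (configuration_space (complex_projective_space n) 2) (\<lambda>x. conf n (f x) (g x))"
proof -
  have "continuous_map X (product_topology (\<lambda>_. complex_projective_space n) {1..2}) (\<lambda>x. conf n (f x) (g x))"
    unfolding continuous_map_componentwise atLeastAtMost_1_2
    using assms indep_nonzero[OF assms(3)]
    by (auto simp: conf_def intro!: continuous_map_proj_point)
  moreover have "conf n (f x) (g x) \<in> topspace (configuration_space (complex_projective_space n) 2)"
    if "x \<in> topspace X" for x using assms(3)[OF that] by (auto simp: topspace_conf)
  ultimately show ?thesis
    by (auto simp: configuration_space_def continuous_map_in_subtopology image_subset_iff)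
qed

lemma continuous_map_conf_entry:
  assumes "k \<le> n" "l \<le> n" "i \<in> {1, 2}"
  shows "continuous_map (configuration_space (complex_projective_space n) 2) euclidean (\<lambda>x. line_entry n k l (x i))"
proof -
  have "continuous_map (configuration_space (complex_projective_space n) 2) (complex_projective_space n) (\<lambda>x. x i)"
    unfolding configuration_space_def using assms
    by (intro continuous_map_from_subtopology continuous_map_product_projection) auto
  then show ?thesis
    using continuous_map_compose[OF _ continuous_map_line_entry[OF assms(1,2)]] by (auto simp: o_def)
qed

section \<open>Avoiding images of small dimension\<close>

lemma abs_triangle3:
  fixes p q :: real
  assumes "\<bar>f - p\<bar> < a" "\<bar>f' - q\<bar> < b" "\<bar>f - f'\<bar> \<le> c"
  shows "\<bar>p - q\<bar> < a + b + c"
  using assms by linarith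

text \<open>Quantitative form of the fact that a Lipschitz image of a
  \<open>card I\<close>-dimensional set cannot fill a cube of dimension \<open>card J\<close>. By
  pigeonhole, the \<open>R ^ card J\<close> points of a grid in the cube cannot all be close to the
  image, which is controlled by at most \<open>(2 * A * R) ^ card I\<close> boxes. The gap
  \<open>\<delta>\<close> is uniform in \<open>z\<close>, which lets several sets be treated in
  turn.\<close>

lemma avoid_thin_image:
  fixes a :: "'i \<Rightarrow> 'z \<Rightarrow> real" and F :: "'j \<Rightarrow> 'z \<Rightarrow> real"
  assumes fin: "finite I" "finite J" and card: "card I < card J"
    and bnd: "\<And>i z. \<lbrakk>i \<in> I; z \<in> Z\<rbrakk> \<Longrightarrow> \<bar>a i z\<bar> \<le> B"
    and Lip: "\<And>j z z' \<eta>. \<lbrakk>j \<in> J; z \<in> Z; z' \<in> Z; 0 \<le> \<eta>; \<And>i. i \<in> I \<Longrightarrow> \<bar>a i z - a i z'\<bar> \<le> \<eta>\<rbrakk>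
                \<Longrightarrow> \<bar>F j z - F j z'\<bar> \<le> C * \<eta>"
    and "\<epsilon> > 0"
  obtains c \<delta> where "\<delta> > 0" "\<And>j. j \<in> J \<Longrightarrow> 0 \<le> c j \<and> c j < \<epsilon>"
    "\<And>z. z \<in> Z \<Longrightarrow> \<exists>j\<in>J. \<delta> \<le> \<bar>F j z - c j\<bar>"
proof -
  define b where "b = max B 1"
  define C' where "C' = max C 1"
  define A where "A = nat \<lceil>4 * b * C' / \<epsilon>\<rceil> + 1"
  have b: "b \<ge> 1" and C': "C' \<ge> 1" "C \<le> C'" by (auto simp: b_def C'_def)
  have bnd': "\<bar>a i z\<bar> \<le> b" if "i \<in> I" "z \<in> Z" for i z
    using bnd[OF that] by (simp add: b_def)
  have A: "4 * b * C' / \<epsilon> \<le> real A" "A \<ge> 1" unfolding A_def by linarith+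
  \<comment> \<open>\<open>A\<close> does not involve \<open>R\<close>, so \<open>R\<close> can be
    taken just above \<open>(2 * A) ^ card I\<close>, the value beyond which counting grid points
    against boxes gives a contradiction.\<close>
  define R where "R = (2 * A) ^ card I + 1"
  define K where "K = A * R"
  have R: "R \<ge> 1" by (simp add: R_def)
  have K: "K \<ge> 1" using A(2) R by (simp add: K_def)
  \<comment> \<open>\<open>box z\<close> indexes the cell containing the coordinates of
    \<open>z\<close> when each side of \<open>[-b, b]\<close> is cut into \<open>K\<close> parts;
    inside a cell \<open>F\<close> varies by at most half the grid spacing
    \<open>\<epsilon> / R\<close>.\<close>
  define box where "box z = (\<lambda>i\<in>I. nat \<lfloor>(a i z + b) / (2 * b) * K\<rfloor>)" for z
  have box_range: "box z \<in> PiE I (\<lambda>_. {..K})" if "z \<in> Z" for z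
  proof -
    have "nat \<lfloor>(a i z + b) / (2 * b) * K\<rfloor> \<le> K" if "i \<in> I" for i
    proof -
      have "(a i z + b) / (2 * b) \<le> 1" using bnd'[OF that \<open>z \<in> Z\<close>] b by (simp add: divide_simps)
      then have "(a i z + b) / (2 * b) * K \<le> 1 * real K" by (rule mult_right_mono) simp
      then show ?thesis by linarith
    qed
    then show ?thesis by (auto simp: box_def)
  qed
  have box_eq: "\<bar>F j z - F j z'\<bar> \<le> \<epsilon> / (2 * R)" if "box z = box z'" "z \<in> Z" "z' \<in> Z" "j \<in> J" for z z' j
  proof -
    have "\<bar>a i z - a i z'\<bar> \<le> 2 * b / K" if i: "i \<in> I" for i
    proof -
      let ?x = "(a i z + b) / (2 * b) * K" and ?y = "(a i z' + b) / (2 * b) * K"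
      have "nat \<lfloor>?x\<rfloor> = nat \<lfloor>?y\<rfloor>" using fun_cong[OF \<open>box z = box z'\<close>, of i] i by (simp add: box_def)
      moreover have "?x \<ge> 0" "?y \<ge> 0"
        using bnd'[OF i \<open>z \<in> Z\<close>] bnd'[OF i \<open>z' \<in> Z\<close>] b by (auto intro!: mult_nonneg_nonneg divide_nonneg_pos)
      ultimately have "\<lfloor>?x\<rfloor> = \<lfloor>?y\<rfloor>" by (simp add: eq_nat_nat_iff)
      then have "\<bar>?x - ?y\<bar> \<le> 1" by linarith
      moreover have "?x - ?y = (a i z - a i z') * (K / (2 * b))" using b by (simp add: field_simps)
      ultimately have "\<bar>a i z - a i z'\<bar> * (K / (2 * b)) \<le> 1"
        using b by (simp add: abs_mult)
      then show ?thesis using b K by (simp add: field_simps)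
    qed
    then have "\<bar>F j z - F j z'\<bar> \<le> C * (2 * b / K)" using that b by (intro Lip) auto
    also have "\<dots> \<le> C' * (2 * b / K)" using C' b by (intro mult_right_mono) auto
    also have "\<dots> = (4 * b * C' / \<epsilon>) * (\<epsilon> / (2 * K))" using \<open>\<epsilon> > 0\<close> by simp
    also have "\<dots> \<le> A * (\<epsilon> / (2 * K))" using A \<open>\<epsilon> > 0\<close> by (intro mult_right_mono) auto
    also have "\<dots> = \<epsilon> / (2 * R)" using A by (simp add: K_def)
    finally show ?thesis .
  qed
  define G where "G = PiE J (\<lambda>_. {..<R})"
  define pt where "pt g j = \<epsilon> / R * real (g j)" for g :: "'j \<Rightarrow> nat" and j
  have "\<exists>g\<in>G. \<forall>z\<in>Z. \<exists>j\<in>J. \<epsilon> / (4 * R) \<le> \<bar>F j z - pt g j\<bar>"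
  proof (rule ccontr)
    assume "\<not> ?thesis"
    then obtain \<zeta> where \<zeta>: "\<And>g. g \<in> G \<Longrightarrow> \<zeta> g \<in> Z"
      and close: "\<And>g j. \<lbrakk>g \<in> G; j \<in> J\<rbrakk> \<Longrightarrow> \<bar>F j (\<zeta> g) - pt g j\<bar> < \<epsilon> / (4 * R)"
      by (simp add: not_le) metis
    have "inj_on (\<lambda>g. box (\<zeta> g)) G"
    proof (rule inj_onI)
      fix g g' assume g: "g \<in> G" "g' \<in> G" and eq: "box (\<zeta> g) = box (\<zeta> g')"
      have "g j = g' j" if j: "j \<in> J" for j
      proof -
        \<comment> \<open>Both grid points are within a quarter of the spacing of values that differ
          by at most half of it, so they are less than one spacing apart and coincide.\<close>
        have "\<bar>pt g j - pt g' j\<bar> < \<epsilon> / (4 * R) + \<epsilon> / (4 * R) + \<epsilon> / (2 * R)"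
          using close[OF g(1) j] close[OF g(2) j] box_eq[OF eq \<zeta>[OF g(1)] \<zeta>[OF g(2)] j]
          by (rule abs_triangle3)
        also have "\<dots> = \<epsilon> / R" using R by (simp add: field_simps)
        also have "pt g j - pt g' j = \<epsilon> / R * (real (g j) - real (g' j))" by (simp add: pt_def algebra_simps)
        finally have "\<epsilon> / R * \<bar>real (g j) - real (g' j)\<bar> < \<epsilon> / R * 1"
          using R \<open>\<epsilon> > 0\<close> by (simp add: abs_mult)
        then have "\<bar>real (g j) - real (g' j)\<bar> < 1" using R \<open>\<epsilon> > 0\<close> by (simp add: mult_less_cancel_left divide_simps split: if_splits)
        then show ?thesis by linarith
      qed
      then show "g = g'" using g unfolding G_def by (intro PiE_ext)
    qed
    moreover have "(\<lambda>g. box (\<zeta> g)) ` G \<subseteq> PiE I (\<lambda>_. {..K})" using box_range \<zeta> by blast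
    ultimately have "card G \<le> card (PiE I (\<lambda>_. {..K}))"
      using fin by (intro card_inj_on_le finite_PiE) auto
    then have "R ^ card J \<le> (K + 1) ^ card I" using fin by (simp add: G_def card_PiE)
    moreover have "R ^ (card I + 1) \<le> R ^ card J" using card R by (intro power_increasing) auto
    moreover have "(K + 1) ^ card I \<le> (2 * A * R) ^ card I" using K by (intro power_mono) (auto simp: K_def)
    ultimately have "R * R ^ card I \<le> (2 * A * R) ^ card I" by simp
    then have "R * R ^ card I \<le> (2 * A) ^ card I * R ^ card I" unfolding power_mult_distrib[of "2 * A" R] .
    then have "R \<le> (2 * A) ^ card I" using R by (subst (asm) mult_le_cancel2) auto
    then show False by (simp add: R_def)
  qed
  then obtain g where g: "g \<in> G" "\<forall>z\<in>Z. \<exists>j\<in>J. \<epsilon> / (4 * R) \<le> \<bar>F j z - pt g j\<bar>" by blast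
  show ?thesis
  proof
    show "\<epsilon> / (4 * R) > 0" using R \<open>\<epsilon> > 0\<close> by simp
    show "0 \<le> pt g j \<and> pt g j < \<epsilon>" if "j \<in> J" for j
    proof -
      have "g j < R" using g that by (auto simp: G_def)
      then show ?thesis using \<open>\<epsilon> > 0\<close> by (simp add: pt_def divide_simps)
    qed
    show "\<exists>j\<in>J. \<epsilon> / (4 * R) \<le> \<bar>F j z - pt g j\<bar>" if "z \<in> Z" for z using g that by blast
  qed
qed

text \<open>Inf-convolution with the distance pulled back along the separating family.\<close>

lemma lipschitz_approximation:
  fixes h :: "'a::topological_space \<Rightarrow> real" and e :: "'i \<Rightarrow> 'a \<Rightarrow> complex"
  assumes Q: "compact Q" and h: "continuous_on Q h" and fin: "finite J"
    and e: "\<And>a. a \<in> J \<Longrightarrow> continuous_on Q (e a)"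
    and sep: "\<And>x y. \<lbrakk>x \<in> Q; y \<in> Q; \<And>a. a \<in> J \<Longrightarrow> e a x = e a y\<rbrakk> \<Longrightarrow> h x = h y"
    and "\<epsilon> > 0"
  obtains g L where "L \<ge> 0" "\<And>x. x \<in> Q \<Longrightarrow> \<bar>g x - h x\<bar> \<le> \<epsilon>"
    "\<And>x y. \<lbrakk>x \<in> Q; y \<in> Q\<rbrakk> \<Longrightarrow> \<bar>g x - g y\<bar> \<le> L * (\<Sum>a\<in>J. cmod (e a x - e a y))"
proof (cases "Q = {}")
  case True
  then show ?thesis using that[of 0 "\<lambda>_. 0"] by simp
next
  case False
  define d where "d x y = (\<Sum>a\<in>J. cmod (e a x - e a y))" for x y
  have d_nonneg: "d x y \<ge> 0" for x y by (simp add: d_def sum_nonneg)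
  have d_self: "d x x = 0" for x by (simp add: d_def)
  have d_tri: "d x z \<le> d x y + d y z" for x y z
    unfolding d_def by (simp add: sum.distrib[symmetric] sum_mono norm_diff_triangle_ineq[of "e _ x" "e _ y" "e _ y" "e _ z", simplified] norm_triangle_sub
        dist_norm[symmetric] dist_triangle)
  have d_sym: "d x y = d y x" for x y by (simp add: d_def norm_minus_commute)
  obtain M where M: "\<And>x. x \<in> Q \<Longrightarrow> \<bar>h x\<bar> \<le> M"
    using compact_imp_bounded[OF compact_continuous_image[OF h Q]]
    by (auto simp: bounded_iff)
  have M0: "M \<ge> 0" using M False by fastforce
  \<comment> \<open>The pairs on which \<open>h\<close> drops by at least \<open>\<epsilon>\<close>
    form a compact set \<open>D\<close>, where \<open>d\<close> is bounded below by a positive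
    number because of \<open>sep\<close>. A large \<open>L\<close> serves on \<open>D\<close>;
    outside \<open>D\<close> the term \<open>\<epsilon>\<close> alone suffices.\<close>
  have "\<exists>L\<ge>0. \<forall>x\<in>Q. \<forall>y\<in>Q. h x \<le> h y + L * d x y + \<epsilon>"
  proof -
    define D where "D = {p \<in> Q \<times> Q. h (fst p) - h (snd p) \<ge> \<epsilon>}"
    have hh: "continuous_on (Q \<times> Q) (\<lambda>p. h (fst p) - h (snd p))"
      by (intro continuous_intros continuous_on_compose2[OF h]) auto
    have dd: "continuous_on (Q \<times> Q) (\<lambda>p. d (fst p) (snd p))" unfolding d_def
      by (intro continuous_intros continuous_on_compose2[OF e]) auto
    have "compact D"
    proof -
      have "closedin (top_of_set (Q \<times> Q)) ((Q \<times> Q) \<inter> (\<lambda>p. h (fst p) - h (snd p)) -` {\<epsilon>..})"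
        by (rule continuous_closedin_preimage[OF hh]) simp
      moreover have "D = (Q \<times> Q) \<inter> (\<lambda>p. h (fst p) - h (snd p)) -` {\<epsilon>..}" by (auto simp: D_def)
      ultimately show ?thesis using Q closedin_compact compact_Times by metis
    qed
    show ?thesis
    proof (cases "D = {}")
      case True
      then have "\<forall>x\<in>Q. \<forall>y\<in>Q. h x \<le> h y + 0 * d x y + \<epsilon>" by (force simp: D_def)
      then show ?thesis by blast
    next
      case False
      obtain p where p: "p \<in> D" "\<And>q. q \<in> D \<Longrightarrow> d (fst p) (snd p) \<le> d (fst q) (snd q)"
        using continuous_attains_inf[OF \<open>compact D\<close> False continuous_on_subset[OF dd]] by (auto simp: D_def)
      have "d (fst p) (snd p) > 0"
      proof (rule ccontr)
        assume "\<not> ?thesis"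
        then have "d (fst p) (snd p) = 0" using d_nonneg by (metis antisym_conv1)
        then have "\<And>a. a \<in> J \<Longrightarrow> e a (fst p) = e a (snd p)"
          using fin by (simp add: d_def sum_nonneg_eq_0_iff)
        then have "h (fst p) = h (snd p)" using p(1) by (intro sep) (auto simp: D_def)
        with p(1) \<open>\<epsilon> > 0\<close> show False by (simp add: D_def)
      qed
      \<comment> \<open>\<open>2 * M\<close> bounds every difference of values of \<open>h\<close>,
        and the denominator is the minimum of \<open>d\<close> on \<open>D\<close>.\<close>
      define L where "L = 2 * M / d (fst p) (snd p)"
      have "h x \<le> h y + L * d x y + \<epsilon>" if xy: "x \<in> Q" "y \<in> Q" for x y
      proof (cases "(x, y) \<in> D")
        case True
        have "2 * M = L * d (fst p) (snd p)" using \<open>d (fst p) (snd p) > 0\<close> by (simp add: L_def)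
        also have "\<dots> \<le> L * d x y" using p(2)[OF True] M0 \<open>d (fst p) (snd p) > 0\<close>
          by (intro mult_left_mono) (auto simp: L_def)
        finally show ?thesis using M[OF xy(1)] M[OF xy(2)] \<open>\<epsilon> > 0\<close> by linarith
      next
        case False
        moreover have "L * d x y \<ge> 0" using M0 d_nonneg by (simp add: L_def)
        ultimately show ?thesis using xy by (auto simp: D_def)
      qed
      moreover have "L \<ge> 0" using M0 d_nonneg by (simp add: L_def)
      ultimately show ?thesis by blast
    qed
  qed
  then obtain L where L: "L \<ge> 0" "\<And>x y. \<lbrakk>x \<in> Q; y \<in> Q\<rbrakk> \<Longrightarrow> h x \<le> h y + L * d x y + \<epsilon>" by blast
  define g where "g x = (INF y\<in>Q. h y + L * d x y)" for x
  have bdd: "bdd_below ((\<lambda>y. h y + L * d x y) ` Q)" for x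
  proof (rule bdd_belowI2)
    fix y assume "y \<in> Q"
    then show "- M \<le> h y + L * d x y" using M[of y] L(1) d_nonneg[of x y] by (smt (verit) mult_nonneg_nonneg)
  qed
  have g_le: "g x \<le> h y + L * d x y" if "y \<in> Q" for x y
    unfolding g_def by (rule cINF_lower[OF bdd that])
  have g_lip: "g x \<le> g y + L * d x y" if "x \<in> Q" "y \<in> Q" for x y
  proof -
    have "g x - L * d x y \<le> h z + L * d y z" if "z \<in> Q" for z
    proof -
      have "L * d x z \<le> L * d x y + L * d y z"
        using mult_left_mono[OF d_tri L(1)] by (simp add: algebra_simps)
      then show ?thesis using g_le[OF that, of x] by linarith
    qed
    then have "g x - L * d x y \<le> g y" unfolding g_def[of y] by (intro cINF_greatest False)
    then show ?thesis by linarith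
  qed
  show ?thesis
  proof
    show "L \<ge> 0" by fact
    show "\<bar>g x - h x\<bar> \<le> \<epsilon>" if x: "x \<in> Q" for x
    proof -
      have "g x \<le> h x" using g_le[OF x, of x] by (simp add: d_self)
      moreover have "h x - \<epsilon> \<le> g x" unfolding g_def
        using L(2)[OF x] by (intro cINF_greatest False) (simp add: algebra_simps)
      ultimately show ?thesis using \<open>\<epsilon> > 0\<close> by linarith
    qed
    show "\<bar>g x - g y\<bar> \<le> L * (\<Sum>a\<in>J. cmod (e a x - e a y))" if "x \<in> Q" "y \<in> Q" for x y
      using g_lip[OF that] g_lip[OF that(2,1)] by (simp add: d_sym flip: d_def)
  qed
qed

section \<open>The categorical cover\<close>

text \<open>On disjoint open sets the overlap condition for gluing is vacuous. All pieces must end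
  in the same map \<open>g\<close>, which is why the charts are contracted to a common
  point.\<close>

lemma homotopic_with_disjoint_Union:
  assumes op: "\<And>i. i \<in> I \<Longrightarrow> openin X (V i)"
    and disj: "\<And>i j. \<lbrakk>i \<in> I; j \<in> I; i \<noteq> j\<rbrakk> \<Longrightarrow> V i \<inter> V j = {}"
    and hom: "\<And>i. i \<in> I \<Longrightarrow> homotopic_with (\<lambda>_. True) (subtopology X (V i)) Y f g"
  shows "homotopic_with (\<lambda>_. True) (subtopology X (\<Union>i\<in>I. V i)) Y f g"
proof -
  have "\<forall>i. \<exists>h. i \<in> I \<longrightarrow> continuous_map (prod_topology (top_of_set {0..1::real}) (subtopology X (V i))) Y h \<and>
          (\<forall>x. h (0, x) = f x) \<and> (\<forall>x. h (1, x) = g x)"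
    using hom unfolding homotopic_with_def by blast
  then obtain h where h: "\<And>i. i \<in> I \<Longrightarrow> continuous_map (prod_topology (top_of_set {0..1::real}) (subtopology X (V i))) Y (h i)"
    and h0: "\<And>i x. i \<in> I \<Longrightarrow> h i (0, x) = f x" and h1: "\<And>i x. i \<in> I \<Longrightarrow> h i (1, x) = g x"
    by metis
  define W where "W = (\<Union>i\<in>I. V i)"
  define P where "P = prod_topology (top_of_set {0..1::real}) (subtopology X W)"
  define j where "j x = (SOME i. i \<in> I \<and> x \<in> V i)" for x
  have j: "j x \<in> I \<and> x \<in> V (j x)" if "x \<in> W" for x
    using that unfolding j_def W_def by (intro someI_ex[of "\<lambda>i. i \<in> I \<and> x \<in> V i"]) auto
  have "continuous_map P Y (\<lambda>p. h (j (snd p)) p)"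
  proof (rule pasting_lemma[where I = I and T = "\<lambda>i. {0..1} \<times> V i" and f = h])
    fix i assume i: "i \<in> I"
    have WV: "W \<inter> V i = V i" using i by (auto simp: W_def)
    then have "openin (subtopology X W) (V i)" using openin_subtopology_Int2[OF op[OF i], of W] by simp
    then show "openin P ({0..1} \<times> V i)" by (simp add: P_def openin_prod_Times_iff)
    have "subtopology P ({0..1} \<times> V i) =
        prod_topology (subtopology (top_of_set {0..1}) {0..1}) (subtopology (subtopology X W) (V i))"
      unfolding P_def by (rule subtopology_Times)
    also have "\<dots> = prod_topology (top_of_set {0..1::real}) (subtopology X (V i))"
      by (simp add: subtopology_subtopology WV)
    finally have "subtopology P ({0..1} \<times> V i) = prod_topology (top_of_set {0..1::real}) (subtopology X (V i))" .
    then show "continuous_map (subtopology P ({0..1} \<times> V i)) Y (h i)" using h[OF i] by simp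
  next
    fix i k x assume "i \<in> I" "k \<in> I" "x \<in> topspace P \<inter> {0..1} \<times> V i \<inter> {0..1} \<times> V k"
    then have "i = k" using disj[of i k] by auto
    then show "h i x = h k x" by simp
  next
    fix x assume "x \<in> topspace P"
    then show "\<exists>i. i \<in> I \<and> x \<in> {0..1} \<times> V i \<and> h (j (snd x)) x = h i x"
      using j[of "snd x"] by (intro exI[of _ "j (snd x)"]) (auto simp: P_def)
  qed
  moreover have "h (j x) (0, x) = f x" "h (j x) (1, x) = g x" if "x \<in> W" for x
    using j[OF that] h0 h1 by auto
  ultimately show ?thesis
    unfolding W_def[symmetric] P_def
    by (subst homotopic_with) (auto intro!: exI[of _ "\<lambda>p. h (j (snd p)) p"])
qed

abbreviation confCP :: "nat \<Rightarrow> (nat \<Rightarrow> (nat \<Rightarrow> complex) set) topology" where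
  "confCP n \<equiv> configuration_space (complex_projective_space n) 2"

text \<open>The squared modulus of \<open>v\<^sub>i (v\<^sub>i w\<^sub>j - v\<^sub>j w\<^sub>i)\<close>, normalised to be scale invariant.\<close>

definition chart_fun :: "nat \<Rightarrow> nat \<Rightarrow> nat \<Rightarrow> (nat \<Rightarrow> (nat \<Rightarrow> complex) set) \<Rightarrow> real" where
  "chart_fun n i j x = (let P = (\<lambda>k l. line_entry n k l (x 1)); R = (\<lambda>k l. line_entry n k l (x 2)) in
     Re (P i i * (P i i * R j j + P j j * R i i - P i j * R j i - P j i * R i j)))"

lemma continuous_map_chart_fun:
  assumes "i \<le> n" "j \<le> n"
  shows "continuous_map (confCP n) euclideanreal (chart_fun n i j)"
  unfolding chart_fun_def Let_def using assms
  by (intro continuous_map_Re continuous_map_field_mult continuous_map_add continuous_map_diff continuous_map_conf_entry) auto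

lemma Re_sqnorm_pos:
  assumes "nonzero n v"
  shows "Re (sqnorm n v) > 0"
proof -
  have "Re (sqnorm n v) = (\<Sum>k\<le>n. (cmod (v k))\<^sup>2)" by (simp add: sqnorm_eq)
  moreover have "Re (sqnorm n v) \<noteq> 0"
    using assms sqnorm_eq_0_iff[of n v] unfolding sqnorm_eq of_real_eq_0_iff Re_complex_of_real by blast
  moreover have "(\<Sum>k\<le>n. (cmod (v k))\<^sup>2) \<ge> 0" by (simp add: sum_nonneg)
  ultimately show ?thesis by linarith
qed

text \<open>Substituting \<open>v k * cnj (v l)\<close> for the entries, up to the norms, factors
  the expression into \<open>v i * (v i * w j - v j * w i)\<close> times its conjugate.\<close>

lemma chart_fun_conf:
  assumes "indep n v w" "i \<le> n" "j \<le> n"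
  shows "chart_fun n i j (conf n v w) =
    (cmod (v i * (v i * w j - v j * w i)))\<^sup>2 / ((Re (sqnorm n v))\<^sup>2 * Re (sqnorm n w))"
proof -
  have nz: "nonzero n v" "nonzero n w" using indep_nonzero[OF assms(1)] by auto
  have identity: "(a * a' / A) * ((a * a' / A) * (d * d' / B) + (b * b' / A) * (c * c' / B)
      - (a * b' / A) * (d * c' / B) - (b * a' / A) * (c * d' / B))
      = (a * (a * d - b * c)) * (a' * (a' * d' - b' * c')) / (A\<^sup>2 * B)"
    if "A \<noteq> 0" "B \<noteq> 0" for a a' b b' c c' d d' A B :: complex
    using that by (simp add: divide_simps) (simp add: algebra_simps power2_eq_square)
  define a b where "a = Re (sqnorm n v)" and "b = Re (sqnorm n w)"
  then have sq: "sqnorm n v = of_real a" "sqnorm n w = of_real b"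
    by (simp_all add: sqnorm_eq)
  have nz': "sqnorm n v \<noteq> 0" "sqnorm n w \<noteq> 0" using nz sqnorm_eq_0_iff by auto
  let ?m = "v i * (v i * w j - v j * w i)"
  have "chart_fun n i j (conf n v w) = Re ((?m * cnj ?m) / ((sqnorm n v)\<^sup>2 * sqnorm n w))"
    unfolding chart_fun_def Let_def conf_simps
      line_entry_proj_point[OF nz(1) assms(2,2)] line_entry_proj_point[OF nz(1) assms(2,3)]
      line_entry_proj_point[OF nz(1) assms(3,2)] line_entry_proj_point[OF nz(1) assms(3,3)]
      line_entry_proj_point[OF nz(2) assms(2,2)] line_entry_proj_point[OF nz(2) assms(2,3)]
      line_entry_proj_point[OF nz(2) assms(3,2)] line_entry_proj_point[OF nz(2) assms(3,3)]
      proj_entry_def identity[OF nz'] by simp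
  also have "(?m * cnj ?m) / ((sqnorm n v)\<^sup>2 * sqnorm n w) =
      of_real ((cmod ?m)\<^sup>2 / (a\<^sup>2 * b))"
    unfolding complex_norm_square[symmetric] sq by simp
  finally show ?thesis by (simp add: a_def b_def)
qed

lemma chart_fun_conf_pos:
  assumes "indep n v w" "i \<le> n" "j \<le> n"
  shows "chart_fun n i j (conf n v w) > 0 \<longleftrightarrow> v i \<noteq> 0 \<and> v i * w j \<noteq> v j * w i"
proof -
  have "(Re (sqnorm n v))\<^sup>2 * Re (sqnorm n w) > 0"
    using indep_nonzero[OF assms(1)] Re_sqnorm_pos by (simp add: less_imp_neq[symmetric])
  then show ?thesis unfolding chart_fun_conf[OF assms] zero_less_divide_iff by auto
qed

section \<open>Contractible charts around pairs of coordinate lines\<close>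

definition chart_dom :: "nat \<Rightarrow> nat \<Rightarrow> nat \<Rightarrow> (nat \<Rightarrow> (nat \<Rightarrow> complex) set) set" where
  "chart_dom n i j = {x \<in> topspace (confCP n). chart_fun n i j x > 0}"

lemma openin_chart_dom: "i \<le> n \<Longrightarrow> j \<le> n \<Longrightarrow> openin (confCP n) (chart_dom n i j)"
  unfolding chart_dom_def
  using openin_continuous_map_preimage[OF continuous_map_chart_fun, of i n j "{0<..}"] by simp

text \<open>Columns of the projections give continuous generators. Column \<open>i\<close> works for
  the first line as \<open>v i \<noteq> 0\<close>. For the second line no single column works on the
  whole chart; the combination used for \<open>W\<close> is \<open>w\<close> times a factor
  containing the conjugate of the minor \<open>v i * w j - v j * w i\<close>, which is nonzero
  there.\<close>

lemma chart_lift: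
  assumes "i \<le> n" "j \<le> n"
  obtains V W where
    "\<And>k. k \<le> n \<Longrightarrow> continuous_map (subtopology (confCP n) (chart_dom n i j)) euclidean (\<lambda>x. V x k)"
    "\<And>k. k \<le> n \<Longrightarrow> continuous_map (subtopology (confCP n) (chart_dom n i j)) euclidean (\<lambda>x. W x k)"
    "\<And>x. x \<in> chart_dom n i j \<Longrightarrow> x = conf n (V x) (W x)"
    "\<And>x. x \<in> chart_dom n i j \<Longrightarrow> indep n (V x) (W x)"
    "\<And>x. x \<in> chart_dom n i j \<Longrightarrow> V x i \<noteq> 0 \<and> V x i * W x j \<noteq> V x j * W x i"
proof -
  define V where "V x k = line_entry n k i (x 1)" for x :: "nat \<Rightarrow> (nat \<Rightarrow> complex) set" and k
  define W where "W x k = line_entry n k j (x 2) * line_entry n i i (x 1) - line_entry n k i (x 2) * line_entry n i j (x 1)"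
    for x :: "nat \<Rightarrow> (nat \<Rightarrow> complex) set" and k
  show ?thesis
  proof
    show "continuous_map (subtopology (confCP n) (chart_dom n i j)) euclidean (\<lambda>x. V x k)" if "k \<le> n" for k
      unfolding V_def using that assms by (intro continuous_map_from_subtopology continuous_map_conf_entry) auto
    show "continuous_map (subtopology (confCP n) (chart_dom n i j)) euclidean (\<lambda>x. W x k)" if "k \<le> n" for k
      unfolding W_def using that assms
      by (intro continuous_map_from_subtopology continuous_map_diff continuous_map_field_mult continuous_map_conf_entry) auto
    fix x assume x: "x \<in> chart_dom n i j"
    then obtain v w where vw: "x = conf n v w" "indep n v w" by (auto simp: chart_dom_def topspace_conf)
    have pos: "v i \<noteq> 0" "v i * w j \<noteq> v j * w i"
      using x chart_fun_conf_pos[OF vw(2) assms] vw by (auto simp: chart_dom_def)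
    have nz: "nonzero n v" "nonzero n w" using indep_nonzero[OF vw(2)] by auto
    then have sq: "sqnorm n v \<noteq> 0" "sqnorm n w \<noteq> 0" using sqnorm_eq_0_iff by auto
    define a where "a = cnj (v i) / sqnorm n v"
    define b where "b = v i * cnj (v i * w j - v j * w i) / (sqnorm n v * sqnorm n w)"
    have "cnj (v i * w j - v j * w i) \<noteq> 0" using pos by (simp only: complex_cnj_zero_iff) simp
    then have ab: "a \<noteq> 0" "b \<noteq> 0" using sq pos by (auto simp: a_def b_def)
    have V: "V x k = a * v k" if "k \<le> n" for k
      using that nz assms by (simp add: V_def vw line_entry_proj_point proj_entry_def a_def)
    have W: "W x k = b * w k" if "k \<le> n" for k
      using that nz assms sq by (simp add: W_def vw line_entry_proj_point proj_entry_def b_def field_simps)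
    have m: "V x k * W x l - V x l * W x k = a * b * (v k * w l - v l * w k)" if "k \<le> n" "l \<le> n" for k l
      using that by (simp add: V W algebra_simps)
    have "V x i * W x j - V x j * W x i \<noteq> 0" unfolding m[OF assms] using ab pos by simp
    then show "V x i \<noteq> 0 \<and> V x i * W x j \<noteq> V x j * W x i" using V[OF assms(1)] ab pos by auto
    then show ind: "indep n (V x) (W x)" using assms by (auto simp: indep_def)
    have "scaled n a v (V x)" "scaled n b w (W x)" by (auto simp: scaled_def V W)
    then show "x = conf n (V x) (W x)" using ab conf_eq_iff[OF vw(2) ind] vw(1) by blast
  qed
qed

abbreviation unit_vec :: "nat \<Rightarrow> nat \<Rightarrow> complex" where
  "unit_vec i \<equiv> (\<lambda>k. if k = i then 1 else 0)"

lemma continuous_map_snd_comp: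
  "continuous_map Y Z f \<Longrightarrow> continuous_map (prod_topology X Y) Z (\<lambda>p. f (snd p))"
  using continuous_map_compose[OF continuous_map_snd] by (auto simp: o_def)

text \<open>Along the homotopy the \<open>(i, j)\<close> minor of the moving pair keeps the value
  \<open>v i * (v i * w j - v j * w i)\<close>, so the two lines never meet.\<close>

lemma chart_dom_nullhomotopic:
  assumes ij: "i \<le> n" "j \<le> n" "i \<noteq> j"
  shows "homotopic_with (\<lambda>_. True) (subtopology (confCP n) (chart_dom n i j)) (confCP n)
           id (\<lambda>_. conf n (unit_vec i) (unit_vec j))"
proof -
  define S where "S = subtopology (confCP n) (chart_dom n i j)"
  have topS: "topspace S = chart_dom n i j" by (auto simp: S_def chart_dom_def)
  obtain V W where
    contV: "\<And>k. k \<le> n \<Longrightarrow> continuous_map S euclidean (\<lambda>x. V x k)" and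
    contW: "\<And>k. k \<le> n \<Longrightarrow> continuous_map S euclidean (\<lambda>x. W x k)" and
    eq: "\<And>x. x \<in> chart_dom n i j \<Longrightarrow> x = conf n (V x) (W x)" and
    ind: "\<And>x. x \<in> chart_dom n i j \<Longrightarrow> indep n (V x) (W x)" and
    nz: "\<And>x. x \<in> chart_dom n i j \<Longrightarrow> V x i \<noteq> 0 \<and> V x i * W x j \<noteq> V x j * W x i"
    using chart_lift[OF ij(1,2)] unfolding S_def by blast
  define vt where "vt t v k = of_real (1 - t) * v k + of_real t * (if k = i then v i else 0)"
    for t :: real and v :: "nat \<Rightarrow> complex" and k
  \<comment> \<open>\<open>v i * w k - w i * v k\<close> clears the coordinate \<open>i\<close> of
    \<open>w\<close> by subtracting a multiple of \<open>v\<close>; the last term puts that multiple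
    back along the moving \<open>vt\<close>. At \<open>t = 0\<close> the sum is
    \<open>v i * w k\<close>, at \<open>t = 1\<close> only the coordinate \<open>j\<close> is
    left.\<close>
  define wt where "wt t v w k = of_real (1 - t) * (v i * w k - w i * v k)
      + of_real t * (if k = j then v i * w j - v j * w i else 0) + of_real (1 - t) * w i * vt t v k"
    for t :: real and v w :: "nat \<Rightarrow> complex" and k
  define T where "T = prod_topology (top_of_set {0..1::real}) S"
  have vi: "vt t v i = v i" for t v by (simp add: vt_def algebra_simps)
  have minor: "vt t v i * wt t v w j - vt t v j * wt t v w i = v i * (v i * w j - v j * w i)" for t v w
    using ij(3) by (simp add: wt_def vi) (simp add: vt_def algebra_simps)
  have ind': "indep n (vt t (V x)) (wt t (V x) (W x))" if "x \<in> chart_dom n i j" for t x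
  proof -
    have "vt t (V x) i * wt t (V x) (W x) j - vt t (V x) j * wt t (V x) (W x) i \<noteq> 0"
      unfolding minor using nz[OF that] by simp
    then show ?thesis using ij by (auto simp: indep_def)
  qed
  have t1: "continuous_map T euclidean (\<lambda>p. complex_of_real (fst p))"
    unfolding T_def
    by (rule continuous_map_compose[where f=fst and g="\<lambda>t. complex_of_real t", unfolded o_def, OF continuous_map_fst])
       (simp add: continuous_intros)
  have t2: "continuous_map T euclidean (\<lambda>p. complex_of_real (1 - fst p))"
    unfolding of_real_diff by (intro continuous_map_diff t1) auto
  note t = t1 t2 t2[unfolded of_real_diff of_real_1]
  have cV: "continuous_map T euclidean (\<lambda>p. V (snd p) k)" if "k \<le> n" for k
    unfolding T_def by (rule continuous_map_snd_comp[OF contV[OF that]])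
  have cW: "continuous_map T euclidean (\<lambda>p. W (snd p) k)" if "k \<le> n" for k
    unfolding T_def by (rule continuous_map_snd_comp[OF contW[OF that]])
  have cvt: "continuous_map T euclidean (\<lambda>p. vt (fst p) (V (snd p)) k)" if "k \<le> n" for k
    unfolding vt_def using ij that
    by (cases "k = i") (auto intro!: continuous_map_add continuous_map_field_mult t cV)
  have cwt: "continuous_map T euclidean (\<lambda>p. wt (fst p) (V (snd p)) (W (snd p)) k)" if "k \<le> n" for k
    unfolding wt_def using ij that
    by (cases "k = j") (auto intro!: continuous_map_add continuous_map_diff continuous_map_field_mult t cV cW cvt)
  have "continuous_map T (confCP n) (\<lambda>p. conf n (vt (fst p) (V (snd p))) (wt (fst p) (V (snd p)) (W (snd p))))"
    by (intro continuous_map_conf cvt cwt ind') (auto simp: T_def topS)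
  moreover have "conf n (vt 0 (V x)) (wt 0 (V x) (W x)) = x" if "x \<in> chart_dom n i j" for x
  proof -
    have "scaled n 1 (V x) (vt 0 (V x))" "scaled n (V x i) (W x) (wt 0 (V x) (W x))"
      by (auto simp: scaled_def vt_def wt_def)
    then have "conf n (V x) (W x) = conf n (vt 0 (V x)) (wt 0 (V x) (W x))"
      using conf_eq_iff[OF ind[OF that] ind'[OF that]] nz[OF that] by (metis one_neq_zero)
    then show ?thesis using eq[OF that] by simp
  qed
  moreover have "conf n (vt 1 (V x)) (wt 1 (V x) (W x)) = conf n (unit_vec i) (unit_vec j)"
    if "x \<in> chart_dom n i j" for x
  proof -
    have "scaled n (V x i) (unit_vec i) (vt 1 (V x))"
      "scaled n (V x i * W x j - V x j * W x i) (unit_vec j) (wt 1 (V x) (W x))"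
      by (auto simp: scaled_def vt_def wt_def)
    moreover have "indep n (unit_vec i) (unit_vec j)"
      using ij unfolding indep_def by (intro exI[of _ i] exI[of _ j] conjI) auto
    moreover have "V x i * W x j - V x j * W x i \<noteq> 0" using nz[OF that] by simp
    ultimately show ?thesis using conf_eq_iff[OF _ ind'[OF that]] nz[OF that] by metis
  qed
  ultimately show ?thesis
    unfolding S_def[symmetric] T_def
    by (subst homotopic_with)
       (auto simp: topS intro!: exI[of _ "\<lambda>p. conf n (vt (fst p) (V (snd p))) (wt (fst p) (V (snd p)) (W (snd p)))"])
qed

text \<open>The minors of \<open>(1, ..., 1)\<close> and \<open>(0, 1, ..., n)\<close> are
  \<open>j - i\<close>, so this configuration lies in every chart.\<close>

definition base_conf :: "nat \<Rightarrow> nat \<Rightarrow> (nat \<Rightarrow> complex) set" where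
  "base_conf n = conf n (\<lambda>_. 1) (\<lambda>k. of_nat k)"

lemma base_conf_in_chart_dom:
  assumes "i \<le> n" "j \<le> n" "i \<noteq> j"
  shows "base_conf n \<in> chart_dom n i j"
proof -
  have "indep n (\<lambda>_. 1) (\<lambda>k. of_nat k)"
    using assms unfolding indep_def by (intro exI[of _ i] exI[of _ j] conjI) auto
  then show ?thesis
    using chart_fun_conf_pos assms by (auto simp: chart_dom_def base_conf_def topspace_conf)
qed

text \<open>Following \<open>base_conf n\<close> through the contraction gives a path to the end
  point; appending the reversed path moves the end point to \<open>base_conf n\<close>.\<close>

lemma chart_dom_nullhomotopic_base:
  assumes ij: "i \<le> n" "j \<le> n" "i \<noteq> j"
  shows "homotopic_with (\<lambda>_. True) (subtopology (confCP n) (chart_dom n i j)) (confCP n)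
           id (\<lambda>_. base_conf n)"
proof -
  let ?S = "subtopology (confCP n) (chart_dom n i j)"
  note hom = chart_dom_nullhomotopic[OF assms]
  have "continuous_map ?S ?S (\<lambda>_. base_conf n)"
    using base_conf_in_chart_dom[OF assms] by (auto simp: chart_dom_def)
  then have "homotopic_with (\<lambda>_. True) ?S (confCP n) (id \<circ> (\<lambda>_. base_conf n))
      ((\<lambda>_. conf n (unit_vec i) (unit_vec j)) \<circ> (\<lambda>_. base_conf n))"
    by (intro homotopic_with_compose_continuous_map_right[OF hom]) auto
  then have "homotopic_with (\<lambda>_. True) ?S (confCP n) (\<lambda>_. base_conf n) (\<lambda>_. conf n (unit_vec i) (unit_vec j))"
    by (simp add: o_def)
  then show ?thesis by (intro homotopic_with_trans[OF hom]) (simp add: homotopic_with_sym)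
qed

text \<open>The complex dimension of the Schubert cell around the torus-fixed point \<open>(e\<^sub>i, e\<^sub>j)\<close>.\<close>

definition level :: "nat \<Rightarrow> nat \<Rightarrow> nat" where
  "level i j = (if i < j then i + j - 1 else i + j)"

text \<open>Requiring a strict maximum among the charts of one level keeps the sets open and makes
  those of the same level disjoint.\<close>

definition chart_cell :: "nat \<Rightarrow> nat \<times> nat \<Rightarrow> (nat \<Rightarrow> (nat \<Rightarrow> complex) set) set" where
  "chart_cell n p = {x \<in> chart_dom n (fst p) (snd p). \<forall>q\<in>{..n} \<times> {..n}.
     fst q \<noteq> snd q \<and> q \<noteq> p \<and> level (fst q) (snd q) = level (fst p) (snd p)
       \<longrightarrow> chart_fun n (fst q) (snd q) x < chart_fun n (fst p) (snd p) x}"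

lemma chart_cell_less:
  assumes "x \<in> chart_cell n p" "q \<in> {..n} \<times> {..n}" "fst q \<noteq> snd q" "q \<noteq> p"
    "level (fst q) (snd q) = level (fst p) (snd p)"
  shows "chart_fun n (fst q) (snd q) x < chart_fun n (fst p) (snd p) x"
  using assms unfolding chart_cell_def by blast

lemma openin_chart_cell:
  assumes "p \<in> {..n} \<times> {..n}"
  shows "openin (confCP n) (chart_cell n p)"
proof -
  define I where "I = {q \<in> {..n} \<times> {..n}. fst q \<noteq> snd q \<and> q \<noteq> p \<and> level (fst q) (snd q) = level (fst p) (snd p)}"
  have op: "openin (confCP n) {x \<in> topspace (confCP n). chart_fun n (fst q) (snd q) x < chart_fun n (fst p) (snd p) x}"
    if "q \<in> I" for q
  proof -
    have "continuous_map (confCP n) euclideanreal (\<lambda>x. chart_fun n (fst p) (snd p) x - chart_fun n (fst q) (snd q) x)"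
      using that assms by (intro continuous_map_diff continuous_map_chart_fun) (auto simp: I_def)
    from openin_continuous_map_preimage[OF this, of "{0<..}"] show ?thesis by simp
  qed
  have eq: "chart_cell n p = chart_dom n (fst p) (snd p) \<inter>
      ((\<Inter>q\<in>I. {x \<in> topspace (confCP n). chart_fun n (fst q) (snd q) x < chart_fun n (fst p) (snd p) x}) \<inter> topspace (confCP n))"
    by (auto simp: chart_cell_def I_def chart_dom_def)
  have fin: "finite I" by (rule finite_subset[of _ "{..n} \<times> {..n}"]) (auto simp: I_def)
  show ?thesis
    unfolding eq by (intro openin_Int openin_chart_dom openin_INT fin op) (use assms in auto)
qed

text \<open>\<open>(i, j)\<close> labels the Schubert cell of the pair: \<open>i\<close> is the last
  index with \<open>v i \<noteq> 0\<close>, and \<open>j\<close> the last with a nonzero minor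
  \<open>m i j\<close>. The other chart functions of the same level vanish at this point, so the
  strict maximum is attained at \<open>(i, j)\<close>.\<close>

lemma chart_cells_cover:
  assumes "indep n v w"
  obtains p where "p \<in> {..n} \<times> {..n}" "fst p \<noteq> snd p" "conf n v w \<in> chart_cell n p"
proof -
  define m where "m a b = v a * w b - v b * w a" for a b
  define i where "i = Max {k. k \<le> n \<and> v k \<noteq> 0}"
  define j where "j = Max {k. k \<le> n \<and> m i k \<noteq> 0}"
  have ne: "{k. k \<le> n \<and> v k \<noteq> 0} \<noteq> {}" using indep_nonzero[OF assms] by (auto simp: nonzero_def)
  then have i: "i \<le> n" "v i \<noteq> 0" using Max_in[of "{k. k \<le> n \<and> v k \<noteq> 0}"] by (auto simp: i_def)
  have i_max: "k \<le> i" if "k \<le> n" "v k \<noteq> 0" for k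
    unfolding i_def using that by (intro Max_ge) auto
  \<comment> \<open>A Pluecker relation: as \<open>v i \<noteq> 0\<close>, the minors
    \<open>m i _\<close> determine all others.\<close>
  have pl: "v i * m a b = v a * m i b - v b * m i a" for a b by (simp add: m_def algebra_simps)
  have "\<exists>k\<le>n. m i k \<noteq> 0"
  proof (rule ccontr)
    assume "\<not> ?thesis"
    then have "v i * m a b = 0" if "a \<le> n" "b \<le> n" for a b using that pl[of a b] by simp
    then show False using assms i by (auto simp: indep_def m_def)
  qed
  then have j: "j \<le> n" "m i j \<noteq> 0" using Max_in[of "{k. k \<le> n \<and> m i k \<noteq> 0}"] by (auto simp: j_def)
  have j_max: "k \<le> j" if "k \<le> n" "m i k \<noteq> 0" for k
    unfolding j_def using that by (intro Max_ge) auto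
  have ij: "i \<noteq> j" using j by (auto simp: m_def)
  have pos: "chart_fun n i j (conf n v w) > 0"
    using chart_fun_conf_pos[OF assms i(1) j(1)] i j by (auto simp: m_def)
  have "chart_fun n a b (conf n v w) = 0"
    if ab: "a \<le> n" "b \<le> n" "a \<noteq> b" "(a, b) \<noteq> (i, j)" and lev: "level a b = level i j" for a b
  proof -
    have "v a = 0 \<or> m a b = 0"
    proof (rule ccontr)
      assume "\<not> ?thesis"
      then have va: "v a \<noteq> 0" and mab: "m a b \<noteq> 0" by auto
      have "a \<le> i" using i_max va ab by auto
      moreover have "a \<noteq> i" using lev ab ij by (auto simp: level_def split: if_splits)
      ultimately have "a < i" by simp
      \<comment> \<open>The relation \<open>pl\<close> bounds \<open>b\<close> in terms of
        \<open>i\<close> and \<open>j\<close>; together with \<open>a < i\<close> this is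
        incompatible with equal levels, also when the correction by one in \<open>level\<close>
        applies to only one of the pairs.\<close>
      have "m i b \<noteq> 0 \<or> (v b \<noteq> 0 \<and> m i a \<noteq> 0)" using pl[of a b] i mab by auto
      then have "b \<le> j \<or> (b \<le> i \<and> a \<le> j)" using i_max j_max ab by blast
      then show False using lev \<open>a < i\<close> ab ij unfolding level_def by (auto split: if_splits)
    qed
    then show ?thesis using chart_fun_conf[OF assms ab(1,2)] by (auto simp: m_def)
  qed
  then have "conf n v w \<in> chart_cell n (i, j)"
    using pos assms by (auto simp: chart_cell_def chart_dom_def topspace_conf)
  then show ?thesis using that[of "(i, j)"] i j ij by auto
qed

theorem LS_category_conf_le:
  assumes "n \<ge> 1"
  shows "LS_category (confCP n) \<le> enat (2 * n)"
proof -
  define I where "I k = {p \<in> {..n} \<times> {..n}. fst p \<noteq> snd p \<and> level (fst p) (snd p) = k}" for k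
  define U where "U k = (\<Union>p\<in>I k. chart_cell n p)" for k
  have "openin (confCP n) (U k)" for k
    unfolding U_def by (intro openin_Union) (auto simp: I_def openin_chart_cell)
  moreover have "contractible_within (confCP n) (U k)" for k
  proof -
    have "homotopic_with (\<lambda>_. True) (subtopology (confCP n) (U k)) (confCP n) id (\<lambda>_. base_conf n)"
      unfolding U_def
    proof (rule homotopic_with_disjoint_Union)
      show "openin (confCP n) (chart_cell n p)" if "p \<in> I k" for p
        using that by (intro openin_chart_cell) (auto simp: I_def)
      show "chart_cell n p \<inter> chart_cell n q = {}" if "p \<in> I k" "q \<in> I k" "p \<noteq> q" for p q
      proof (rule ccontr)
        assume "\<not> ?thesis"
        then obtain x where x: "x \<in> chart_cell n p" "x \<in> chart_cell n q" by blast
        have "chart_fun n (fst q) (snd q) x < chart_fun n (fst p) (snd p) x"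
          using that by (intro chart_cell_less[OF x(1)]) (auto simp: I_def)
        moreover have "chart_fun n (fst p) (snd p) x < chart_fun n (fst q) (snd q) x"
          using that by (intro chart_cell_less[OF x(2)]) (auto simp: I_def)
        ultimately show False by simp
      qed
      show "homotopic_with (\<lambda>_. True) (subtopology (confCP n) (chart_cell n p)) (confCP n) id (\<lambda>_. base_conf n)"
        if "p \<in> I k" for p
      proof -
        have "homotopic_with (\<lambda>_. True)
            (subtopology (subtopology (confCP n) (chart_dom n (fst p) (snd p))) (chart_cell n p)) (confCP n) id (\<lambda>_. base_conf n)"
          using that by (intro homotopic_from_subtopology chart_dom_nullhomotopic_base) (auto simp: I_def)
        moreover have "chart_dom n (fst p) (snd p) \<inter> chart_cell n p = chart_cell n p"
          by (auto simp: chart_cell_def)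
        ultimately show ?thesis by (simp add: subtopology_subtopology)
      qed
    qed
    moreover have "base_conf n \<in> topspace (confCP n)"
      using base_conf_in_chart_dom[of 0 n 1] assms by (auto simp: chart_dom_def)
    ultimately show ?thesis unfolding contractible_within_def by blast
  qed
  moreover have "(\<Union>k<2 * n. U k) = topspace (confCP n)"
  proof
    show "(\<Union>k<2 * n. U k) \<subseteq> topspace (confCP n)" by (auto simp: U_def chart_cell_def chart_dom_def)
    show "topspace (confCP n) \<subseteq> (\<Union>k<2 * n. U k)"
    proof
      fix x assume "x \<in> topspace (confCP n)"
      then obtain v w where "x = conf n v w" "indep n v w" by (auto simp: topspace_conf)
      then obtain p where p: "p \<in> {..n} \<times> {..n}" "fst p \<noteq> snd p" "x \<in> chart_cell n p"
        using chart_cells_cover by metis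
      \<comment> \<open>The largest level is \<open>n + (n - 1)\<close>, reached at
        \<open>i = n\<close> and \<open>j = n - 1\<close>.\<close>
      then have "level (fst p) (snd p) < 2 * n" by (auto simp: level_def)
      moreover have "x \<in> U (level (fst p) (snd p))" unfolding U_def I_def using p by blast
      ultimately show "x \<in> (\<Union>k<2 * n. U k)" by blast
    qed
  qed
  ultimately show ?thesis
    unfolding LS_category_def by (intro Inf_lower) blast
qed

section \<open>Parametrised pairs of orthogonal lines\<close>

definition bdd_lip :: "('a \<Rightarrow> 'a \<Rightarrow> real) \<Rightarrow> 'a set \<Rightarrow> ('a \<Rightarrow> complex) \<Rightarrow> bool" where
  "bdd_lip d S f \<longleftrightarrow> (\<exists>M C. (\<forall>x\<in>S. cmod (f x) \<le> M) \<and> 0 \<le> C \<and>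
     (\<forall>x\<in>S. \<forall>y\<in>S. cmod (f x - f y) \<le> C * d x y))"

lemma bdd_lipI:
  assumes "\<And>x. x \<in> S \<Longrightarrow> cmod (f x) \<le> M" "0 \<le> C"
    "\<And>x y. \<lbrakk>x \<in> S; y \<in> S\<rbrakk> \<Longrightarrow> cmod (f x - f y) \<le> C * d x y"
  shows "bdd_lip d S f"
  using assms unfolding bdd_lip_def by blast

lemma bdd_lipE:
  assumes "bdd_lip d S f"
  obtains M C where "M \<ge> 0" "C \<ge> 0" "\<And>x. x \<in> S \<Longrightarrow> cmod (f x) \<le> M"
    "\<And>x y. \<lbrakk>x \<in> S; y \<in> S\<rbrakk> \<Longrightarrow> cmod (f x - f y) \<le> C * d x y"
proof -
  obtain M C where "\<forall>x\<in>S. cmod (f x) \<le> M" "0 \<le> C" "\<forall>x\<in>S. \<forall>y\<in>S. cmod (f x - f y) \<le> C * d x y"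
    using assms unfolding bdd_lip_def by blast
  then show thesis by (intro that[of "max M 0" C]) (auto simp: le_max_iff_disj)
qed

lemma bdd_lip_const: "bdd_lip d S (\<lambda>_. c)"
  by (rule bdd_lipI[of S _ "cmod c" 0]) auto

lemma bdd_lip_add:
  assumes "bdd_lip d S f" "bdd_lip d S g"
  shows "bdd_lip d S (\<lambda>x. f x + g x)"
proof -
  obtain M C where f: "M \<ge> 0" "C \<ge> 0" "\<And>x. x \<in> S \<Longrightarrow> cmod (f x) \<le> M"
    "\<And>x y. \<lbrakk>x \<in> S; y \<in> S\<rbrakk> \<Longrightarrow> cmod (f x - f y) \<le> C * d x y" using bdd_lipE[OF assms(1)] by blast
  obtain M' C' where g: "M' \<ge> 0" "C' \<ge> 0" "\<And>x. x \<in> S \<Longrightarrow> cmod (g x) \<le> M'"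
    "\<And>x y. \<lbrakk>x \<in> S; y \<in> S\<rbrakk> \<Longrightarrow> cmod (g x - g y) \<le> C' * d x y" using bdd_lipE[OF assms(2)] by blast
  show ?thesis
  proof (rule bdd_lipI[of _ _ "M + M'" "C + C'"])
    show "cmod (f x + g x) \<le> M + M'" if "x \<in> S" for x
      using f(3)[OF that] g(3)[OF that] norm_triangle_ineq[of "f x" "g x"] by linarith
    show "cmod (f x + g x - (f y + g y)) \<le> (C + C') * d x y" if "x \<in> S" "y \<in> S" for x y
      using f(4)[OF that] g(4)[OF that] norm_diff_triangle_ineq[of "f x" "g x" "f y" "g y"]
      unfolding distrib_right by linarith
  qed (use f g in auto)
qed

text \<open>Boundedness is built into \<open>bdd_lip\<close> for the sake of this product
  rule.\<close>

lemma bdd_lip_mult: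
  assumes "bdd_lip d S f" "bdd_lip d S g"
  shows "bdd_lip d S (\<lambda>x. f x * g x)"
proof -
  obtain M C where f: "M \<ge> 0" "C \<ge> 0" "\<And>x. x \<in> S \<Longrightarrow> cmod (f x) \<le> M"
    "\<And>x y. \<lbrakk>x \<in> S; y \<in> S\<rbrakk> \<Longrightarrow> cmod (f x - f y) \<le> C * d x y" using bdd_lipE[OF assms(1)] by blast
  obtain M' C' where g: "M' \<ge> 0" "C' \<ge> 0" "\<And>x. x \<in> S \<Longrightarrow> cmod (g x) \<le> M'"
    "\<And>x y. \<lbrakk>x \<in> S; y \<in> S\<rbrakk> \<Longrightarrow> cmod (g x - g y) \<le> C' * d x y" using bdd_lipE[OF assms(2)] by blast
  show ?thesis
  proof (rule bdd_lipI[of _ _ "M * M'" "M * C' + M' * C"])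
    show "cmod (f x * g x) \<le> M * M'" if "x \<in> S" for x
      unfolding norm_mult using f(3)[OF that] g(3)[OF that] f(1) by (intro mult_mono) auto
    show "cmod (f x * g x - f y * g y) \<le> (M * C' + M' * C) * d x y" if "x \<in> S" "y \<in> S" for x y
    proof -
      have "cmod (f x) * cmod (g x - g y) \<le> M * (C' * d x y)"
        using f(3)[OF that(1)] g(4)[OF that] f(1) by (intro mult_mono) auto
      moreover have "cmod (g y) * cmod (f x - f y) \<le> M' * (C * d x y)"
        using g(3)[OF that(2)] f(4)[OF that] g(1) by (intro mult_mono) auto
      moreover have "f x * g x - f y * g y = f x * (g x - g y) + g y * (f x - f y)"
        by (simp add: algebra_simps)
      then have "cmod (f x * g x - f y * g y) \<le> cmod (f x) * cmod (g x - g y) + cmod (g y) * cmod (f x - f y)"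
        by (metis norm_mult norm_triangle_ineq)
      ultimately show ?thesis by (simp add: algebra_simps)
    qed
  qed (use f g in auto)
qed

lemma bdd_lip_minus: "bdd_lip d S f \<Longrightarrow> bdd_lip d S (\<lambda>x. - f x)"
  using bdd_lip_mult[OF bdd_lip_const[of d S "-1"], of f] by simp

lemma bdd_lip_diff: "bdd_lip d S f \<Longrightarrow> bdd_lip d S g \<Longrightarrow> bdd_lip d S (\<lambda>x. f x - g x)"
  using bdd_lip_add[of d S f "\<lambda>x. - g x"] bdd_lip_minus[of d S g] by simp

lemma bdd_lip_sum: "(\<And>i. i \<in> I \<Longrightarrow> bdd_lip d S (f i)) \<Longrightarrow> bdd_lip d S (\<lambda>x. \<Sum>i\<in>I. f i x)"
  by (induction I rule: infinite_finite_induct) (simp_all add: bdd_lip_const bdd_lip_add)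

lemma bdd_lip_cnj:
  assumes "bdd_lip d S f" shows "bdd_lip d S (\<lambda>x. cnj (f x))"
  using assms unfolding bdd_lip_def by (simp flip: complex_cnj_diff)

lemma bdd_lip_inverse:
  assumes "bdd_lip d S f" "m > 0" "\<And>x. x \<in> S \<Longrightarrow> m \<le> cmod (f x)"
  shows "bdd_lip d S (\<lambda>x. inverse (f x))"
proof -
  obtain M C where f: "M \<ge> 0" "C \<ge> 0" "\<And>x. x \<in> S \<Longrightarrow> cmod (f x) \<le> M"
    "\<And>x y. \<lbrakk>x \<in> S; y \<in> S\<rbrakk> \<Longrightarrow> cmod (f x - f y) \<le> C * d x y" using bdd_lipE[OF assms(1)] by blast
  have nz: "f x \<noteq> 0" if "x \<in> S" for x using assms(3)[OF that] assms(2) by auto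
  have inv: "cmod (inverse (f x)) \<le> inverse m" if "x \<in> S" for x
    using assms(3)[OF that] assms(2) by (simp add: norm_inverse le_imp_inverse_le)
  show ?thesis
  proof (rule bdd_lipI[of _ _ "inverse m" "inverse m * inverse m * C"])
    show "cmod (inverse (f x) - inverse (f y)) \<le> inverse m * inverse m * C * d x y"
      if "x \<in> S" "y \<in> S" for x y
    proof -
      have "inverse (f x) - inverse (f y) = - (inverse (f x) * inverse (f y) * (f x - f y))"
        using nz that by (simp add: field_simps)
      then have "cmod (inverse (f x) - inverse (f y)) = cmod (inverse (f x)) * cmod (inverse (f y)) * cmod (f x - f y)"
        by (simp add: norm_mult)
      also have "\<dots> \<le> inverse m * inverse m * (C * d x y)"
        using inv that f(4)[OF that] assms(2) by (intro mult_mono) auto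
      finally show ?thesis by (simp add: mult.assoc)
    qed
  qed (use inv f assms in auto)
qed

lemma bdd_lip_divide:
  assumes "bdd_lip d S f" "bdd_lip d S g" "m > 0" "\<And>x. x \<in> S \<Longrightarrow> m \<le> cmod (g x)"
  shows "bdd_lip d S (\<lambda>x. f x / g x)"
  unfolding divide_inverse by (intro bdd_lip_mult bdd_lip_inverse[OF assms(2-4)] assms(1))

lemma compact_bounded_below:
  fixes f :: "'a::topological_space \<Rightarrow> complex"
  assumes "compact S" "continuous_on S f" "\<And>x. x \<in> S \<Longrightarrow> f x \<noteq> 0"
  obtains m where "m > 0" "\<And>x. x \<in> S \<Longrightarrow> m \<le> cmod (f x)"
proof (cases "S = {}")
  case False
  obtain x where "x \<in> S" "\<And>y. y \<in> S \<Longrightarrow> cmod (f x) \<le> cmod (f y)"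
    using continuous_attains_inf[OF assms(1) False continuous_on_norm[OF assms(2)]] by blast
  then show ?thesis using that[of "cmod (f x)"] assms(3) by simp
qed (use that[of 1] in simp)

lemma compact_bounded_above:
  fixes f :: "'a::topological_space \<Rightarrow> complex"
  assumes "compact S" "continuous_on S f"
  obtains M where "M > 0" "\<And>x. x \<in> S \<Longrightarrow> cmod (f x) \<le> M"
proof -
  obtain M where "\<And>x. x \<in> S \<Longrightarrow> cmod (f x) \<le> M"
    using compact_imp_bounded[OF compact_continuous_image[OF assms(2,1)]] by (auto simp: bounded_iff)
  then show ?thesis using that[of "max M 1"] by (force simp: le_max_iff_disj)
qed

section \<open>A compact parameter space for pairs of orthogonal lines\<close>

type_synonym params = "(nat \<Rightarrow> complex) \<times> (nat \<Rightarrow> complex)"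

definition herm :: "nat \<Rightarrow> (nat \<Rightarrow> complex) \<Rightarrow> (nat \<Rightarrow> complex) \<Rightarrow> complex" where
  "herm n u v = (\<Sum>k<n. u k * cnj (v k))"

text \<open>For \<open>v = (z, r)\<close> with \<open>r \<ge> 0\<close> real, \<open>u \<mapsto> ((|z|\<^sup>2 + r) u - \<langle>u, z\<rangle> z, - \<langle>u, z\<rangle>)\<close>
  is an isomorphism from \<open>\<complex>\<^sup>n\<close> onto the orthogonal complement of \<open>v\<close> that is polynomial
  in \<open>v\<close>, so \<open>(v, u)\<close> parametrises pairs of orthogonal lines.\<close>

definition perp :: "nat \<Rightarrow> params \<Rightarrow> nat \<Rightarrow> complex" where
  "perp n x k = (let v = fst x; u = snd x in
     if k < n then (herm n v v + v n) * u k - herm n u v * v k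
     else if k = n then - herm n u v else 0)"

text \<open>Only finitely many coordinates are free; the others are pinned to 0. The bound
  \<open>1/2\<close> keeps both vectors away from 0 and is the one that \<open>cell\<close> meets,
  since \<open>max m (1 - m) \<ge> 1/2\<close>. The last coordinate of the first vector is real and
  nonnegative as \<open>perp\<close> demands.\<close>

definition param_set :: "nat \<Rightarrow> params set" where
  "param_set n = {x. (\<forall>k. cmod (fst x k) \<le> 1) \<and> (\<forall>k. cmod (snd x k) \<le> 1) \<and>
     (\<forall>k>n. fst x k = 0) \<and> (\<forall>k\<ge>n. snd x k = 0) \<and> Im (fst x n) = 0 \<and> 0 \<le> Re (fst x n) \<and>
     (\<exists>k\<le>n. 1/2 \<le> cmod (fst x k)) \<and> (\<exists>k<n. 1/2 \<le> cmod (snd x k))}"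

text \<open>A generator of the line whose dual is the \<open>i\<close>-th summand: the first
  \<open>n\<close> summands belong to the first line, the others to the second.\<close>

definition pvec :: "nat \<Rightarrow> nat \<Rightarrow> params \<Rightarrow> nat \<Rightarrow> complex" where
  "pvec n i x = (if i < n then fst x else perp n x)"

text \<open>The sum distance in the coordinates that \<open>param_set\<close> leaves free; Lipschitz
  constants on \<open>params\<close> refer to it.\<close>

definition pgauge :: "nat \<Rightarrow> params \<Rightarrow> params \<Rightarrow> real" where
  "pgauge n x y = (\<Sum>k\<le>n. cmod (fst x k - fst y k)) + (\<Sum>k<n. cmod (snd x k - snd y k))"

lemma continuous_on_params_coord [continuous_intros]:
  fixes S :: "params set"
  shows "continuous_on S (\<lambda>x. fst x k)" "continuous_on S (\<lambda>x. snd x k)"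
  by (rule continuous_on_product_then_coordinatewise[OF continuous_on_fst[OF continuous_on_id]]
      continuous_on_product_then_coordinatewise[OF continuous_on_snd[OF continuous_on_id]])+

lemma compact_param_set: "compact (param_set n)"
proof -
  have "compactin (product_topology (\<lambda>_. euclidean) UNIV) (PiE UNIV (\<lambda>_::nat. cball 0 1 :: complex set))"
    by (simp add: compactin_PiE compactin_euclidean_iff)
  then have box: "compact (PiE UNIV (\<lambda>_::nat. cball 0 1 :: complex set))"
    by (simp add: euclidean_product_topology compactin_euclidean_iff)
  let ?B = "PiE UNIV (\<lambda>_::nat. cball 0 1 :: complex set)"
  define K :: "params set" where "K = (\<Inter>k\<in>{n<..}. {x. fst x k = 0}) \<inter> (\<Inter>k\<in>{n..}. {x. snd x k = 0}) \<inter>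
     {x. Im (fst x n) = 0} \<inter> {x. 0 \<le> Re (fst x n)} \<inter>
     (\<Union>k\<in>{..n}. {x. 1/2 \<le> cmod (fst x k)}) \<inter> (\<Union>k\<in>{..<n}. {x. 1/2 \<le> cmod (snd x k)})"
  have "closed K" unfolding K_def
    by (intro closed_Int closed_INT closed_UN ballI closed_Collect_eq closed_Collect_le continuous_intros finite_atMost finite_lessThan)
  moreover have "param_set n = (?B \<times> ?B) \<inter> K"
    by (auto simp: param_set_def K_def PiE_def)
  ultimately show ?thesis using compact_Int_closed[OF compact_Times[OF box box]] by simp
qed

abbreviation param_lip :: "nat \<Rightarrow> (params \<Rightarrow> complex) \<Rightarrow> bool" where
  "param_lip n \<equiv> bdd_lip (pgauge n) (param_set n)"

lemma pgauge_nonneg: "pgauge n x y \<ge> 0"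
  by (simp add: pgauge_def sum_nonneg)

lemma bdd_lip_fst: "k \<le> n \<Longrightarrow> param_lip n (\<lambda>x. fst x k)"
proof (rule bdd_lipI[of _ _ 1 1])
  fix x y :: params assume "k \<le> n"
  then have "cmod (fst x k - fst y k) \<le> (\<Sum>k\<le>n. cmod (fst x k - fst y k))"
    by (intro member_le_sum) auto
  moreover have "(\<Sum>k<n. cmod (snd x k - snd y k)) \<ge> 0" by (simp add: sum_nonneg)
  ultimately show "cmod (fst x k - fst y k) \<le> 1 * pgauge n x y" by (simp add: pgauge_def)
qed (auto simp: param_set_def)

lemma bdd_lip_snd: "k < n \<Longrightarrow> param_lip n (\<lambda>x. snd x k)"
proof (rule bdd_lipI[of _ _ 1 1])
  fix x y :: params assume "k < n"
  then have "cmod (snd x k - snd y k) \<le> (\<Sum>k<n. cmod (snd x k - snd y k))"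
    by (intro member_le_sum) auto
  moreover have "(\<Sum>k\<le>n. cmod (fst x k - fst y k)) \<ge> 0" by (simp add: sum_nonneg)
  ultimately show "cmod (snd x k - snd y k) \<le> 1 * pgauge n x y" by (simp add: pgauge_def)
qed (auto simp: param_set_def)

lemma bdd_lip_perp: "param_lip n (\<lambda>x. perp n x k)"
  by (cases "k < n"; cases "k = n")
     (auto simp: perp_def Let_def herm_def
       intro!: bdd_lip_diff bdd_lip_minus bdd_lip_mult bdd_lip_add bdd_lip_sum bdd_lip_cnj bdd_lip_fst bdd_lip_snd bdd_lip_const)

lemma bdd_lip_pvec: "k \<le> n \<Longrightarrow> param_lip n (\<lambda>x. pvec n i x k)"
  by (cases "i < n") (simp_all add: pvec_def bdd_lip_fst bdd_lip_perp)

lemma continuous_on_perp: "continuous_on S (\<lambda>x. perp n x k)"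
  by (cases "k < n"; cases "k = n") (auto simp: perp_def Let_def herm_def intro!: continuous_intros)

lemma continuous_on_pvec: "continuous_on S (\<lambda>x. pvec n i x k)"
  by (cases "i < n") (auto simp: pvec_def intro!: continuous_on_perp continuous_intros)

lemma herm_self: "herm n v v = of_real (\<Sum>k<n. (cmod (v k))\<^sup>2)"
  by (simp add: herm_def complex_norm_square[symmetric] del: of_real_power)

text \<open>With \<open>v = fst x\<close> and \<open>u = snd x\<close>, the first \<open>n\<close>
  terms add up to \<open>v n * herm n u v\<close>; the last term cancels this because
  \<open>v n\<close> is real.\<close>

lemma perp_orth:
  assumes "x \<in> param_set n"
  shows "(\<Sum>k\<le>n. perp n x k * cnj (fst x k)) = 0"
proof -
  let ?v = "fst x" and ?u = "snd x"
  have r: "cnj (?v n) = ?v n" using assms by (simp add: param_set_def complex_eq_iff)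
  have "(\<Sum>k<n. perp n x k * cnj (?v k)) = (herm n ?v ?v + ?v n) * herm n ?u ?v - herm n ?u ?v * herm n ?v ?v"
  proof -
    have "(\<Sum>k<n. perp n x k * cnj (?v k)) =
        (\<Sum>k<n. (herm n ?v ?v + ?v n) * (?u k * cnj (?v k)) - herm n ?u ?v * (?v k * cnj (?v k)))"
      by (intro sum.cong) (auto simp: perp_def Let_def algebra_simps)
    then show ?thesis
      by (simp only: sum_subtractf sum_distrib_left[symmetric] herm_def[symmetric])
  qed
  then show ?thesis
    by (simp add: r perp_def Let_def algebra_simps flip: lessThan_Suc_atMost)
qed

text \<open>If the last entry vanishes then \<open>herm n u v = 0\<close>, and the other entries
  become \<open>(herm n v v + v n) * u k\<close>, where the factor is positive since
  \<open>v\<close> is nonzero and \<open>v n\<close> nonnegative.\<close>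

lemma perp_nonzero:
  assumes x: "x \<in> param_set n"
  shows "nonzero n (perp n x)"
proof (rule ccontr)
  let ?v = "fst x" and ?u = "snd x"
  assume "\<not> ?thesis"
  then have z: "perp n x k = 0" if "k \<le> n" for k using that by (auto simp: nonzero_def)
  have h: "herm n ?u ?v = 0" using z[of n] by (simp add: perp_def)
  obtain k where k: "k < n" "1/2 \<le> cmod (?u k)" using x by (auto simp: param_set_def)
  then have "?u k \<noteq> 0" by auto
  moreover have "(herm n ?v ?v + ?v n) * ?u k = 0" using z[of k] k h by (simp add: perp_def Let_def)
  ultimately have "herm n ?v ?v + ?v n = 0" by simp
  then have "(\<Sum>k<n. (cmod (?v k))\<^sup>2) + Re (?v n) = 0"
    unfolding herm_self by (simp add: complex_eq_iff)
  moreover have "(\<Sum>k<n. (cmod (?v k))\<^sup>2) \<ge> 0" by (simp add: sum_nonneg)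
  ultimately have 0: "(\<Sum>k<n. (cmod (?v k))\<^sup>2) = 0" "Re (?v n) = 0" using x by (auto simp: param_set_def)
  then have "?v k = 0" if "k < n" for k using that by (auto simp: sum_nonneg_eq_0_iff)
  moreover have "?v n = 0" using 0 x by (simp add: param_set_def complex_eq_iff)
  ultimately have "?v k = 0" if "k \<le> n" for k using that by (cases "k = n") auto
  then show False using x by (auto simp: param_set_def)
qed

lemma fst_nonzero: "x \<in> param_set n \<Longrightarrow> nonzero n (fst x)"
  by (force simp: param_set_def nonzero_def)

lemma pvec_nonzero: "x \<in> param_set n \<Longrightarrow> nonzero n (pvec n i x)"
  by (simp add: pvec_def fst_nonzero perp_nonzero)

text \<open>Two proportional vectors that are orthogonal cannot both be nonzero.\<close>

lemma indep_perp:
  assumes x: "x \<in> param_set n"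
  shows "indep n (fst x) (perp n x)"
proof (rule ccontr)
  let ?v = "fst x" and ?w = "perp n x"
  assume "\<not> ?thesis"
  then have eq: "?v i * ?w j = ?v j * ?w i" if "i \<le> n" "j \<le> n" for i j using that by (auto simp: indep_def)
  have "sqnorm n ?v * ?w j = 0" if "j \<le> n" for j
  proof -
    have "sqnorm n ?v * ?w j = (\<Sum>i\<le>n. cnj (?v i) * (?v i * ?w j))"
      by (simp add: sqnorm_def sum_distrib_left sum_distrib_right mult_ac)
    also have "\<dots> = (\<Sum>i\<le>n. cnj (?v i) * (?v j * ?w i))" using eq that by (intro sum.cong) auto
    also have "\<dots> = ?v j * (\<Sum>i\<le>n. ?w i * cnj (?v i))" by (simp add: sum_distrib_left mult_ac)
    finally show ?thesis using perp_orth[OF x] by simp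
  qed
  moreover have "sqnorm n ?v \<noteq> 0" using fst_nonzero[OF x] sqnorm_eq_0_iff by blast
  ultimately show False using perp_nonzero[OF x] by (auto simp: nonzero_def)
qed

text \<open>One nonzero column of the projection is already a generator of the line.\<close>

lemma proj_entry_eq_imp_scaled:
  assumes nz: "nonzero n v" "nonzero n w"
    and eq: "\<And>k l. \<lbrakk>k \<le> n; l \<le> n\<rbrakk> \<Longrightarrow> proj_entry n k l v = proj_entry n k l w"
  obtains a where "a \<noteq> 0" "scaled n a v w"
proof -
  have sq: "sqnorm n v \<noteq> 0" "sqnorm n w \<noteq> 0" using nz sqnorm_eq_0_iff by auto
  obtain l where l: "l \<le> n" "v l \<noteq> 0" using nz by (auto simp: nonzero_def)
  then have "proj_entry n l l v \<noteq> 0" using sq by (simp add: proj_entry_def)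
  then have wl: "w l \<noteq> 0" using eq[of l l] l by (auto simp: proj_entry_def)
  define a where "a = cnj (v l) * sqnorm n w / (sqnorm n v * cnj (w l))"
  have "w k = a * v k" if "k \<le> n" for k
    using eq[OF that l(1)] sq wl by (simp add: proj_entry_def a_def field_simps)
  moreover have "a \<noteq> 0" using sq wl l by (simp add: a_def)
  ultimately show ?thesis using that[of a] by (auto simp: scaled_def)
qed

lemma continuous_on_sqnorm: "continuous_on S (\<lambda>x. sqnorm n (pvec n i x))"
  unfolding sqnorm_def by (intro continuous_on_sum continuous_on_mult continuous_on_cnj continuous_on_pvec)

lemma bdd_lip_proj_entry:
  assumes "k \<le> n" "l \<le> n"
  shows "param_lip n (\<lambda>x. proj_entry n k l (pvec n i x))"
proof -
  have nz: "sqnorm n (pvec n i x) \<noteq> 0" if "x \<in> param_set n" for x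
    using pvec_nonzero[OF that] sqnorm_eq_0_iff by blast
  obtain m where m: "m > 0" "\<And>x. x \<in> param_set n \<Longrightarrow> m \<le> cmod (sqnorm n (pvec n i x))"
    using compact_bounded_below[OF compact_param_set continuous_on_sqnorm nz] by blast
  have "param_lip n (\<lambda>x. sqnorm n (pvec n i x))"
    unfolding sqnorm_def by (intro bdd_lip_sum bdd_lip_mult bdd_lip_cnj bdd_lip_pvec) auto
  moreover have "param_lip n (\<lambda>x. pvec n i x k * cnj (pvec n i x l))"
    by (intro bdd_lip_mult bdd_lip_cnj bdd_lip_pvec assms)
  ultimately show ?thesis unfolding proj_entry_def
    using bdd_lip_divide[where g = "\<lambda>x. sqnorm n (pvec n i x)"] m by blast
qed

lemma continuous_on_proj_entry:
  "continuous_on (param_set n) (\<lambda>x. proj_entry n k l (pvec n i x))"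
  unfolding proj_entry_def
proof (rule continuous_on_divide)
  show "\<forall>x\<in>param_set n. sqnorm n (pvec n i x) \<noteq> 0"
    using pvec_nonzero sqnorm_eq_0_iff by blast
qed (intro continuous_on_mult continuous_on_cnj continuous_on_pvec continuous_on_sqnorm)+

section \<open>Perturbing sections\<close>

text \<open>The pullback to parameters of a section of the \<open>i\<close>-th bundle: such a
  section is a linear functional on one of the two lines, evaluated at the generator
  \<open>pvec n i x\<close>.\<close>

definition equivariant :: "nat \<Rightarrow> nat \<Rightarrow> (params \<Rightarrow> complex) \<Rightarrow> bool" where
  "equivariant n i f \<longleftrightarrow> (\<forall>x\<in>param_set n. \<forall>y\<in>param_set n. \<forall>a b.
     scaled n a (fst x) (fst y) \<longrightarrow> scaled n b (perp n x) (perp n y) \<longrightarrow>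
       f y = (if i < n then a else b) * f x)"

text \<open>Sets on which \<open>2n - 2\<close> complex coordinates are bi-Lipschitz; their real box
  dimension is at most \<open>4n - 4\<close>.\<close>

definition thin :: "nat \<Rightarrow> params set \<Rightarrow> bool" where
  "thin n S \<longleftrightarrow> S \<subseteq> param_set n \<and> (\<exists>V W. V \<subseteq> {..n} \<and> W \<subseteq> {..<n} \<and> card V + card W \<le> 2 * n - 2 \<and>
     (\<exists>C\<ge>0. \<forall>x\<in>S. \<forall>y\<in>S. pgauge n x y \<le>
        C * ((\<Sum>k\<in>V. cmod (fst x k - fst y k)) + (\<Sum>k\<in>W. cmod (snd x k - snd y k)))))"

lemma thin_subset: "thin n S \<Longrightarrow> T \<subseteq> S \<Longrightarrow> thin n T"
  unfolding thin_def by (meson subset_iff)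

text \<open>Dividing by the frame coordinate \<open>b\<close>, which is bounded below, turns a zero
  of the \<open>i\<close>-th component into the equation \<open>c i = f i (x, t)\<close>. The
  functions \<open>f i\<close> are Lipschitz in the thin coordinates and in \<open>t\<close>, so
  \<open>avoid_thin_image\<close> yields constants \<open>c i\<close> for which these equations
  never hold simultaneously.\<close>

lemma perturb_avoid:
  fixes s s0 :: "nat \<Rightarrow> params \<Rightarrow> complex"
  assumes n: "n \<ge> 1" and thin: "thin n S" and kl: "k \<le> n" "l \<le> n"
    and "\<epsilon> > 0" and frame: "\<And>x. x \<in> S \<Longrightarrow> \<epsilon> \<le> cmod (fst x k) \<and> \<epsilon> \<le> cmod (perp n x l)"
    and s: "\<And>i. i < 2 * n - 1 \<Longrightarrow> param_lip n (s i)"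
    and s0: "\<And>i. i < 2 * n - 1 \<Longrightarrow> param_lip n (s0 i)"
    and "\<eta> > 0"
  obtains c \<delta> where "\<delta> > 0" "\<And>i. i < 2 * n - 1 \<Longrightarrow> cmod (c i) < \<eta>"
    "\<And>x t. \<lbrakk>x \<in> S; 0 \<le> t; t \<le> T\<rbrakk> \<Longrightarrow> \<exists>i<2 * n - 1.
       \<delta> \<le> cmod (s i x + c i * pvec n i x (if i < n then k else l) + of_real t * s0 i x)"
proof -
  obtain V W C where S: "S \<subseteq> param_set n" and V: "V \<subseteq> {..n}" and W: "W \<subseteq> {..<n}"
    and VW: "card V + card W \<le> 2 * n - 2" and C: "C \<ge> 0"
    and le: "\<And>x y. \<lbrakk>x \<in> S; y \<in> S\<rbrakk> \<Longrightarrow> pgauge n x y \<le>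
        C * ((\<Sum>k\<in>V. cmod (fst x k - fst y k)) + (\<Sum>k\<in>W. cmod (snd x k - snd y k)))"
    using thin unfolding thin_def by blast
  define b where "b i x = pvec n i x (if i < n then k else l)" for i x
  define Z where "Z = S \<times> {0..T}"
  define d where "d z z' = pgauge n (fst z) (fst z') + \<bar>snd z - snd z'\<bar>" for z z' :: "params \<times> real"
  define f where "f i z = - (s i (fst z) + of_real (snd z) * s0 i (fst z)) / b i (fst z)" for i and z :: "params \<times> real"
  have b_ge: "\<epsilon> \<le> cmod (b i x)" if "x \<in> S" for i x
    using frame[OF that] by (auto simp: b_def pvec_def)
  have lift: "bdd_lip d Z (\<lambda>z. g (fst z))" if g: "param_lip n g" for g
  proof -
    obtain M C where g: "M \<ge> 0" "C \<ge> 0" "\<And>x. x \<in> param_set n \<Longrightarrow> cmod (g x) \<le> M"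
      "\<And>x y. \<lbrakk>x \<in> param_set n; y \<in> param_set n\<rbrakk> \<Longrightarrow> cmod (g x - g y) \<le> C * pgauge n x y"
      using bdd_lipE[OF g] by blast
    show ?thesis
    proof (rule bdd_lipI[of _ _ M C])
      fix z z' assume z: "z \<in> Z" "z' \<in> Z"
      then have "cmod (g (fst z) - g (fst z')) \<le> C * pgauge n (fst z) (fst z')"
        using S by (intro g(4)) (auto simp: Z_def)
      also have "\<dots> \<le> C * d z z'" using g(2) by (intro mult_left_mono) (auto simp: d_def)
      finally show "cmod (g (fst z) - g (fst z')) \<le> C * d z z'" .
    qed (use g S in \<open>auto simp: Z_def\<close>)
  qed
  have time: "bdd_lip d Z (\<lambda>z. of_real (snd z))"
    by (rule bdd_lipI[of _ _ "T" 1])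
       (auto simp: Z_def d_def pgauge_nonneg simp flip: of_real_diff)
  have f_bdd_lip: "bdd_lip d Z (f i)" if "i < 2 * n - 1" for i
  proof -
    have "bdd_lip d Z (\<lambda>z. - (s i (fst z) + of_real (snd z) * s0 i (fst z)))"
      by (intro bdd_lip_minus bdd_lip_add bdd_lip_mult lift s s0 time that)
    moreover have "bdd_lip d Z (\<lambda>z. b i (fst z))"
      unfolding b_def using kl by (intro lift bdd_lip_pvec) auto
    ultimately show ?thesis unfolding f_def
      by (rule bdd_lip_divide[OF _ _ \<open>\<epsilon> > 0\<close>]) (use b_ge in \<open>auto simp: Z_def\<close>)
  qed
  have "\<forall>i. \<exists>L\<ge>0. i < 2 * n - 1 \<longrightarrow> (\<forall>z\<in>Z. \<forall>z'\<in>Z. cmod (f i z - f i z') \<le> L * d z z')"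
    using f_bdd_lip bdd_lipE by (metis order_refl)
  then obtain L where L0: "\<And>i. L i \<ge> 0"
    and L: "\<And>i z z'. \<lbrakk>i < 2 * n - 1; z \<in> Z; z' \<in> Z\<rbrakk> \<Longrightarrow> cmod (f i z - f i z') \<le> L i * d z z'"
    by metis
  \<comment> \<open>The first component of \<open>p\<close> is a tag: 0 and 1 for real and imaginary
    parts in the first vector, 2 and 3 for those in the second, 4 for the time.\<close>
  define co where "co p z = (if fst p = 0 then Re (fst (fst z) (snd p)) else if fst p = 1 then Im (fst (fst z) (snd p))
     else if fst p = 2 then Re (snd (fst z) (snd p)) else if fst p = 3 then Im (snd (fst z) (snd p)) else snd z)"
    for p :: "nat \<times> nat" and z :: "params \<times> real"
  define I :: "(nat \<times> nat) set" where "I = {0, 1} \<times> V \<union> {2, 3} \<times> W \<union> {(4, 0)}"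
  define J :: "(nat \<times> nat) set" where "J = {0, 1} \<times> {..<2 * n - 1}"
  define F where "F p z = (if fst p = 0 then Re (f (snd p) z) else Im (f (snd p) z))" for p :: "nat \<times> nat" and z
  define D where "D = C * (2 * card V + 2 * card W) + 1"
  have fin: "finite V" "finite W" using V W finite_subset by auto
  have "card I \<le> card ({0, 1::nat} \<times> V \<union> {2, 3} \<times> W) + 1"
    unfolding I_def by (rule order.trans[OF card_Un_le]) simp
  also have "\<dots> \<le> card ({0, 1::nat} \<times> V) + card ({2, 3::nat} \<times> W) + 1"
    using card_Un_le by (intro add_right_mono)
  also have "\<dots> = 2 * (card V + card W) + 1" by (simp add: card_cartesian_product)
  \<comment> \<open>At most \<open>4 * n - 4\<close> real coordinates and the time, against the
    \<open>4 * n - 2\<close> real parts of the unknown constants.\<close>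
  also have "\<dots> < 2 * (2 * n - 1)" using VW n by presburger
  also have "\<dots> = card J" by (simp add: J_def card_cartesian_product)
  finally have card: "card I < card J" .
  \<comment> \<open>\<open>\<eta> / 2\<close> for the real and for the imaginary part gives
    \<open>cmod (c i) < \<eta>\<close>.\<close>
  obtain c \<delta> where \<delta>: "\<delta> > 0" and c: "\<And>j. j \<in> J \<Longrightarrow> 0 \<le> c j \<and> c j < \<eta> / 2"
    and av: "\<And>z. z \<in> Z \<Longrightarrow> \<exists>j\<in>J. \<delta> \<le> \<bar>F j z - c j\<bar>"
  proof (rule avoid_thin_image[where I = I and J = J and a = co and F = F and Z = Z and \<epsilon> = "\<eta> / 2"
        and B = "max 1 T" and C = "(\<Sum>i<2 * n - 1. L i) * D"])
    show "finite I" "finite J" using fin by (auto simp: I_def J_def)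
    show "card I < card J" by fact
    show "\<bar>co i z\<bar> \<le> max 1 T" if "i \<in> I" "z \<in> Z" for i z
    proof -
      have "fst z \<in> param_set n" using that S by (auto simp: Z_def)
      then have "cmod (fst (fst z) j) \<le> 1" "cmod (snd (fst z) j) \<le> 1" for j by (auto simp: param_set_def)
      then have "\<bar>Re (fst (fst z) j)\<bar> \<le> 1" "\<bar>Im (fst (fst z) j)\<bar> \<le> 1"
        "\<bar>Re (snd (fst z) j)\<bar> \<le> 1" "\<bar>Im (snd (fst z) j)\<bar> \<le> 1" for j
        using abs_Re_le_cmod abs_Im_le_cmod order_trans by blast+
      then show ?thesis using that by (auto simp: co_def Z_def le_max_iff_disj)
    qed
    show "\<bar>F j z - F j z'\<bar> \<le> (\<Sum>i<2 * n - 1. L i) * D * \<eta>'"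
      if j: "j \<in> J" and z: "z \<in> Z" "z' \<in> Z" and "0 \<le> \<eta>'" and close: "\<And>i. i \<in> I \<Longrightarrow> \<bar>co i z - co i z'\<bar> \<le> \<eta>'"
      for j z z' \<eta>'
    proof -
      have cV: "cmod (fst (fst z) k - fst (fst z') k) \<le> 2 * \<eta>'" if "k \<in> V" for k
        using close[of "(0, k)"] close[of "(1, k)"] that cmod_le[of "fst (fst z) k - fst (fst z') k"]
        by (simp add: I_def co_def)
      have cW: "cmod (snd (fst z) k - snd (fst z') k) \<le> 2 * \<eta>'" if "k \<in> W" for k
        using close[of "(2, k)"] close[of "(3, k)"] that cmod_le[of "snd (fst z) k - snd (fst z') k"]
        by (simp add: I_def co_def)
      have "(\<Sum>k\<in>V. cmod (fst (fst z) k - fst (fst z') k)) \<le> card V * (2 * \<eta>')"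
        using cV by (rule sum_bounded_above)
      moreover have "(\<Sum>k\<in>W. cmod (snd (fst z) k - snd (fst z') k)) \<le> card W * (2 * \<eta>')"
        using cW by (rule sum_bounded_above)
      ultimately have "(\<Sum>k\<in>V. cmod (fst (fst z) k - fst (fst z') k)) + (\<Sum>k\<in>W. cmod (snd (fst z) k - snd (fst z') k))
          \<le> (2 * card V + 2 * card W) * \<eta>'" by (simp add: algebra_simps)
      then have "pgauge n (fst z) (fst z') \<le> C * ((2 * card V + 2 * card W) * \<eta>')"
        using le[of "fst z" "fst z'"] z C by (fastforce simp: Z_def intro: order.trans mult_left_mono)
      moreover have "\<bar>snd z - snd z'\<bar> \<le> \<eta>'" using close[of "(4, 0)"] by (simp add: I_def co_def)
      ultimately have dle: "d z z' \<le> D * \<eta>'" by (simp add: d_def D_def algebra_simps)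
      have i: "snd j < 2 * n - 1" using j by (auto simp: J_def)
      have "\<bar>F j z - F j z'\<bar> \<le> cmod (f (snd j) z - f (snd j) z')"
        using abs_Re_le_cmod[of "f (snd j) z - f (snd j) z'"] abs_Im_le_cmod[of "f (snd j) z - f (snd j) z'"]
        by (simp add: F_def)
      also have "\<dots> \<le> L (snd j) * d z z'" by (rule L[OF i z])
      also have "\<dots> \<le> (\<Sum>i<2 * n - 1. L i) * (D * \<eta>')"
        using i L0 dle by (intro mult_mono member_le_sum sum_nonneg) (auto simp: d_def pgauge_nonneg)
      finally show ?thesis by (simp add: mult.assoc)
    qed
    show "\<eta> / 2 > 0" using \<open>\<eta> > 0\<close> by simp
  qed blast
  show ?thesis
  proof (rule that[of "\<delta> * \<epsilon>" "\<lambda>i. Complex (c (0, i)) (c (1, i))"])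
    show "\<delta> * \<epsilon> > 0" using \<delta> \<open>\<epsilon> > 0\<close> by simp
    show "cmod (Complex (c (0, i)) (c (1, i))) < \<eta>" if "i < 2 * n - 1" for i
      using c[of "(0, i)"] c[of "(1, i)"] that cmod_le[of "Complex (c (0, i)) (c (1, i))"]
      by (simp add: J_def)
    fix x t assume x: "x \<in> S" and t: "0 \<le> t" "t \<le> T"
    then have "(x, t) \<in> Z" by (simp add: Z_def)
    from av[OF this] obtain j where j: "j \<in> J" "\<delta> \<le> \<bar>F j (x, t) - c j\<bar>" by blast
    define i where "i = snd j"
    have i: "i < 2 * n - 1" using j by (auto simp: J_def i_def)
    let ?c = "Complex (c (0, i)) (c (1, i))"
    have "\<delta> \<le> cmod (f i (x, t) - ?c)"
      using j abs_Re_le_cmod[of "f i (x, t) - ?c"] abs_Im_le_cmod[of "f i (x, t) - ?c"]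
      by (auto simp: J_def F_def i_def)
    then have "\<delta> * \<epsilon> \<le> cmod (f i (x, t) - ?c) * cmod (b i x)"
      using b_ge[OF x] \<delta> \<open>\<epsilon> > 0\<close> by (intro mult_mono) auto
    also have "\<dots> = cmod (s i x + ?c * b i x + of_real t * s0 i x)"
    proof -
      have "b i x \<noteq> 0" using b_ge[OF x, of i] \<open>\<epsilon> > 0\<close> by auto
      then have "(f i (x, t) - ?c) * b i x = - (s i x + ?c * b i x + of_real t * s0 i x)"
        by (simp add: f_def field_simps)
      then show ?thesis by (metis norm_minus_cancel norm_mult)
    qed
    finally show "\<exists>i<2 * n - 1. \<delta> * \<epsilon> \<le> cmod (s i x + Complex (c (0, i)) (c (1, i)) * pvec n i x (if i < n then k else l) + of_real t * s0 i x)"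
      using i unfolding b_def by blast
  qed
qed

text \<open>One fixed coordinate of each vector is uniformly nonzero on \<open>S\<close>, and so
  trivialises the bundles there.\<close>

definition framed :: "nat \<Rightarrow> params set \<Rightarrow> bool" where
  "framed n S \<longleftrightarrow> (\<exists>k\<le>n. \<exists>l\<le>n. \<exists>\<epsilon>>0. \<forall>x\<in>S. \<epsilon> \<le> cmod (fst x k) \<and> \<epsilon> \<le> cmod (perp n x l))"

lemma equivariant_pvec: "k \<le> n \<Longrightarrow> equivariant n i (\<lambda>x. pvec n i x k)"
  by (auto simp: equivariant_def pvec_def scaled_def)

lemma equivariant_add:
  "equivariant n i f \<Longrightarrow> equivariant n i g \<Longrightarrow> equivariant n i (\<lambda>x. f x + g x)"
  unfolding equivariant_def by (metis distrib_left)

lemma equivariant_cmult: "equivariant n i f \<Longrightarrow> equivariant n i (\<lambda>x. c * f x)"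
  unfolding equivariant_def by (metis mult.left_commute)

text \<open>The sets are treated one at a time. Each new perturbation is at most half of the gap
  already reached, so the earlier sets keep a positive gap.\<close>

lemma avoid_finite:
  fixes s s0 :: "nat \<Rightarrow> params \<Rightarrow> complex"
  assumes n: "n \<ge> 1" and "finite \<S>" and "\<And>S. S \<in> \<S> \<Longrightarrow> thin n S \<and> framed n S"
    and s: "\<And>i. i < 2 * n - 1 \<Longrightarrow> param_lip n (s i) \<and> equivariant n i (s i)"
    and s0: "\<And>i. i < 2 * n - 1 \<Longrightarrow> param_lip n (s0 i)"
    and "\<eta> > 0"
  shows "\<exists>s' \<delta>. \<delta> > 0 \<and> (\<forall>i<2 * n - 1. param_lip n (s' i) \<and> equivariant n i (s' i) \<and>
       (\<forall>x\<in>param_set n. cmod (s' i x - s i x) \<le> \<eta>)) \<and>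
     (\<forall>S\<in>\<S>. \<forall>x\<in>S. \<forall>t\<in>{0..T}. \<exists>i<2 * n - 1. \<delta> \<le> cmod (s' i x + of_real t * s0 i x))"
    (is "?C \<S> \<eta>")
  using assms(2,3,6)
proof (induction \<S> arbitrary: \<eta> rule: finite_induct)
  case empty
  then show ?case using s by (intro exI[of _ s] exI[of _ 1]) auto
next
  case (insert S \<S>)
  have "?C \<S> (\<eta> / 2)" using insert.prems by (intro insert.IH) auto
  then obtain s' \<delta> where \<delta>: "\<delta> > 0"
    and A: "\<forall>i<2 * n - 1. param_lip n (s' i) \<and> equivariant n i (s' i) \<and>
       (\<forall>x\<in>param_set n. cmod (s' i x - s i x) \<le> \<eta> / 2)"
    and B: "\<forall>S\<in>\<S>. \<forall>x\<in>S. \<forall>t\<in>{0..T}. \<exists>i<2 * n - 1. \<delta> \<le> cmod (s' i x + of_real t * s0 i x)"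
    by (elim exE conjE)
  have s': "param_lip n (s' i)" "equivariant n i (s' i)" if "i < 2 * n - 1" for i
    using A that by simp_all
  have near: "cmod (s' i x - s i x) \<le> \<eta> / 2" if "i < 2 * n - 1" "x \<in> param_set n" for i x
    using A that by simp
  have av: "\<exists>i<2 * n - 1. \<delta> \<le> cmod (s' i x + of_real t * s0 i x)"
    if "S \<in> \<S>" "x \<in> S" "t \<in> {0..T}" for S x t
    using B that by simp
  obtain k l \<epsilon> where kl: "k \<le> n" "l \<le> n" and \<epsilon>: "\<epsilon> > 0"
    and frame: "\<And>x. x \<in> S \<Longrightarrow> \<epsilon> \<le> cmod (fst x k) \<and> \<epsilon> \<le> cmod (perp n x l)"
    using insert.prems(1)[of S, OF insertI1] unfolding framed_def by (elim exE conjE) blast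
  have thinS: "thin n S" using insert.prems(1)[of S] by simp
  define b where "b i x = pvec n i x (if i < n then k else l)" for i x
  obtain M1 where M1: "M1 > 0" "\<And>x. x \<in> param_set n \<Longrightarrow> cmod (fst x k) \<le> M1"
    using compact_bounded_above[OF compact_param_set, of n "\<lambda>x. fst x k"] continuous_on_params_coord by blast
  obtain M2 where M2: "M2 > 0" "\<And>x. x \<in> param_set n \<Longrightarrow> cmod (perp n x l) \<le> M2"
    using compact_bounded_above[OF compact_param_set, of n "\<lambda>x. perp n x l"] continuous_on_perp by blast
  define M where "M = M1 + M2"
  have M: "M > 0" "\<And>i x. x \<in> param_set n \<Longrightarrow> cmod (b i x) \<le> M"
    using M1 M2 by (auto simp: M_def b_def pvec_def add_increasing add_increasing2)
  \<comment> \<open>After division by the bound \<open>M\<close> of the frame coordinates, the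
    correction \<open>c i * b i x\<close> stays below half of the allowed distance and half of the
    gap.\<close>
  define \<eta>' where "\<eta>' = min (\<eta> / 2) (\<delta> / 2) / M"
  have \<eta>': "\<eta>' > 0" using insert.prems(2) \<delta> M by (simp add: \<eta>'_def)
  obtain c \<delta>' where \<delta>': "\<delta>' > 0" and c: "\<And>i. i < 2 * n - 1 \<Longrightarrow> cmod (c i) < \<eta>'"
    and av': "\<And>x t. \<lbrakk>x \<in> S; 0 \<le> t; t \<le> T\<rbrakk> \<Longrightarrow> \<exists>i<2 * n - 1.
       \<delta>' \<le> cmod (s' i x + c i * pvec n i x (if i < n then k else l) + of_real t * s0 i x)"
  proof (rule perturb_avoid[OF n thinS kl \<epsilon>, where s = s' and ?s0.0 = s0 and \<eta> = \<eta>' and T = T])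
    show "\<epsilon> \<le> cmod (fst x k) \<and> \<epsilon> \<le> cmod (perp n x l)" if "x \<in> S" for x by (rule frame[OF that])
    show "param_lip n (s' i)" if "i < 2 * n - 1" for i by (rule s'(1)[OF that])
    show "param_lip n (s0 i)" if "i < 2 * n - 1" for i by (rule s0[OF that])
    show "\<eta>' > 0" by (rule \<eta>')
  qed blast
  have S\<S>: "x \<in> param_set n" if "x \<in> S'" "S' \<in> insert S \<S>" for x S'
    using insert.prems(1)[OF that(2)] that(1) by (auto simp: thin_def)
  have cb: "cmod (c i * b i x) \<le> min (\<eta> / 2) (\<delta> / 2)" if "i < 2 * n - 1" "x \<in> param_set n" for i x
  proof -
    have "cmod (c i * b i x) \<le> \<eta>' * M" unfolding norm_mult
      using c[OF that(1)] M(2)[OF that(2), of i] \<eta>' by (intro mult_mono) auto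
    then show ?thesis using M by (simp add: \<eta>'_def)
  qed
  show ?case
  proof (intro exI[of _ "\<lambda>i x. s' i x + c i * b i x"] exI[of _ "min \<delta>' (\<delta> / 2)"] conjI allI impI ballI)
    show "min \<delta>' (\<delta> / 2) > 0" using \<delta> \<delta>' by simp
    fix i assume i: "i < 2 * n - 1"
    show "param_lip n (\<lambda>x. s' i x + c i * b i x)"
      unfolding b_def using kl i by (intro bdd_lip_add bdd_lip_mult bdd_lip_const bdd_lip_pvec s') auto
    show "equivariant n i (\<lambda>x. s' i x + c i * b i x)"
      unfolding b_def using kl i by (intro equivariant_add equivariant_cmult equivariant_pvec s') auto
    fix x assume x: "x \<in> param_set n"
    have eq: "s' i x + c i * b i x - s i x = (s' i x - s i x) + c i * b i x" by simp
    have "cmod (c i * b i x) \<le> \<eta> / 2" using cb[OF i x] by simp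
    then show "cmod (s' i x + c i * b i x - s i x) \<le> \<eta>"
      unfolding eq using near[OF i x] norm_triangle_ineq[of "s' i x - s i x" "c i * b i x"] by linarith
  next
    fix S' x t assume S': "S' \<in> insert S \<S>" and x: "x \<in> S'" and t: "t \<in> {0..T}"
    show "\<exists>i<2 * n - 1. min \<delta>' (\<delta> / 2) \<le> cmod (s' i x + c i * b i x + of_real t * s0 i x)"
    proof (cases "S' = S")
      case True
      have "x \<in> S" "0 \<le> t" "t \<le> T" using True x t by auto
      from av'[OF this] obtain i where "i < 2 * n - 1" "\<delta>' \<le> cmod (s' i x + c i * b i x + of_real t * s0 i x)"
        unfolding b_def by blast
      then show ?thesis by (meson min.coboundedI1)
    next
      case False
      then obtain i where i: "i < 2 * n - 1" "\<delta> \<le> cmod (s' i x + of_real t * s0 i x)"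
        using av[of S' x t] S' x t by blast
      have eq: "s' i x + of_real t * s0 i x = (s' i x + c i * b i x + of_real t * s0 i x) - c i * b i x" by simp
      have "cmod (c i * b i x) \<le> \<delta> / 2" using cb[OF i(1) S\<S>[OF x S']] by simp
      moreover have "\<delta> \<le> cmod (s' i x + c i * b i x + of_real t * s0 i x) + cmod (c i * b i x)"
        using i(2) norm_triangle_ineq4[of "s' i x + c i * b i x + of_real t * s0 i x" "c i * b i x"]
        unfolding eq by linarith
      ultimately have "\<delta> / 2 \<le> cmod (s' i x + c i * b i x + of_real t * s0 i x)" by linarith
      then show ?thesis using i(1) by (meson min.coboundedI2)
    qed
  qed
qed

section \<open>Lipschitz approximation of equivariant functions\<close>

definition same_lines :: "nat \<Rightarrow> params \<Rightarrow> params \<Rightarrow> bool" where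
  "same_lines n x y \<longleftrightarrow> (\<forall>i\<in>{0, n}. \<forall>k\<le>n. \<forall>l\<le>n.
     proj_entry n k l (pvec n i x) = proj_entry n k l (pvec n i y))"

lemma same_lines_scaled:
  assumes "n \<ge> 1" "x \<in> param_set n" "y \<in> param_set n" "same_lines n x y"
  obtains a b where "a \<noteq> 0" "b \<noteq> 0" "scaled n a (fst x) (fst y)" "scaled n b (perp n x) (perp n y)"
proof -
  \<comment> \<open>Index \<open>0\<close> selects the first vector, as \<open>n \<ge> 1\<close>,
    and index \<open>n\<close> the second.\<close>
  have "proj_entry n k l (fst x) = proj_entry n k l (fst y)"
    "proj_entry n k l (perp n x) = proj_entry n k l (perp n y)" if "k \<le> n" "l \<le> n" for k l
    using assms that by (auto simp: same_lines_def pvec_def)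
  then show ?thesis
    using that proj_entry_eq_imp_scaled[of n "fst x" "fst y"] proj_entry_eq_imp_scaled[of n "perp n x" "perp n y"]
      fst_nonzero perp_nonzero assms by metis
qed

lemma scaled_same_lines:
  assumes x: "x \<in> param_set n" and y: "y \<in> param_set n"
    and sc: "scaled n a (fst x) (fst y)" "scaled n b (perp n x) (perp n y)"
  shows "same_lines n x y" "a \<noteq> 0" "b \<noteq> 0"
proof -
  show "a \<noteq> 0" using sc(1) fst_nonzero[OF y] by (auto simp: scaled_def nonzero_def)
  moreover show "b \<noteq> 0" using sc(2) perp_nonzero[OF y] by (auto simp: scaled_def nonzero_def)
  ultimately show "same_lines n x y"
    using proj_entry_scaled[OF sc(1)] proj_entry_scaled[OF sc(2)] by (auto simp: same_lines_def pvec_def)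
qed

text \<open>The projection entries separate pairs of lines, so the approximation can be made
  Lipschitz in these entries, which forces it to depend on the lines only.\<close>

lemma invariant_approximation:
  assumes h: "continuous_on (param_set n) h"
    and inv: "\<And>x y. \<lbrakk>x \<in> param_set n; y \<in> param_set n; same_lines n x y\<rbrakk> \<Longrightarrow> h x = h y"
    and "\<epsilon> > 0"
  obtains g where "param_lip n g"
    "\<And>x. x \<in> param_set n \<Longrightarrow> cmod (g x - h x) \<le> \<epsilon>"
    "\<And>x y. \<lbrakk>x \<in> param_set n; y \<in> param_set n; same_lines n x y\<rbrakk> \<Longrightarrow> g x = g y"
proof -
  define Q where "Q = param_set n"
  define J where "J = {0, n} \<times> {..n} \<times> {..n}"
  define e where "e p x = (case p of (i, k, l) \<Rightarrow> proj_entry n k l (pvec n i x))" for p :: "nat \<times> nat \<times> nat" and x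
  have fin: "finite J" by (simp add: J_def)
  have cont: "continuous_on Q (e p)" for p
    unfolding e_def Q_def by (cases p) (simp add: continuous_on_proj_entry)
  have same: "same_lines n x y" if "\<And>p. p \<in> J \<Longrightarrow> e p x = e p y" for x y
    unfolding same_lines_def
  proof (intro ballI allI impI)
    fix i k l assume "i \<in> {0, n}" "k \<le> n" "l \<le> n"
    then show "proj_entry n k l (pvec n i x) = proj_entry n k l (pvec n i y)"
      using that[of "(i, k, l)"] by (simp add: J_def e_def)
  qed
  have e_same: "e p x = e p y" if "same_lines n x y" "p \<in> J" for x y p
    using that unfolding same_lines_def J_def e_def by auto
  define d where "d x y = (\<Sum>p\<in>J. cmod (e p x - e p y))" for x y
  have d0: "d x y = 0" if "same_lines n x y" for x y
    unfolding d_def using e_same[OF that] by simp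
  have Qc: "compact Q" by (simp add: Q_def compact_param_set)
  have *: "\<exists>g L. L \<ge> 0 \<and> (\<forall>x\<in>Q. \<bar>g x - f x\<bar> \<le> \<epsilon> / 2) \<and> (\<forall>x\<in>Q. \<forall>y\<in>Q. \<bar>g x - g y\<bar> \<le> L * d x y)"
    if f: "continuous_on Q f" and fi: "\<And>x y. \<lbrakk>x \<in> Q; y \<in> Q; same_lines n x y\<rbrakk> \<Longrightarrow> f x = f y" for f :: "params \<Rightarrow> real"
  proof -
    obtain g L where "L \<ge> 0" "\<And>x. x \<in> Q \<Longrightarrow> \<bar>g x - f x\<bar> \<le> \<epsilon> / 2"
      "\<And>x y. \<lbrakk>x \<in> Q; y \<in> Q\<rbrakk> \<Longrightarrow> \<bar>g x - g y\<bar> \<le> L * (\<Sum>p\<in>J. cmod (e p x - e p y))"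
    proof (rule lipschitz_approximation[OF Qc f fin, of e "\<epsilon> / 2"])
      show "continuous_on Q (e a)" for a by (rule cont)
      show "f x = f y" if "x \<in> Q" "y \<in> Q" "\<And>a. a \<in> J \<Longrightarrow> e a x = e a y" for x y
        using fi[OF that(1,2) same] that(3) by blast
      show "\<epsilon> / 2 > 0" using \<open>\<epsilon> > 0\<close> by simp
    qed blast
    then show ?thesis unfolding d_def by blast
  qed
  have c: "continuous_on Q h" "continuous_on Q (\<lambda>x. Re (h x))" "continuous_on Q (\<lambda>x. Im (h x))"
    using h unfolding Q_def by (auto intro: continuous_intros)
  have i: "Re (h x) = Re (h y)" "Im (h x) = Im (h y)" if "x \<in> Q" "y \<in> Q" "same_lines n x y" for x y
    using inv[of x y] that unfolding Q_def by simp_all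
  from *[OF c(2) i(1)] obtain g1 L1 where
    1: "L1 \<ge> 0" "\<forall>x\<in>Q. \<bar>g1 x - Re (h x)\<bar> \<le> \<epsilon> / 2" "\<forall>x\<in>Q. \<forall>y\<in>Q. \<bar>g1 x - g1 y\<bar> \<le> L1 * d x y"
    by blast
  from *[OF c(3) i(2)] obtain g2 L2 where
    2: "L2 \<ge> 0" "\<forall>x\<in>Q. \<bar>g2 x - Im (h x)\<bar> \<le> \<epsilon> / 2" "\<forall>x\<in>Q. \<forall>y\<in>Q. \<bar>g2 x - g2 y\<bar> \<le> L2 * d x y"
    by blast
  define g where "g x = Complex (g1 x) (g2 x)" for x
  have near: "cmod (g x - h x) \<le> \<epsilon>" if "x \<in> Q" for x
  proof -
    have "\<bar>g1 x - Re (h x)\<bar> \<le> \<epsilon> / 2" "\<bar>g2 x - Im (h x)\<bar> \<le> \<epsilon> / 2" using 1(2) 2(2) that by auto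
    then show ?thesis using cmod_le[of "g x - h x"] by (simp add: g_def)
  qed
  have g_d: "cmod (g x - g y) \<le> (L1 + L2) * d x y" if "x \<in> Q" "y \<in> Q" for x y
  proof -
    have "\<bar>g1 x - g1 y\<bar> \<le> L1 * d x y" "\<bar>g2 x - g2 y\<bar> \<le> L2 * d x y" using 1(3) 2(3) that by auto
    then show ?thesis using cmod_le[of "g x - g y"] by (simp add: g_def distrib_right)
  qed
  have "\<forall>p. \<exists>C\<ge>0. p \<in> J \<longrightarrow> (\<forall>x\<in>Q. \<forall>y\<in>Q. cmod (e p x - e p y) \<le> C * pgauge n x y)"
  proof
    fix p
    show "\<exists>C\<ge>0. p \<in> J \<longrightarrow> (\<forall>x\<in>Q. \<forall>y\<in>Q. cmod (e p x - e p y) \<le> C * pgauge n x y)"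
    proof (cases "p \<in> J")
      case True
      then have "bdd_lip (pgauge n) Q (e p)" unfolding e_def Q_def J_def by (auto intro: bdd_lip_proj_entry)
      then show ?thesis by (rule bdd_lipE) blast
    qed auto
  qed
  then obtain C where C: "\<And>p. C p \<ge> 0"
    "\<And>p x y. \<lbrakk>p \<in> J; x \<in> Q; y \<in> Q\<rbrakk> \<Longrightarrow> cmod (e p x - e p y) \<le> C p * pgauge n x y" by metis
  have d_le: "d x y \<le> (\<Sum>p\<in>J. C p) * pgauge n x y" if "x \<in> Q" "y \<in> Q" for x y
    unfolding d_def sum_distrib_right using C(2) that by (intro sum_mono) auto
  obtain M where M: "\<And>x. x \<in> Q \<Longrightarrow> cmod (h x) \<le> M"
    using compact_bounded_above[OF Qc c(1)] by blast
  have "bdd_lip (pgauge n) Q g"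
  proof (rule bdd_lipI[of _ _ "M + \<epsilon>" "(L1 + L2) * (\<Sum>p\<in>J. C p)"])
    show "cmod (g x) \<le> M + \<epsilon>" if "x \<in> Q" for x
      using near[OF that] M[OF that] norm_triangle_ineq2[of "g x" "h x"] by linarith
    show "0 \<le> (L1 + L2) * (\<Sum>p\<in>J. C p)" using 1 2 C(1) by (simp add: sum_nonneg)
    show "cmod (g x - g y) \<le> (L1 + L2) * (\<Sum>p\<in>J. C p) * pgauge n x y" if "x \<in> Q" "y \<in> Q" for x y
    proof -
      have "(L1 + L2) * d x y \<le> (L1 + L2) * ((\<Sum>p\<in>J. C p) * pgauge n x y)"
        using d_le[OF that] 1(1) 2(1) by (intro mult_left_mono) auto
      then show ?thesis using g_d[OF that] by (simp add: mult.assoc)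
    qed
  qed
  moreover have "g x = g y" if "x \<in> Q" "y \<in> Q" "same_lines n x y" for x y
    using g_d[OF that(1,2)] d0[OF that(3)] by simp
  ultimately show ?thesis using that near unfolding Q_def by blast
qed

text \<open>Rescaling cancels in the coefficients \<open>h k\<close>, and \<open>s\<close> is the
  sum of the \<open>h k x * b x k\<close>. So it is enough to approximate the invariant functions
  \<open>h k\<close> and to reassemble.\<close>

lemma equivariant_approximation:
  assumes n: "n \<ge> 1" and s: "continuous_on (param_set n) s" and eqv: "equivariant n i s" and "\<epsilon> > 0"
  obtains s' where "param_lip n s'" "equivariant n i s'"
    "\<And>x. x \<in> param_set n \<Longrightarrow> cmod (s' x - s x) \<le> \<epsilon>"
proof -
  define Q where "Q = param_set n"
  define b where "b = pvec n i"
  define h where "h k x = s x * cnj (b x k) / sqnorm n (b x)" for k x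
  have sq: "sqnorm n (b x) \<noteq> 0" if "x \<in> Q" for x
    using pvec_nonzero that sqnorm_eq_0_iff unfolding b_def Q_def by blast
  have cont: "continuous_on Q (h k)" for k
    unfolding h_def b_def Q_def
  proof (rule continuous_on_divide)
    show "\<forall>x\<in>param_set n. sqnorm n (pvec n i x) \<noteq> 0" using sq unfolding b_def Q_def by blast
  qed (intro continuous_on_mult continuous_on_cnj continuous_on_pvec continuous_on_sqnorm s)+
  have inv: "h k x = h k y" if k: "k \<le> n" and xy: "x \<in> Q" "y \<in> Q" and same: "same_lines n x y" for k x y
  proof -
    obtain a c where ac: "a \<noteq> 0" "c \<noteq> 0" "scaled n a (fst x) (fst y)" "scaled n c (perp n x) (perp n y)"
      using same_lines_scaled[OF n _ _ same] xy unfolding Q_def by blast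
    define f where "f = (if i < n then a else c)"
    have f: "f \<noteq> 0" "scaled n f (b x) (b y)" using ac by (auto simp: f_def b_def pvec_def)
    have "s y = f * s x" using eqv ac xy unfolding equivariant_def f_def Q_def by blast
    moreover have "b y k = f * b x k" using f k by (simp add: scaled_def)
    ultimately show ?thesis
      unfolding h_def using sqnorm_scaled[OF f(2)] f sq xy by (simp add: field_simps)
  qed
  have "\<forall>k. \<exists>M. M \<ge> 0 \<and> (\<forall>x\<in>Q. cmod (b x k) \<le> M)"
  proof
    fix k
    obtain M where "M > 0" "\<And>x. x \<in> Q \<Longrightarrow> cmod (b x k) \<le> M"
      using compact_bounded_above[OF compact_param_set continuous_on_pvec] unfolding Q_def b_def by blast
    then show "\<exists>M. M \<ge> 0 \<and> (\<forall>x\<in>Q. cmod (b x k) \<le> M)" by (intro exI[of _ M]) simp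
  qed
  then obtain M where M: "\<And>k. M k \<ge> 0" "\<And>k x. x \<in> Q \<Longrightarrow> cmod (b x k) \<le> M k" by metis
  \<comment> \<open>The errors of the coefficients enter with weights at most \<open>M k\<close>;
    the added 1 avoids a division by 0.\<close>
  define \<epsilon>' where "\<epsilon>' = \<epsilon> / ((\<Sum>k\<le>n. M k) + 1)"
  have Mpos: "(\<Sum>k\<le>n. M k) + 1 > 0" using M(1) by (simp add: sum_nonneg add_nonneg_pos)
  have \<epsilon>': "\<epsilon>' > 0" using \<open>\<epsilon> > 0\<close> Mpos by (simp add: \<epsilon>'_def)
  have "\<forall>k. \<exists>g. k \<le> n \<longrightarrow> bdd_lip (pgauge n) Q g \<and> (\<forall>x\<in>Q. cmod (g x - h k x) \<le> \<epsilon>') \<and>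
     (\<forall>x\<in>Q. \<forall>y\<in>Q. same_lines n x y \<longrightarrow> g x = g y)"
  proof
    fix k
    show "\<exists>g. k \<le> n \<longrightarrow> bdd_lip (pgauge n) Q g \<and> (\<forall>x\<in>Q. cmod (g x - h k x) \<le> \<epsilon>') \<and>
     (\<forall>x\<in>Q. \<forall>y\<in>Q. same_lines n x y \<longrightarrow> g x = g y)"
    proof (cases "k \<le> n")
      case True
      obtain g where "bdd_lip (pgauge n) Q g" "\<And>x. x \<in> Q \<Longrightarrow> cmod (g x - h k x) \<le> \<epsilon>'"
        "\<And>x y. \<lbrakk>x \<in> Q; y \<in> Q; same_lines n x y\<rbrakk> \<Longrightarrow> g x = g y"
        using invariant_approximation[OF cont[of k, unfolded Q_def] inv[OF True, unfolded Q_def] \<epsilon>'] unfolding Q_def by blast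
      then show ?thesis by blast
    qed auto
  qed
  then obtain g where g: "\<And>k. k \<le> n \<Longrightarrow> bdd_lip (pgauge n) Q (g k)"
    "\<And>k x. \<lbrakk>k \<le> n; x \<in> Q\<rbrakk> \<Longrightarrow> cmod (g k x - h k x) \<le> \<epsilon>'"
    "\<And>k x y. \<lbrakk>k \<le> n; x \<in> Q; y \<in> Q; same_lines n x y\<rbrakk> \<Longrightarrow> g k x = g k y" by metis
  define s' where "s' x = (\<Sum>k\<le>n. g k x * b x k)" for x
  show ?thesis
  proof (rule that[of s'])
    show "param_lip n s'"
      unfolding s'_def b_def using g(1) by (intro bdd_lip_sum bdd_lip_mult bdd_lip_pvec) (auto simp: Q_def)
    show "equivariant n i s'"
      unfolding equivariant_def
    proof (intro ballI allI impI)
      fix x y a c assume xy: "x \<in> param_set n" "y \<in> param_set n"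
        and sc: "scaled n a (fst x) (fst y)" "scaled n c (perp n x) (perp n y)"
      have "same_lines n x y" by (rule scaled_same_lines(1)[OF xy sc])
      then have "g k y = g k x" if "k \<le> n" for k using g(3)[OF that] xy unfolding Q_def by metis
      moreover have "b y k = (if i < n then a else c) * b x k" if "k \<le> n" for k
        using sc that by (simp add: b_def pvec_def scaled_def)
      ultimately show "s' y = (if i < n then a else c) * s' x"
        unfolding s'_def sum_distrib_left by (intro sum.cong) auto
    qed
    fix x assume x: "x \<in> param_set n"
    then have xQ: "x \<in> Q" by (simp add: Q_def)
    have "s x = (\<Sum>k\<le>n. h k x * b x k)"
    proof -
      have "(\<Sum>k\<le>n. h k x * b x k) = (\<Sum>k\<le>n. s x / sqnorm n (b x) * (b x k * cnj (b x k)))"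
        by (simp add: h_def mult_ac)
      also have "\<dots> = s x / sqnorm n (b x) * sqnorm n (b x)" by (simp add: sqnorm_def sum_distrib_left)
      finally show ?thesis using sq[OF xQ] by simp
    qed
    then have "s' x - s x = (\<Sum>k\<le>n. (g k x - h k x) * b x k)"
      by (simp add: s'_def sum_subtractf left_diff_distrib)
    also have "cmod \<dots> \<le> (\<Sum>k\<le>n. cmod ((g k x - h k x) * b x k))" by (rule norm_sum)
    also have "\<dots> \<le> (\<Sum>k\<le>n. \<epsilon>' * M k)"
      unfolding norm_mult using g(2) M xQ \<epsilon>' by (intro sum_mono mult_mono) auto
    also have "\<dots> = \<epsilon>' * (\<Sum>k\<le>n. M k)" by (simp add: sum_distrib_left)
    also have "\<dots> \<le> \<epsilon>' * ((\<Sum>k\<le>n. M k) + 1)" using \<epsilon>' by (intro mult_left_mono) auto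
    also have "\<dots> = \<epsilon>" using Mpos by (simp add: \<epsilon>'_def)
    finally show "cmod (s' x - s x) \<le> \<epsilon>" .
  qed
qed

section \<open>The boundary of the top cell\<close>

text \<open>With the maximum norm the cell is a polydisc, on whose boundary some coordinate has
  modulus exactly 1 and can be divided out.\<close>

primrec maxmod :: "nat \<Rightarrow> (nat \<Rightarrow> complex) \<Rightarrow> real" where
  "maxmod 0 v = 0"
| "maxmod (Suc k) v = max (maxmod k v) (cmod (v k))"

lemma maxmod_nonneg: "0 \<le> maxmod k v"
  by (induction k) auto

lemma maxmod_ge: "i < k \<Longrightarrow> cmod (v i) \<le> maxmod k v"
  by (induction k) (auto simp: less_Suc_eq le_max_iff_disj)

lemma maxmod_le: "0 \<le> c \<Longrightarrow> (\<And>i. i < k \<Longrightarrow> cmod (v i) \<le> c) \<Longrightarrow> maxmod k v \<le> c"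
  by (induction k) auto

lemma maxmod_attained: "maxmod k v \<noteq> 0 \<Longrightarrow> \<exists>i<k. maxmod k v = cmod (v i)"
  by (induction k) (auto simp: less_Suc_eq max_def)

lemma maxmod_scale: "maxmod k (\<lambda>i. c * v i) = cmod c * maxmod k v"
  by (induction k) (auto simp: norm_mult max_mult_distrib_left)

lemma maxmod_diff: "\<bar>maxmod k v - maxmod k w\<bar> \<le> (\<Sum>i<k. cmod (v i - w i))"
proof (induction k)
  case (Suc k)
  have "\<bar>cmod (v k) - cmod (w k)\<bar> \<le> cmod (v k - w k)" by (rule norm_triangle_ineq3)
  moreover have "0 \<le> (\<Sum>i<k. cmod (v i - w i))" by (simp add: sum_nonneg)
  ultimately show ?case using Suc by (simp add: max_def) linarith
qed simp

lemma continuous_on_maxmod: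
  "(\<And>i. i < k \<Longrightarrow> continuous_on S (\<lambda>x. f x i)) \<Longrightarrow> continuous_on S (\<lambda>x. maxmod k (f x))"
  by (induction k) (auto intro!: continuous_intros)

text \<open>Represents the face \<open>|z| = 1\<close>, where \<open>r = 0\<close>: scaling to
  \<open>fst x i = 1\<close> and \<open>snd x j = 1\<close> leaves \<open>(n - 1) + (n - 1)\<close>
  complex coordinates.\<close>

definition piece1 :: "nat \<Rightarrow> nat \<Rightarrow> nat \<Rightarrow> params set" where
  "piece1 n i j = {x \<in> param_set n. fst x i = 1 \<and> fst x n = 0 \<and> snd x j = 1}"

text \<open>Represents the face on which the last coordinate of \<open>u\<close> is 0: after scaling
  to \<open>snd x j = 1\<close> there remain \<open>n\<close> coordinates of \<open>z\<close> and
  \<open>n - 2\<close> of \<open>u\<close>, while \<open>r\<close> is a function of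
  \<open>z\<close>.\<close>

definition piece2 :: "nat \<Rightarrow> nat \<Rightarrow> params set" where
  "piece2 n j = {x \<in> param_set n. fst x n = of_real (1 - maxmod n (fst x)) \<and> snd x (n - 1) = 0 \<and> snd x j = 1}"

definition pieces :: "nat \<Rightarrow> params set set" where
  "pieces n = (\<lambda>(i, j). piece1 n i j) ` ({..<n} \<times> {..<n}) \<union> piece2 n ` {..<n - 1}"

lemma finite_pieces: "finite (pieces n)"
  by (simp add: pieces_def)

lemma thin_piece1:
  assumes "i < n" "j < n"
  shows "thin n (piece1 n i j)"
proof -
  define V where "V = {..<n} - {i}"
  define W where "W = {..<n} - {j}"
  have "card V + card W \<le> 2 * n - 2" using assms by (simp add: V_def W_def)
  moreover have "pgauge n x y \<le> 1 * ((\<Sum>k\<in>V. cmod (fst x k - fst y k)) + (\<Sum>k\<in>W. cmod (snd x k - snd y k)))"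
    if xy: "x \<in> piece1 n i j" "y \<in> piece1 n i j" for x y
  proof -
    have "(\<Sum>k\<le>n. cmod (fst x k - fst y k)) = (\<Sum>k\<in>V. cmod (fst x k - fst y k))"
      using xy by (intro sum.mono_neutral_right) (auto simp: V_def piece1_def le_less)
    moreover have "(\<Sum>k<n. cmod (snd x k - snd y k)) = (\<Sum>k\<in>W. cmod (snd x k - snd y k))"
      using xy by (intro sum.mono_neutral_right) (auto simp: W_def piece1_def)
    ultimately show ?thesis by (simp add: pgauge_def)
  qed
  moreover have "V \<subseteq> {..n}" "W \<subseteq> {..<n}" "piece1 n i j \<subseteq> param_set n"
    by (auto simp: V_def W_def piece1_def)
  ultimately show ?thesis unfolding thin_def by (meson zero_le_one)
qed

lemma thin_piece2:
  assumes "j < n - 1"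
  shows "thin n (piece2 n j)"
proof -
  define V where "V = {..<n}"
  define W where "W = {..<n} - {j, n - 1}"
  have "card W = n - 2" unfolding W_def using assms by (subst card_Diff_subset) auto
  then have "card V + card W \<le> 2 * n - 2" using assms by (simp add: V_def)
  \<comment> \<open>The factor 2 accounts for \<open>fst x n\<close>, a function of the other
    coordinates of the first vector with Lipschitz constant 1.\<close>
  moreover have "pgauge n x y \<le> 2 * ((\<Sum>k\<in>V. cmod (fst x k - fst y k)) + (\<Sum>k\<in>W. cmod (snd x k - snd y k)))"
    if xy: "x \<in> piece2 n j" "y \<in> piece2 n j" for x y
  proof -
    have "fst x n - fst y n = of_real (maxmod n (fst y) - maxmod n (fst x))"
      using xy by (simp add: piece2_def)
    then have "cmod (fst x n - fst y n) = \<bar>maxmod n (fst y) - maxmod n (fst x)\<bar>"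
      by (simp only: norm_of_real)
    also have "\<dots> \<le> (\<Sum>k<n. cmod (fst x k - fst y k))"
      using maxmod_diff[of n "fst x" "fst y"] by (simp add: abs_minus_commute)
    finally have "(\<Sum>k\<le>n. cmod (fst x k - fst y k)) \<le> 2 * (\<Sum>k\<in>V. cmod (fst x k - fst y k))"
      by (simp add: V_def flip: lessThan_Suc_atMost)
    moreover have "(\<Sum>k<n. cmod (snd x k - snd y k)) = (\<Sum>k\<in>W. cmod (snd x k - snd y k))"
      using xy by (intro sum.mono_neutral_right) (auto simp: W_def piece2_def)
    moreover have "(\<Sum>k\<in>W. cmod (snd x k - snd y k)) \<ge> 0" by (simp add: sum_nonneg)
    ultimately show ?thesis by (simp add: pgauge_def)
  qed
  moreover have "V \<subseteq> {..n}" "W \<subseteq> {..<n}" "piece2 n j \<subseteq> param_set n"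
    by (auto simp: V_def W_def piece2_def)
  ultimately show ?thesis unfolding thin_def by (meson zero_le_numeral)
qed

lemma thin_pieces: "S \<in> pieces n \<Longrightarrow> thin n S"
  unfolding pieces_def using thin_piece1 thin_piece2 by auto

lemma framed_cover:
  obtains \<A> where "finite \<A>" "\<And>A. A \<in> \<A> \<Longrightarrow> framed n A" "param_set n \<subseteq> \<Union>\<A>"
proof -
  have nz: "sqnorm n (pvec n n x) \<noteq> 0" if "x \<in> param_set n" for x
    using pvec_nonzero[OF that] sqnorm_eq_0_iff by blast
  obtain m where m: "m > 0" "\<And>x. x \<in> param_set n \<Longrightarrow> m \<le> cmod (sqnorm n (pvec n n x))"
    using compact_bounded_below[OF compact_param_set continuous_on_sqnorm nz] by blast
  \<comment> \<open>\<open>1/2\<close> is the bound for the first vector in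
    \<open>param_set\<close>. For the second, among \<open>n + 1\<close> squared moduli with sum at
    least \<open>m\<close> one is at least \<open>m / (n + 1)\<close>.\<close>
  define \<epsilon> where "\<epsilon> = min (1/2) (sqrt (m / (n + 1)))"
  have \<epsilon>: "\<epsilon> > 0" "\<epsilon> \<le> 1/2" using m by (auto simp: \<epsilon>_def)
  have "0 \<le> \<epsilon>" "\<epsilon> \<le> sqrt (m / (n + 1))" using \<epsilon>(1) by (auto simp: \<epsilon>_def)
  then have "\<epsilon>\<^sup>2 \<le> (sqrt (m / (n + 1)))\<^sup>2" by (rule power_mono[rotated])
  then have \<epsilon>2: "\<epsilon>\<^sup>2 * (n + 1) \<le> m" using m by (simp add: field_simps)
  define A where "A k l = {x. \<epsilon> \<le> cmod (fst x k) \<and> \<epsilon> \<le> cmod (perp n x l)}" for k l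
  show ?thesis
  proof (rule that[of "(\<lambda>(k, l). A k l) ` ({..n} \<times> {..n})"])
    show "framed n B" if "B \<in> (\<lambda>(k, l). A k l) ` ({..n} \<times> {..n})" for B
      using that \<epsilon>(1) unfolding framed_def A_def by blast
    show "param_set n \<subseteq> \<Union> ((\<lambda>(k, l). A k l) ` ({..n} \<times> {..n}))"
    proof
      fix x assume x: "x \<in> param_set n"
      then obtain k where k: "k \<le> n" "\<epsilon> \<le> cmod (fst x k)"
        using \<epsilon>(2) unfolding param_set_def by fastforce
      have "\<exists>l\<le>n. \<epsilon> \<le> cmod (perp n x l)"
      proof (rule ccontr)
        assume "\<not> ?thesis"
        then have lt: "cmod (perp n x l) < \<epsilon>" if "l \<le> n" for l using that by force
        have "cmod (sqnorm n (perp n x)) = \<bar>\<Sum>k\<le>n. (cmod (perp n x k))\<^sup>2\<bar>" unfolding sqnorm_eq by (rule norm_of_real)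
        also have "\<dots> = (\<Sum>k\<le>n. (cmod (perp n x k))\<^sup>2)" by (simp add: sum_nonneg)
        also have "\<dots> < (\<Sum>k\<le>n. \<epsilon>\<^sup>2)" using lt by (intro sum_strict_mono power_strict_mono) auto
        also have "\<dots> \<le> m" using \<epsilon>2 by (simp add: mult.commute add.commute)
        finally show False using m(2)[OF x] by (simp add: pvec_def)
      qed
      then obtain l where "l \<le> n" "\<epsilon> \<le> cmod (perp n x l)" by blast
      then show "x \<in> \<Union> ((\<lambda>(k, l). A k l) ` ({..n} \<times> {..n}))" using k by (force simp: A_def)
    qed
  qed simp
qed

text \<open>The characteristic map of the top cell.\<close>

definition cell :: "nat \<Rightarrow> (nat \<Rightarrow> complex) \<Rightarrow> params" where
  "cell n \<xi> = (\<lambda>k. if k < n then \<xi> k else if k = n then of_real (1 - maxmod n \<xi>) else 0,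
     \<lambda>k. if k < n - 1 then \<xi> (n + k) else if k = n - 1 then of_real (1 - maxmod (n - 1) (\<lambda>k. \<xi> (n + k))) else 0)"

lemma maxmod_cong: "(\<And>i. i < k \<Longrightarrow> v i = w i) \<Longrightarrow> maxmod k v = maxmod k w"
  by (induction k) auto

lemma cell_in_param_set:
  assumes n: "n \<ge> 1" and le: "maxmod (2 * n - 1) \<xi> \<le> 1"
  shows "cell n \<xi> \<in> param_set n"
proof -
  have c: "cmod (\<xi> k) \<le> 1" if "k < 2 * n - 1" for k using maxmod_ge[OF that, of \<xi>] le by linarith
  \<comment> \<open>Either \<open>maxmod m w\<close> is at most \<open>1/2\<close> and the added
    coordinate \<open>1 - maxmod m w\<close> is large, or the maximum is attained at a large
    coordinate.\<close>
  have half: "\<exists>k\<le>m. 1/2 \<le> (if k < m then cmod (w k) else 1 - maxmod m w)" for m and w :: "nat \<Rightarrow> complex"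
  proof (cases "maxmod m w \<le> 1/2")
    case True
    then show ?thesis by (intro exI[of _ m]) auto
  next
    case False
    then obtain i where "i < m" "maxmod m w = cmod (w i)" using maxmod_attained[of m w] by auto
    with False show ?thesis by (intro exI[of _ i]) auto
  qed
  have m1: "maxmod n \<xi> \<le> 1" using c n by (intro maxmod_le) auto
  have m2: "maxmod (n - 1) (\<lambda>k. \<xi> (n + k)) \<le> 1" using c n by (intro maxmod_le) auto
  have m0: "0 \<le> maxmod n \<xi>" "0 \<le> maxmod (n - 1) (\<lambda>k. \<xi> (n + k))" by (rule maxmod_nonneg)+
  obtain k where k: "k \<le> n" "1/2 \<le> (if k < n then cmod (\<xi> k) else 1 - maxmod n \<xi>)" using half by blast
  have k': "1/2 \<le> cmod (fst (cell n \<xi>) k)" using k by (auto simp: cell_def simp del: of_real_diff split: if_splits)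
  obtain l where l: "l \<le> n - 1" "1/2 \<le> (if l < n - 1 then cmod (\<xi> (n + l)) else 1 - maxmod (n - 1) (\<lambda>k. \<xi> (n + k)))"
    using half[of "n - 1" "\<lambda>k. \<xi> (n + k)"] by blast
  have l': "1/2 \<le> cmod (snd (cell n \<xi>) l)" using l by (auto simp: cell_def simp del: of_real_diff split: if_splits)
  show ?thesis
    unfolding param_set_def
  proof (intro CollectI conjI allI impI)
    show "cmod (fst (cell n \<xi>) i) \<le> 1" for i
      using c[of i] m1 m0 by (auto simp: cell_def simp del: of_real_diff)
    show "cmod (snd (cell n \<xi>) i) \<le> 1" for i
      using c[of "n + i"] m2 m0 by (auto simp: cell_def simp del: of_real_diff)
    show "\<exists>k\<le>n. 1/2 \<le> cmod (fst (cell n \<xi>) k)" using k(1) k' by blast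
    have "l < n" using l(1) n by linarith
    then show "\<exists>k<n. 1/2 \<le> cmod (snd (cell n \<xi>) k)" using l' by blast
    show "fst (cell n \<xi>) i = 0" if "i > n" for i using that by (simp add: cell_def)
    show "snd (cell n \<xi>) i = 0" if "i \<ge> n" for i using that n by (auto simp: cell_def)
    show "Im (fst (cell n \<xi>) n) = 0" "0 \<le> Re (fst (cell n \<xi>) n)" using m1 by (simp_all add: cell_def)
  qed
qed

lemma perp_cmult: "perp n (v, \<lambda>k. c * u k) k = c * perp n (v, u) k"
  by (simp add: perp_def Let_def herm_def sum_distrib_left algebra_simps)

lemma herm_add: "herm n (\<lambda>k. u k + u' k) v = herm n u v + herm n u' v"
  by (simp add: herm_def sum.distrib distrib_right)

lemma herm_cmult: "herm n (\<lambda>k. c * u k) v = c * herm n u v"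
  by (simp add: herm_def sum_distrib_left mult.assoc)

text \<open>On the face \<open>|z| = 1\<close> the pair of lines only depends on the phase of \<open>z\<close> through the
  parameter \<open>u\<close>, and this dependence can be undone by a unitary change of \<open>u\<close>.\<close>

lemma perp_phase:
  fixes u v :: "nat \<Rightarrow> complex"
  assumes \<zeta>: "cmod \<zeta> = 1" and v0: "v n = 0" and H: "herm n v v \<noteq> 0"
  defines "v' \<equiv> \<lambda>k. cnj \<zeta> * v k"
  defines "u' \<equiv> \<lambda>k. u k + (cnj \<zeta> - 1) * (\<zeta> * herm n u v / herm n v v) * v' k"
  shows "perp n (v', u') k = perp n (v, u) k"
proof -
  have z: "\<zeta> * cnj \<zeta> = 1" using \<zeta> complex_norm_square[of \<zeta>] by simp
  have hvv: "herm n v' v' = herm n v v"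
  proof -
    have "herm n v' v' = (\<Sum>k<n. (\<zeta> * cnj \<zeta>) * (v k * cnj (v k)))"
      by (simp only: herm_def v'_def complex_cnj_mult complex_cnj_cnj mult_ac)
    then show ?thesis by (simp add: z herm_def)
  qed
  have huv: "herm n w v' = \<zeta> * herm n w v" for w
    by (simp add: herm_def v'_def sum_distrib_left mult_ac)
  \<comment> \<open>\<open>u'\<close> is \<open>u\<close> with its component along \<open>v'\<close>
    multiplied by \<open>cnj \<zeta>\<close>, which undoes the factor \<open>\<zeta>\<close> in
    \<open>huv\<close>.\<close>
  have hu'v': "herm n u' v' = herm n u v"
  proof -
    have "herm n u' v' = \<zeta> * herm n u v + (cnj \<zeta> - 1) * (\<zeta> * herm n u v / herm n v v) * herm n v' v'"
      unfolding u'_def herm_add herm_cmult by (simp add: huv)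
    also have "\<dots> = \<zeta> * herm n u v + (cnj \<zeta> - 1) * (\<zeta> * herm n u v)" using H by (simp add: hvv)
    also have "\<dots> = (\<zeta> * cnj \<zeta>) * herm n u v" by (simp add: algebra_simps)
    finally show ?thesis by (simp add: z)
  qed
  have "herm n v v * u' k - herm n u v * v' k = herm n v v * u k - herm n u v * v k" for k
  proof -
    have "herm n v v * u' k = herm n v v * u k + (cnj \<zeta> - 1) * (\<zeta> * herm n u v) * v' k"
      using H by (simp add: u'_def field_simps)
    also have "\<dots> - herm n u v * v' k = herm n v v * u k + (\<zeta> * cnj \<zeta>) * herm n u v * v' k - herm n u v * (\<zeta> * v' k) - herm n u v * v' k"
      by (simp add: algebra_simps)
    also have "\<zeta> * v' k = v k" using z by (simp add: v'_def mult.assoc[symmetric])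
    finally show ?thesis by (simp add: z)
  qed
  then show ?thesis by (simp add: perp_def Let_def hu'v' hvv v0) (simp add: v'_def v0)
qed

text \<open>A coordinate of modulus 1 is normalised to 1. If it belongs to \<open>z\<close>,
  dividing the first vector by it also changes \<open>perp\<close>, so \<open>u\<close> is adjusted
  by \<open>perp_phase\<close> and then rescaled to land in a \<open>piece1\<close>. If it belongs
  to \<open>u\<close>, dividing \<open>u\<close> by it only rescales \<open>perp\<close> and lands
  in a \<open>piece2\<close>.\<close>

lemma cell_boundary:
  assumes n: "n \<ge> 1" and bd: "maxmod (2 * n - 1) \<xi> = 1"
  obtains S y a b where "S \<in> pieces n" "y \<in> S" "y \<in> param_set n" "a \<noteq> 0" "b \<noteq> 0"
    "scaled n a (fst y) (fst (cell n \<xi>))" "scaled n b (perp n y) (perp n (cell n \<xi>))"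
proof -
  let ?x = "cell n \<xi>"
  have xp: "?x \<in> param_set n" using cell_in_param_set[OF n] bd by simp
  have c: "cmod (\<xi> k) \<le> 1" if "k < 2 * n - 1" for k using maxmod_ge[OF that, of \<xi>] bd by linarith
  obtain m where m: "m < 2 * n - 1" "cmod (\<xi> m) = 1" using maxmod_attained[of "2 * n - 1" \<xi>] bd by auto
  show ?thesis
  proof (cases "m < n")
    case True
    define \<zeta> where "\<zeta> = \<xi> m"
    define v u where "v = fst ?x" and "u = snd ?x"
    have x: "?x = (v, u)" by (simp add: v_def u_def)
    have z: "cnj \<zeta> * \<zeta> = 1" using m complex_norm_square[of \<zeta>] by (simp add: \<zeta>_def mult.commute)
    have "maxmod n \<xi> \<le> 1" using c n by (intro maxmod_le) auto
    then have mm: "maxmod n \<xi> = 1" using maxmod_ge[OF True, of \<xi>] m by simp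
    then have vn: "v n = 0" by (simp add: v_def cell_def)
    have vm: "v m = \<zeta>" using True by (simp add: v_def cell_def \<zeta>_def)
    have "(cmod (v m))\<^sup>2 \<le> (\<Sum>k<n. (cmod (v k))\<^sup>2)" using True by (intro member_le_sum) auto
    then have "(\<Sum>k<n. (cmod (v k))\<^sup>2) \<noteq> 0" using m vm by (auto simp: \<zeta>_def)
    then have H: "herm n v v \<noteq> 0" unfolding herm_self of_real_eq_0_iff .
    define v' where "v' = (\<lambda>k. cnj \<zeta> * v k)"
    define u'' where "u'' = (\<lambda>k. u k + (cnj \<zeta> - 1) * (\<zeta> * herm n u v / herm n v v) * v' k)"
    have perp'': "perp n (v', u'') k = perp n ?x k" for k
      unfolding x u''_def v'_def by (rule perp_phase[OF _ vn H]) (use m in \<open>simp add: \<zeta>_def\<close>)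
    have "maxmod n u'' \<noteq> 0"
    proof
      assume "maxmod n u'' = 0"
      then have 0: "u'' k = 0" if "k < n" for k using maxmod_ge[OF that, of u''] by simp
      have "herm n u'' v' = 0" using 0 by (simp add: herm_def)
      then have "perp n (v', u'') k = 0" for k using 0 by (simp add: perp_def Let_def)
      then show False using perp_nonzero[OF xp] perp'' by (auto simp: nonzero_def)
    qed
    \<comment> \<open>Dividing by an entry of largest modulus keeps the others within modulus 1, as
      \<open>param_set\<close> requires.\<close>
    then obtain j where j: "j < n" "maxmod n u'' = cmod (u'' j)" using maxmod_attained by blast
    then have uj: "u'' j \<noteq> 0" using \<open>maxmod n u'' \<noteq> 0\<close> by auto
    define y where "y = (v', \<lambda>k. if k < n then inverse (u'' j) * u'' k else 0)"
    have perp_y: "perp n y k = inverse (u'' j) * perp n ?x k" for k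
    proof -
      have "perp n y k = perp n (v', \<lambda>k. inverse (u'' j) * u'' k) k"
        by (simp add: y_def perp_def Let_def herm_def)
      then show ?thesis unfolding perp_cmult perp'' .
    qed
    have v'1: "cmod (v' k) \<le> 1" for k
      using xp m by (simp add: v'_def norm_mult \<zeta>_def param_set_def v_def)
    have v'm: "v' m = 1" using vm z by (simp add: v'_def)
    have u'1: "cmod (inverse (u'' j) * u'' k) \<le> 1" if "k < n" for k
    proof -
      have "cmod (inverse (u'' j) * u'' k) = cmod (u'' k) / cmod (u'' j)"
        by (simp add: norm_divide field_class.field_divide_inverse norm_mult norm_inverse mult.commute)
      then show ?thesis using maxmod_ge[OF that, of u''] j uj by (simp add: divide_le_eq_1)
    qed
    have y: "y \<in> param_set n"
      unfolding param_set_def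
    proof (intro CollectI conjI allI impI)
      show "cmod (fst y k) \<le> 1" for k using v'1 by (simp add: y_def)
      show "cmod (snd y k) \<le> 1" for k using u'1 by (simp add: y_def)
      show "fst y k = 0" if "k > n" for k using that by (simp add: y_def v'_def v_def cell_def)
      show "snd y k = 0" if "k \<ge> n" for k using that by (simp add: y_def)
      show "Im (fst y n) = 0" "0 \<le> Re (fst y n)" using vn by (simp_all add: y_def v'_def)
      show "\<exists>k\<le>n. 1/2 \<le> cmod (fst y k)" using True v'm by (intro exI[of _ m]) (simp add: y_def)
      show "\<exists>k<n. 1/2 \<le> cmod (snd y k)" using j uj by (intro exI[of _ j]) (simp add: y_def)
    qed
    then have "y \<in> piece1 n m j"
      using v'm vn j uj by (simp add: piece1_def y_def v'_def)
    moreover have "piece1 n m j \<in> pieces n" using True j by (auto simp: pieces_def)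
    moreover have "scaled n \<zeta> (fst y) (fst ?x)"
      using z by (simp add: scaled_def y_def v'_def v_def mult.assoc[symmetric] mult.commute[of \<zeta>])
    moreover have "scaled n (u'' j) (perp n y) (perp n ?x)" using uj by (simp add: scaled_def perp_y)
    moreover have "\<zeta> \<noteq> 0" using z by auto
    ultimately show ?thesis using that y uj by blast
  next
    case False
    define j where "j = m - n"
    have j: "j < n - 1" "n + j = m" using m False by (auto simp: j_def)
    define b where "b = \<xi> m"
    have b: "cmod b = 1" "b \<noteq> 0" using m by (auto simp: b_def)
    have "maxmod (n - 1) (\<lambda>k. \<xi> (n + k)) \<le> 1" using c n by (intro maxmod_le) auto
    then have mm: "maxmod (n - 1) (\<lambda>k. \<xi> (n + k)) = 1"
      using maxmod_ge[OF j(1), of "\<lambda>k. \<xi> (n + k)"] m j by simp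
    define y where "y = (fst ?x, \<lambda>k. inverse b * snd ?x k)"
    have perp_y: "perp n y k = inverse b * perp n ?x k" for k
      unfolding y_def perp_cmult by simp
    have uj: "snd y j = 1" using j b by (simp add: y_def cell_def b_def)
    have y: "y \<in> param_set n"
      unfolding param_set_def
    proof (intro CollectI conjI allI impI)
      show "\<exists>k<n. 1/2 \<le> cmod (snd y k)" using uj j by (intro exI[of _ j]) simp
    qed (use xp b in \<open>auto simp: param_set_def y_def norm_mult norm_inverse\<close>)
    have "maxmod n (fst ?x) = maxmod n \<xi>" by (rule maxmod_cong) (simp add: cell_def)
    then have "y \<in> piece2 n j" using y uj mm n by (simp add: piece2_def y_def cell_def)
    moreover have "piece2 n j \<in> pieces n" using j by (auto simp: pieces_def)
    moreover have "scaled n 1 (fst y) (fst ?x)" by (simp add: scaled_def y_def)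
    moreover have "scaled n b (perp n y) (perp n ?x)" using b by (simp add: scaled_def perp_y)
    ultimately show ?thesis using that y b by (metis zero_neq_one)
  qed
qed

section \<open>The reference section and its zeros\<close>

definition std_section :: "nat \<Rightarrow> nat \<Rightarrow> params \<Rightarrow> complex" where
  "std_section n i x = pvec n i x (if i < n then i else i - n)"

lemma bdd_lip_std_section: "i < 2 * n - 1 \<Longrightarrow> param_lip n (std_section n i)"
  unfolding std_section_def by (intro bdd_lip_pvec) auto

lemma equivariant_std_section: "i < 2 * n - 1 \<Longrightarrow> equivariant n i (std_section n i)"
  unfolding std_section_def by (intro equivariant_pvec) auto

lemma continuous_on_std_section: "continuous_on S (std_section n i)"
  unfolding std_section_def by (rule continuous_on_pvec)

lemma compact_piece:
  assumes "S \<in> pieces n" shows "compact S"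
proof -
  have cm: "continuous_on UNIV (\<lambda>x::params. maxmod n (fst x))"
    by (intro continuous_on_maxmod continuous_intros)
  have "closed {x::params. fst x i = 1}" "closed {x::params. fst x n = 0}" "closed {x::params. snd x j = 1}"
    "closed {x::params. snd x (n - 1) = 0}" "closed {x::params. fst x n = of_real (1 - maxmod n (fst x))}" for i j
    by (intro closed_Collect_eq continuous_on_params_coord continuous_on_const continuous_on_of_real
        continuous_on_diff cm)+
  note cl = this
  have eq1: "piece1 n i j = param_set n \<inter> ({x. fst x i = 1} \<inter> {x. fst x n = 0} \<inter> {x. snd x j = 1})" for i j
    by (auto simp: piece1_def)
  have 1: "compact (piece1 n i j)" for i j
    unfolding eq1 by (intro compact_Int_closed compact_param_set closed_Int cl)
  have eq2: "piece2 n j = param_set n \<inter> ({x. fst x n = of_real (1 - maxmod n (fst x))} \<inter> {x. snd x (n - 1) = 0} \<inter> {x. snd x j = 1})" for j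
    by (auto simp: piece2_def)
  have 2: "compact (piece2 n j)" for j
    unfolding eq2 by (intro compact_Int_closed compact_param_set closed_Int cl)
  show ?thesis using assms 1 2 by (auto simp: pieces_def)
qed

text \<open>On \<open>piece1\<close> the coordinate \<open>fst x i = 1\<close> is a component. On
  \<open>piece2\<close> with \<open>z = 0\<close> one has \<open>r = 1\<close>, so
  \<open>perp n x\<close> agrees with \<open>u\<close> in the first \<open>n\<close> entries, and
  \<open>u\<close> has the entry 1 at \<open>j < n - 1\<close>.\<close>

lemma std_section_piece_nonzero:
  assumes n: "n \<ge> 1" and "S \<in> pieces n" "x \<in> S"
  shows "\<exists>i<2 * n - 1. std_section n i x \<noteq> 0"
proof -
  consider i j where "i < n" "x \<in> piece1 n i j" | j where "j < n - 1" "x \<in> piece2 n j"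
    using assms by (auto simp: pieces_def)
  then show ?thesis
  proof cases
    case 1
    then show ?thesis by (intro exI[of _ i]) (auto simp: std_section_def pvec_def piece1_def)
  next
    case 2
    show ?thesis
    proof (cases "\<exists>i<n. fst x i \<noteq> 0")
      case True
      then obtain i where "i < n" "fst x i \<noteq> 0" by blast
      then show ?thesis by (intro exI[of _ i]) (auto simp: std_section_def pvec_def)
    next
      case False
      then have 0: "fst x i = 0" if "i < n" for i using that by blast
      then have "maxmod n (fst x) = 0"
        using maxmod_le[of 0 n "fst x"] maxmod_nonneg[of n "fst x"] by auto
      moreover have "herm n (fst x) (fst x) = 0" "herm n (snd x) (fst x) = 0" using 0 by (simp_all add: herm_def)
      ultimately have "perp n x j = 1" using 2 by (simp add: perp_def Let_def piece2_def)
      then show ?thesis using 2 by (intro exI[of _ "n + j"]) (auto simp: std_section_def pvec_def)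
    qed
  qed
qed

lemma sections_bounded_below:
  fixes s :: "nat \<Rightarrow> params \<Rightarrow> complex"
  assumes S: "compact S" and s: "\<And>i. i < m \<Longrightarrow> continuous_on S (s i)"
    and nz: "\<And>x. x \<in> S \<Longrightarrow> \<exists>i<m. s i x \<noteq> 0"
  obtains \<beta> where "\<beta> > 0" "\<And>x. x \<in> S \<Longrightarrow> \<exists>i<m. \<beta> \<le> cmod (s i x)"
proof -
  define f where "f x = complex_of_real (\<Sum>i<m. cmod (s i x))" for x
  have f: "continuous_on S f" unfolding f_def
    by (intro continuous_on_of_real continuous_on_sum continuous_on_norm s) simp
  have fnz: "f x \<noteq> 0" if "x \<in> S" for x
  proof -
    obtain i where "i < m" "s i x \<noteq> 0" using nz \<open>x \<in> S\<close> by blast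
    then have "(\<Sum>i<m. cmod (s i x)) > 0" by (intro sum_pos2[of _ i]) auto
    then show ?thesis unfolding f_def of_real_eq_0_iff by linarith
  qed
  obtain c where c: "c > 0" "\<And>x. x \<in> S \<Longrightarrow> c \<le> cmod (f x)"
    using compact_bounded_below[OF S f fnz] by blast
  \<comment> \<open>With \<open>m + 1\<close> in place of \<open>m\<close>, the sum of
    \<open>m\<close> small moduli falls strictly below \<open>c\<close>.\<close>
  show ?thesis
  proof (rule that[of "c / (m + 1)"])
    show "c / (m + 1) > 0" using c by simp
    fix x assume x: "x \<in> S"
    show "\<exists>i<m. c / (m + 1) \<le> cmod (s i x)"
    proof (rule ccontr)
      assume "\<not> ?thesis"
      then have lt: "cmod (s i x) \<le> c / (m + 1)" if "i < m" for i using that by force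
      have "cmod (f x) = (\<Sum>i<m. cmod (s i x))" unfolding f_def norm_of_real by (simp add: sum_nonneg)
      also have "\<dots> \<le> of_nat (card {..<m}) * (c / (m + 1))" using lt by (intro sum_bounded_above) auto
      also have "\<dots> < c" using c(1) by (simp add: field_simps)
      finally show False using c(2)[OF x] by simp
    qed
  qed
qed

section \<open>The degree argument\<close>

text \<open>The coordinates from \<open>m\<close> on are unconstrained, which adds a contractible
  factor to the complement of 0.\<close>

definition nonvanishing :: "nat \<Rightarrow> (nat \<Rightarrow> complex) set" where
  "nonvanishing m = {\<xi>. \<exists>i<m. \<xi> i \<noteq> 0}"

definition tuple :: "nat \<Rightarrow> (nat \<Rightarrow> 'a \<Rightarrow> complex) \<Rightarrow> 'a \<Rightarrow> nat \<Rightarrow> complex" where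
  "tuple m f x i = (if i < m then f i x else 0)"

lemma homotopic_tuple:
  fixes h :: "nat \<Rightarrow> real \<times> 'a::topological_space \<Rightarrow> complex"
  assumes h: "\<And>i. i < m \<Longrightarrow> continuous_on ({0..1} \<times> S) (h i)"
    and nz: "\<And>t x. \<lbrakk>0 \<le> t; t \<le> 1; x \<in> S\<rbrakk> \<Longrightarrow> \<exists>i<m. h i (t, x) \<noteq> 0"
  shows "homotopic_with_canon (\<lambda>_. True) S (nonvanishing m)
    (tuple m (\<lambda>i x. h i (0, x))) (tuple m (\<lambda>i x. h i (1, x)))"
proof -
  have "continuous_on ({0..1} \<times> S) (tuple m h)"
  proof (rule continuous_on_coordinatewise_then_product)
    fix i show "continuous_on ({0..1} \<times> S) (\<lambda>x. tuple m h x i)"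
      using h[of i] by (cases "i < m") (simp_all add: tuple_def)
  qed
  moreover have "tuple m h \<in> {0..1::real} \<times> S \<rightarrow> nonvanishing m"
  proof (rule Pi_I)
    fix p :: "real \<times> 'a" assume "p \<in> {0..1} \<times> S"
    then have "\<exists>i<m. h i (fst p, snd p) \<noteq> 0" by (intro nz) auto
    then show "tuple m h p \<in> nonvanishing m" by (auto simp: nonvanishing_def tuple_def)
  qed
  ultimately have "continuous_map (prod_topology (top_of_set {0..1}) (top_of_set S)) (top_of_set (nonvanishing m)) (tuple m h)"
    unfolding prod_topology_subtopology_eu continuous_map_subtopology_eu by blast
  then show ?thesis unfolding homotopic_with_def
    by (intro exI[of _ "tuple m h"] conjI allI ballI) (simp_all add: tuple_def fun_eq_iff)
qed

lemma homotopic_segment: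
  fixes f g :: "nat \<Rightarrow> 'a::topological_space \<Rightarrow> complex"
  assumes f: "\<And>i. i < m \<Longrightarrow> continuous_on S (f i)" and g: "\<And>i. i < m \<Longrightarrow> continuous_on S (g i)"
    and nz: "\<And>t x. \<lbrakk>0 \<le> t; t \<le> 1; x \<in> S\<rbrakk> \<Longrightarrow> \<exists>i<m. of_real (1 - t) * f i x + of_real t * g i x \<noteq> 0"
  shows "homotopic_with_canon (\<lambda>_. True) S (nonvanishing m) (tuple m f) (tuple m g)"
proof -
  define h where "h i p = of_real (1 - fst p) * f i (snd p) + of_real (fst p) * g i (snd p)" for i and p :: "real \<times> 'a"
  have "homotopic_with_canon (\<lambda>_. True) S (nonvanishing m) (tuple m (\<lambda>i x. h i (0, x))) (tuple m (\<lambda>i x. h i (1, x)))"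
  proof (rule homotopic_tuple)
    show "continuous_on ({0..1} \<times> S) (h i)" if "i < m" for i
      unfolding h_def
      by (intro continuous_intros continuous_on_compose2[OF f[OF that]] continuous_on_compose2[OF g[OF that]]) auto
    show "\<exists>i<m. h i (t, x) \<noteq> 0" if "0 \<le> t" "t \<le> 1" "x \<in> S" for t x
      using nz[OF that] by (simp add: h_def)
  qed
  then show ?thesis by (simp add: h_def)
qed

section \<open>Spheres in real and complex coordinates\<close>

definition to_complex :: "(nat \<Rightarrow> real) \<Rightarrow> nat \<Rightarrow> complex" where
  "to_complex x k = Complex (x (2 * k)) (x (2 * k + 1))"

definition norm_tuple :: "nat \<Rightarrow> (nat \<Rightarrow> complex) \<Rightarrow> real" where
  "norm_tuple m \<xi> = sqrt (\<Sum>i<m. (cmod (\<xi> i))\<^sup>2)"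

text \<open>Radial retraction onto the sphere, with real and imaginary parts interleaved as in
  \<open>to_complex\<close>.\<close>

definition to_sphere :: "nat \<Rightarrow> (nat \<Rightarrow> complex) \<Rightarrow> nat \<Rightarrow> real" where
  "to_sphere m \<xi> j = (if j < 2 * m then
     (if even j then Re (\<xi> (j div 2)) else Im (\<xi> (j div 2))) / norm_tuple m \<xi> else 0)"

lemma sum_pairs: "(\<Sum>j<2 * m. g j) = (\<Sum>i<m. g (2 * i) + g (2 * i + 1))"
  for g :: "nat \<Rightarrow> 'a::comm_monoid_add"
  by (induction m) (auto simp: add.assoc)

abbreviation sphere_set :: "nat \<Rightarrow> (nat \<Rightarrow> real) set" where
  "sphere_set m \<equiv> {x. (\<Sum>j<2 * m. (x j)\<^sup>2) = 1 \<and> (\<forall>j\<ge>2 * m. x j = 0)}"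

lemma nsphere_eq:
  assumes "m \<ge> 1"
  shows "nsphere (2 * m - 1) = top_of_set (sphere_set m)"
proof -
  have "{..2 * m - 1} = {..<2 * m}" "\<And>j. j > 2 * m - 1 \<longleftrightarrow> j \<ge> 2 * m" using assms by auto
  then show ?thesis unfolding nsphere by (simp add: euclidean_product_topology)
qed

lemma norm_to_complex: "x \<in> sphere_set m \<Longrightarrow> norm_tuple m (to_complex x) = 1"
  by (simp add: norm_tuple_def to_complex_def sum_pairs cmod_power2)

lemma to_sphere_to_complex:
  assumes "x \<in> sphere_set m"
  shows "to_sphere m (to_complex x) = x"
proof
  fix j show "to_sphere m (to_complex x) j = x j"
    using assms norm_to_complex[OF assms] by (auto simp: to_sphere_def to_complex_def)
qed

lemma norm_tuple_pos:
  assumes "\<xi> \<in> nonvanishing m" shows "norm_tuple m \<xi> > 0"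
proof -
  obtain i where "i < m" "\<xi> i \<noteq> 0" using assms by (auto simp: nonvanishing_def)
  then have "(\<Sum>i<m. (cmod (\<xi> i))\<^sup>2) > 0" by (intro sum_pos2[of _ i]) auto
  then show ?thesis by (simp add: norm_tuple_def)
qed

lemma to_sphere_in:
  assumes "\<xi> \<in> nonvanishing m" shows "to_sphere m \<xi> \<in> sphere_set m"
proof -
  define N where "N = norm_tuple m \<xi>"
  have N: "N > 0" using norm_tuple_pos[OF assms] by (simp add: N_def)
  have "(\<Sum>j<2 * m. (to_sphere m \<xi> j)\<^sup>2) = (\<Sum>i<m. (cmod (\<xi> i))\<^sup>2 / N\<^sup>2)"
    unfolding sum_pairs
    by (intro sum.cong) (auto simp: to_sphere_def N_def[symmetric] power_divide cmod_power2 add_divide_distrib)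
  also have "\<dots> = (\<Sum>i<m. (cmod (\<xi> i))\<^sup>2) / N\<^sup>2" by (simp add: sum_divide_distrib)
  also have "(\<Sum>i<m. (cmod (\<xi> i))\<^sup>2) = N\<^sup>2" by (simp add: N_def norm_tuple_def sum_nonneg)
  finally show ?thesis using N by (simp add: to_sphere_def)
qed

lemma continuous_on_coord_id: "continuous_on S (\<lambda>\<xi>::nat \<Rightarrow> 'b::topological_space. \<xi> k)"
  by (rule continuous_on_product_then_coordinatewise[OF continuous_on_id])

lemma continuous_on_to_sphere: "continuous_on (nonvanishing m) (to_sphere m)"
proof (rule continuous_on_coordinatewise_then_product)
  fix j
  have N: "continuous_on (nonvanishing m) (norm_tuple m)"
    unfolding norm_tuple_def
    by (intro continuous_on_real_sqrt continuous_on_sum continuous_on_power continuous_on_norm continuous_on_coord_id)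
  have nz: "\<forall>\<xi>\<in>nonvanishing m. norm_tuple m \<xi> \<noteq> 0" using norm_tuple_pos by force
  show "continuous_on (nonvanishing m) (\<lambda>\<xi>. to_sphere m \<xi> j)"
  proof (cases "j < 2 * m"; cases "even j")
    assume "j < 2 * m" "even j"
    then show ?thesis unfolding to_sphere_def
      by (simp add: continuous_on_divide continuous_on_Re continuous_on_coord_id N nz)
  next
    assume "j < 2 * m" "odd j"
    then show ?thesis unfolding to_sphere_def
      by (simp add: continuous_on_divide continuous_on_Im continuous_on_coord_id N nz)
  qed (simp_all add: to_sphere_def)
qed

text \<open>Composing with the radial retraction turns the hypothesis into a contraction of the
  sphere of dimension \<open>2 * m - 1\<close>.\<close>

lemma inclusion_essential:
  assumes m: "m \<ge> 1"
    and hom: "homotopic_with_canon (\<lambda>_. True) (sphere_set m) (nonvanishing m) (tuple m (\<lambda>i x. to_complex x i)) (\<lambda>_. c)"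
  shows False
proof -
  have hom': "homotopic_with_canon (\<lambda>_. True) (sphere_set m) (sphere_set m)
      (to_sphere m \<circ> tuple m (\<lambda>i x. to_complex x i)) (to_sphere m \<circ> (\<lambda>_. c))"
    by (rule homotopic_with_compose_continuous_left[OF hom continuous_on_to_sphere]) (use to_sphere_in in blast)
  have eq: "(to_sphere m \<circ> tuple m (\<lambda>i x. to_complex x i)) x = id x" if "x \<in> sphere_set m" for x
  proof -
    have "to_sphere m (tuple m (\<lambda>i x. to_complex x i) x) = to_sphere m (to_complex x)"
      by (auto simp: to_sphere_def tuple_def norm_tuple_def fun_eq_iff)
    then show ?thesis using to_sphere_to_complex[OF that] by simp
  qed
  have "homotopic_with_canon (\<lambda>_. True) (sphere_set m) (sphere_set m) id (\<lambda>_. to_sphere m c)"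
  proof (rule homotopic_with_eq[OF hom'])
    show "id x = (to_sphere m \<circ> tuple m (\<lambda>i x. to_complex x i)) x"
      if "x \<in> topspace (top_of_set (sphere_set m))" for x
      using that unfolding topspace_euclidean_subtopology by (rule eq[symmetric])
  qed simp_all
  then have "contractible_space (nsphere (2 * m - 1))"
    unfolding contractible_space_def nsphere_eq[OF m] by blast
  then show False using non_contractible_space_nsphere by blast
qed

lemma continuous_on_cell:
  fixes f :: "'a::topological_space \<Rightarrow> nat \<Rightarrow> complex"
  assumes "\<And>k. continuous_on S (\<lambda>x. f x k)"
  shows "continuous_on S (\<lambda>x. cell n (f x))"
  unfolding cell_def
proof (intro continuous_on_Pair continuous_on_coordinatewise_then_product)
  have m: "continuous_on S (\<lambda>x. maxmod n (f x))" "continuous_on S (\<lambda>x. maxmod (n - 1) (\<lambda>k. f x (n + k)))"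
    by (intro continuous_on_maxmod assms)+
  fix k
  show "continuous_on S (\<lambda>x. if k < n then f x k else if k = n then of_real (1 - maxmod n (f x)) else 0)"
    by (cases "k < n"; cases "k = n") (auto simp del: of_real_diff intro!: continuous_on_of_real continuous_on_diff continuous_on_const m assms)
  show "continuous_on S (\<lambda>x. if k < n - 1 then f x (n + k)
      else if k = n - 1 then of_real (1 - maxmod (n - 1) (\<lambda>k. f x (n + k))) else 0)"
    by (cases "k < n - 1"; cases "k = n - 1")
       (auto simp del: of_real_diff One_nat_def intro!: continuous_on_of_real continuous_on_diff continuous_on_const m assms)
qed

text \<open>Radial projection from the round sphere to the boundary of the polydisc.\<close>

definition to_boundary :: "nat \<Rightarrow> (nat \<Rightarrow> real) \<Rightarrow> nat \<Rightarrow> complex" where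
  "to_boundary m x k = to_complex x k / of_real (maxmod m (to_complex x))"

lemma to_complex_nonvanishing:
  assumes "x \<in> sphere_set m" shows "to_complex x \<in> nonvanishing m"
proof (rule ccontr)
  assume "\<not> ?thesis"
  then have "norm_tuple m (to_complex x) = 0" by (simp add: nonvanishing_def norm_tuple_def)
  then show False using norm_to_complex[OF assms] by simp
qed

lemma maxmod_to_complex_pos:
  assumes "x \<in> sphere_set m" shows "maxmod m (to_complex x) > 0"
proof -
  obtain i where "i < m" "to_complex x i \<noteq> 0"
    using to_complex_nonvanishing[OF assms] by (auto simp: nonvanishing_def)
  then show ?thesis using maxmod_ge[of i m "to_complex x"] by (metis less_le_trans zero_less_norm_iff)
qed

lemma maxmod_to_boundary:
  assumes "x \<in> sphere_set m" shows "maxmod m (to_boundary m x) = 1"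
proof -
  have "maxmod m (to_boundary m x) = maxmod m (\<lambda>k. of_real (1 / maxmod m (to_complex x)) * to_complex x k)"
    by (intro maxmod_cong) (simp add: to_boundary_def)
  also have "\<dots> = \<bar>1 / maxmod m (to_complex x)\<bar> * maxmod m (to_complex x)"
    unfolding maxmod_scale norm_of_real ..
  finally show ?thesis using maxmod_to_complex_pos[OF assms] by simp
qed

lemma continuous_on_to_complex: "continuous_on S (\<lambda>x. to_complex x k)"
proof -
  have eq: "to_complex x k = of_real (x (2 * k)) + \<i> * of_real (x (2 * k + 1))" for x
    by (simp add: to_complex_def complex_eq_iff)
  show ?thesis unfolding eq
    by (intro continuous_on_add continuous_on_mult continuous_on_const continuous_on_of_real continuous_on_coord_id)
qed

lemma continuous_on_to_boundary: "continuous_on (sphere_set m) (\<lambda>x. to_boundary m x k)"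
  unfolding to_boundary_def
proof (rule continuous_on_divide)
  show "\<forall>x\<in>sphere_set m. complex_of_real (maxmod m (to_complex x)) \<noteq> 0"
    using maxmod_to_complex_pos by force
qed (intro continuous_on_to_complex continuous_on_of_real continuous_on_maxmod)+

text \<open>On the first \<open>n\<close> coordinates the section is a positive multiple of the
  inclusion. Where these vanish, \<open>z = 0\<close> and \<open>r = 1\<close>, so
  \<open>perp\<close> reproduces \<open>u\<close> and the remaining coordinates are positive
  multiples as well. Hence the straight segment misses 0.\<close>

lemma std_section_cell_homotopic:
  assumes n: "n \<ge> 1" and m: "m = 2 * n - 1"
  shows "homotopic_with_canon (\<lambda>_. True) (sphere_set m) (nonvanishing m)
    (tuple m (\<lambda>i x. to_complex x i)) (tuple m (\<lambda>i x. std_section n i (cell n (to_boundary m x))))"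
proof (rule homotopic_segment)
  show "continuous_on (sphere_set m) (\<lambda>x. to_complex x i)" for i by (rule continuous_on_to_complex)
  show "continuous_on (sphere_set m) (\<lambda>x. std_section n i (cell n (to_boundary m x)))" for i
    by (rule continuous_on_compose2[OF continuous_on_std_section[of UNIV] continuous_on_cell[OF continuous_on_to_boundary]]) auto
  fix t x assume t: "0 \<le> (t::real)" "t \<le> 1" and x: "x \<in> sphere_set m"
  define M where "M = maxmod m (to_complex x)"
  have M: "M > 0" using maxmod_to_complex_pos[OF x] by (simp add: M_def)
  define \<xi> where "\<xi> = to_boundary m x"
  have xi: "\<xi> k = to_complex x k / of_real M" for k by (simp add: \<xi>_def to_boundary_def M_def)
  \<comment> \<open>The positive factor by which the point of the segment multiplies a coordinate of
    \<open>to_complex x\<close>.\<close>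
  define c where "c = 1 - t + t / M"
  have c: "c \<noteq> 0"
  proof (cases "t = 1")
    case False
    then have "1 - t > 0" "t / M \<ge> 0" using t M by auto
    then show ?thesis by (simp add: c_def)
  qed (use M in \<open>simp add: c_def\<close>)
  have comb: "of_real (1 - t) * to_complex x k + of_real t * \<xi> k = of_real c * to_complex x k" for k
    by (simp add: xi c_def algebra_simps)
  show "\<exists>i<m. of_real (1 - t) * to_complex x i + of_real t * std_section n i (cell n (to_boundary m x)) \<noteq> 0"
  proof (rule ccontr)
    assume "\<not> ?thesis"
    then have z: "of_real (1 - t) * to_complex x i + of_real t * std_section n i (cell n \<xi>) = 0" if "i < m" for i
      using that by (auto simp: \<xi>_def)
    have 0: "to_complex x i = 0" if "i < n" for i
    proof -
      have "std_section n i (cell n \<xi>) = \<xi> i" using that by (simp add: std_section_def pvec_def cell_def)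
      then have "of_real c * to_complex x i = 0" using z[of i] comb[of i] that m by simp
      then show ?thesis using c by simp
    qed
    then have xi0: "\<xi> i = 0" if "i < n" for i using that by (simp add: xi)
    then have "maxmod n \<xi> = 0" using maxmod_le[of 0 n \<xi>] maxmod_nonneg[of n \<xi>] by auto
    then have vn: "fst (cell n \<xi>) n = 1" by (simp add: cell_def)
    have v0: "fst (cell n \<xi>) k = 0" if "k < n" for k using that xi0 by (simp add: cell_def)
    then have h: "herm n u (fst (cell n \<xi>)) = 0" for u by (simp add: herm_def)
    have "to_complex x i = 0" if "i < m" for i
    proof (cases "i < n")
      case False
      define k where "k = i - n"
      have k: "k < n - 1" "k < n" "i = n + k" using False that m by (auto simp: k_def)
      have "std_section n i (cell n \<xi>) = snd (cell n \<xi>) k"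
        using k by (simp add: std_section_def pvec_def perp_def Let_def h vn)
      also have "\<dots> = \<xi> i" using k by (simp add: cell_def)
      finally have "of_real c * to_complex x i = 0" using z[OF that] comb[of i] by simp
      then show ?thesis using c by simp
    qed (rule 0)
    then show False using to_complex_nonvanishing[OF x] by (auto simp: nonvanishing_def)
  qed
qed

lemma choice_less: "\<forall>i<m. \<exists>f. P i f \<Longrightarrow> \<exists>f. \<forall>i<m. P i (f i)"
  for m :: nat
  by metis

lemma framed_subset: "framed n A \<Longrightarrow> B \<subseteq> A \<Longrightarrow> framed n B"
  unfolding framed_def by (meson subset_iff)

lemma bdd_lip_continuous_on:
  assumes "bdd_lip (pgauge n) S f" shows "continuous_on S f"
proof -
  obtain C where C: "\<And>x y. \<lbrakk>x \<in> S; y \<in> S\<rbrakk> \<Longrightarrow> cmod (f x - f y) \<le> C * pgauge n x y"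
    using assms unfolding bdd_lip_def by blast
  show ?thesis unfolding continuous_on_def
  proof
    fix x assume x: "x \<in> S"
    have "continuous_on S (\<lambda>y. C * pgauge n y x)" unfolding pgauge_def
      by (intro continuous_on_mult continuous_on_add continuous_on_sum continuous_on_norm
          continuous_on_diff continuous_on_const continuous_on_params_coord)
    then have "((\<lambda>y. C * pgauge n y x) \<longlongrightarrow> C * pgauge n x x) (at x within S)"
      using x unfolding continuous_on_def by blast
    then have lim: "((\<lambda>y. C * pgauge n y x) \<longlongrightarrow> 0) (at x within S)" by (simp add: pgauge_def)
    have "\<forall>\<^sub>F y in at x within S. norm (f y - f x) \<le> C * pgauge n y x"
      using C x by (auto simp: eventually_at_filter)
    from Lim_null_comparison[OF this lim] show "(f \<longlongrightarrow> f x) (at x within S)" by (simp add: LIM_zero_iff)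
  qed
qed

text \<open>Perturbation is needed only for bounded \<open>t\<close>: beyond \<open>T\<close> the
  reference section, bounded below on the pieces, outweighs \<open>s'\<close>. Approximation and
  perturbation each use half of \<open>\<epsilon>\<close>.\<close>

lemma generic_section:
  fixes s :: "nat \<Rightarrow> params \<Rightarrow> complex"
  assumes n: "n \<ge> 1" and m: "m = 2 * n - 1"
    and cont: "\<And>i. i < m \<Longrightarrow> continuous_on (param_set n) (s i)"
    and eqv: "\<And>i. i < m \<Longrightarrow> equivariant n i (s i)"
    and "\<epsilon> > 0"
  obtains s' where
    "\<And>i. i < m \<Longrightarrow> param_lip n (s' i) \<and> equivariant n i (s' i)"
    "\<And>i x. \<lbrakk>i < m; x \<in> param_set n\<rbrakk> \<Longrightarrow> cmod (s' i x - s i x) \<le> \<epsilon>"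
    "\<And>S x t. \<lbrakk>S \<in> pieces n; x \<in> S; 0 \<le> t\<rbrakk> \<Longrightarrow> \<exists>i<m. s' i x + of_real t * std_section n i x \<noteq> 0"
proof -
  have \<epsilon>2: "\<epsilon> / 2 > 0" using \<open>\<epsilon> > 0\<close> by simp
  have "\<forall>i<m. \<exists>f. param_lip n f \<and> equivariant n i f \<and> (\<forall>x\<in>param_set n. cmod (f x - s i x) \<le> \<epsilon> / 2)"
  proof (intro allI impI)
    fix i assume i: "i < m"
    show "\<exists>f. param_lip n f \<and> equivariant n i f \<and> (\<forall>x\<in>param_set n. cmod (f x - s i x) \<le> \<epsilon> / 2)"
      by (rule equivariant_approximation[OF n cont[OF i] eqv[OF i] \<epsilon>2]) blast
  qed
  from choice_less[OF this] obtain s1 where s1': "\<forall>i<m. param_lip n (s1 i) \<and> equivariant n i (s1 i) \<and>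
      (\<forall>x\<in>param_set n. cmod (s1 i x - s i x) \<le> \<epsilon> / 2)" by (elim exE)
  have s1: "param_lip n (s1 i) \<and> equivariant n i (s1 i)" if "i < m" for i using s1' that by blast
  have near1: "cmod (s1 i x - s i x) \<le> \<epsilon> / 2" if "i < m" "x \<in> param_set n" for i x using s1' that by blast
  have "\<forall>i<m. \<exists>M. M > 0 \<and> (\<forall>x\<in>param_set n. cmod (s i x) \<le> M)"
  proof (intro allI impI)
    fix i assume i: "i < m"
    show "\<exists>M. M > 0 \<and> (\<forall>x\<in>param_set n. cmod (s i x) \<le> M)"
      by (rule compact_bounded_above[OF compact_param_set cont[OF i]]) blast
  qed
  from choice_less[OF this] obtain M where M': "\<forall>i<m. M i > 0 \<and> (\<forall>x\<in>param_set n. cmod (s i x) \<le> M i)"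
    by (elim exE)
  have M: "M i > 0" "x \<in> param_set n \<Longrightarrow> cmod (s i x) \<le> M i" if "i < m" for i x using M' that by blast+
  define B where "B = (\<Sum>i<m. M i)"
  have B: "cmod (s i x) \<le> B" if "i < m" "x \<in> param_set n" for i x
  proof -
    have "M i \<le> B" unfolding B_def using that M(1) by (intro member_le_sum) (auto intro: less_imp_le)
    then show ?thesis using M(2)[OF that] by linarith
  qed
  have B0: "B \<ge> 0" unfolding B_def using M(1) by (intro sum_nonneg) (auto intro: less_imp_le)
  have cp: "compact (\<Union>(pieces n))" using finite_pieces compact_piece by (intro compact_Union) auto
  obtain \<beta> where \<beta>: "\<beta> > 0" "\<And>x. x \<in> \<Union>(pieces n) \<Longrightarrow> \<exists>i<m. \<beta> \<le> cmod (std_section n i x)"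
  proof (rule sections_bounded_below[OF cp, of m "std_section n"])
    show "\<exists>i<m. std_section n i x \<noteq> 0" if "x \<in> \<Union>(pieces n)" for x
      using that std_section_piece_nonzero[OF n] m by blast
  qed (rule continuous_on_std_section, blast)
  define T where "T = (B + \<epsilon>) / \<beta>"
  obtain \<A> where \<A>: "finite \<A>" "\<And>A. A \<in> \<A> \<Longrightarrow> framed n A" "param_set n \<subseteq> \<Union>\<A>"
    using framed_cover by blast
  \<comment> \<open>Sets to be avoided must be both thin and framed, so each piece is cut by the
    framed sets that cover \<open>param_set n\<close>.\<close>
  define \<S> where "\<S> = (\<lambda>(S, A). S \<inter> A) ` (pieces n \<times> \<A>)"
  have "finite \<S>" unfolding \<S>_def using finite_pieces \<A>(1) by simp
  moreover have "thin n S \<and> framed n S" if S: "S \<in> \<S>" for S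
  proof -
    obtain S' A where "S' \<in> pieces n" "A \<in> \<A>" "S = S' \<inter> A" using S unfolding \<S>_def by blast
    then show ?thesis using thin_subset[OF thin_pieces, of S'] framed_subset[OF \<A>(2), of A] by blast
  qed
  ultimately have "\<exists>s' \<delta>. \<delta> > 0 \<and> (\<forall>i<2 * n - 1. param_lip n (s' i) \<and> equivariant n i (s' i) \<and>
       (\<forall>x\<in>param_set n. cmod (s' i x - s1 i x) \<le> \<epsilon> / 2)) \<and>
     (\<forall>S\<in>\<S>. \<forall>x\<in>S. \<forall>t\<in>{0..T}. \<exists>i<2 * n - 1. \<delta> \<le> cmod (s' i x + of_real t * std_section n i x))"
    using s1 \<open>\<epsilon> > 0\<close> unfolding m by (intro avoid_finite[OF n _ _ _ bdd_lip_std_section]) auto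
  then obtain s' \<delta> where \<delta>: "\<delta> > 0"
    and a: "\<forall>i<m. param_lip n (s' i) \<and> equivariant n i (s' i) \<and>
       (\<forall>x\<in>param_set n. cmod (s' i x - s1 i x) \<le> \<epsilon> / 2)"
    and b: "\<forall>S\<in>\<S>. \<forall>x\<in>S. \<forall>t\<in>{0..T}. \<exists>i<m. \<delta> \<le> cmod (s' i x + of_real t * std_section n i x)"
    unfolding m by (elim exE conjE)
  have near: "cmod (s' i x - s i x) \<le> \<epsilon>" if "i < m" "x \<in> param_set n" for i x
  proof -
    have "cmod (s' i x - s1 i x) \<le> \<epsilon> / 2" using a that by blast
    then show ?thesis using near1[OF that] norm_triangle_ineq[of "s' i x - s1 i x" "s1 i x - s i x"] by simp
  qed
  have nz: "\<exists>i<m. s' i x + of_real t * std_section n i x \<noteq> 0" if S: "S \<in> pieces n" "x \<in> S" and t: "0 \<le> t" for S x t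
  proof (cases "t \<le> T")
    case True
    have "x \<in> param_set n" using thin_pieces[OF S(1)] S(2) by (auto simp: thin_def)
    then obtain A where "A \<in> \<A>" "x \<in> A" using \<A>(3) by blast
    then have "S \<inter> A \<in> \<S>" "x \<in> S \<inter> A" using S by (auto simp: \<S>_def)
    moreover have "t \<in> {0..T}" using True t by simp
    ultimately obtain i where "i < m" "\<delta> \<le> cmod (s' i x + of_real t * std_section n i x)" using b by meson
    then show ?thesis using \<delta> by (intro exI[of _ i]) auto
  next
    case False
    have x: "x \<in> param_set n" using thin_pieces[OF S(1)] S(2) by (auto simp: thin_def)
    have "x \<in> \<Union>(pieces n)" using S by blast
    then obtain i where i: "i < m" "\<beta> \<le> cmod (std_section n i x)" using \<beta>(2) by meson
    have "B + \<epsilon> = T * \<beta>" using \<beta> by (simp add: T_def)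
    also have "\<dots> < t * \<beta>" using False \<beta> by simp
    also have "\<dots> \<le> t * cmod (std_section n i x)" using i t by (intro mult_left_mono) auto
    also have "\<dots> = cmod (of_real t * std_section n i x)" using t by (simp add: norm_mult)
    finally have "B + \<epsilon> < cmod (of_real t * std_section n i x)" .
    moreover have "cmod (s' i x) \<le> B + \<epsilon>"
      using near[OF i(1) x] B[OF i(1) x] norm_triangle_ineq2[of "s' i x" "s i x"] by linarith
    ultimately have "s' i x + of_real t * std_section n i x \<noteq> 0"
      by (metis add_eq_0_iff norm_minus_cancel not_le)
    then show ?thesis using i by blast
  qed
  have "param_lip n (s' i) \<and> equivariant n i (s' i)" if "i < m" for i using a that by blast
  then show ?thesis by (rule that[of s']) (use near nz in blast)+
qed

theorem no_equivariant_sections: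
  fixes s :: "nat \<Rightarrow> params \<Rightarrow> complex"
  assumes n: "n \<ge> 1"
    and cont: "\<And>i. i < 2 * n - 1 \<Longrightarrow> continuous_on (param_set n) (s i)"
    and eqv: "\<And>i. i < 2 * n - 1 \<Longrightarrow> equivariant n i (s i)"
    and nz: "\<And>x. x \<in> param_set n \<Longrightarrow> \<exists>i<2 * n - 1. s i x \<noteq> 0"
  shows False
proof -
  define m where "m = 2 * n - 1"
  have m1: "m \<ge> 1" using n by (simp add: m_def)
  obtain \<beta> where \<beta>: "\<beta> > 0" "\<And>x. x \<in> param_set n \<Longrightarrow> \<exists>i<m. \<beta> \<le> cmod (s i x)"
    by (rule sections_bounded_below[OF compact_param_set cont nz, folded m_def]) blast+
  have \<beta>2: "\<beta> / 2 > 0" using \<beta> by simp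
  obtain s' where s': "\<And>i. i < m \<Longrightarrow> param_lip n (s' i) \<and> equivariant n i (s' i)"
    and near: "\<And>i x. \<lbrakk>i < m; x \<in> param_set n\<rbrakk> \<Longrightarrow> cmod (s' i x - s i x) \<le> \<beta> / 2"
    and av: "\<And>S x t. \<lbrakk>S \<in> pieces n; x \<in> S; 0 \<le> t\<rbrakk> \<Longrightarrow> \<exists>i<m. s' i x + of_real t * std_section n i x \<noteq> 0"
    by (rule generic_section[OF n m_def cont[folded m_def] eqv[folded m_def] \<beta>2]) blast+
  have bdry: "\<exists>S\<in>pieces n. \<exists>y\<in>S. \<exists>a b. y \<in> param_set n \<and> a \<noteq> 0 \<and> b \<noteq> 0 \<and>
      scaled n a (fst y) (fst (cell n \<xi>)) \<and> scaled n b (perp n y) (perp n (cell n \<xi>))"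
    if "maxmod m \<xi> = 1" for \<xi>
    by (rule cell_boundary[OF n that[unfolded m_def]]) blast+
  have transfer: "f (cell n \<xi>) = c * f y"
    if "equivariant n i f" "y \<in> param_set n" "cell n \<xi> \<in> param_set n" "c = (if i < n then a else b)"
      "scaled n a (fst y) (fst (cell n \<xi>))" "scaled n b (perp n y) (perp n (cell n \<xi>))" for f \<xi> y a b c i
    using that unfolding equivariant_def by blast
  let ?p = "to_boundary m" and ?S = "sphere_set m"
  have cp: "cell n (?p x) \<in> param_set n" if "x \<in> ?S" for x
    using maxmod_to_boundary[OF that] cell_in_param_set[OF n, of "?p x"] unfolding m_def by simp
  have ccell: "continuous_on ?S (\<lambda>x. cell n (?p x))" by (rule continuous_on_cell[OF continuous_on_to_boundary])
  have cs': "continuous_on (param_set n) (s' i)" if "i < m" for i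
    using s'[OF that] bdd_lip_continuous_on by blast
  \<comment> \<open>Each boundary point has the same lines as a point \<open>y\<close> of a piece.
    Between the two, the \<open>i\<close>-th components of both sections scale by the same nonzero
    factor, so it is enough to exclude zeros on the pieces.\<close>
  have bnz: "\<exists>i<m. of_real (1 - t) * std_section n i (cell n (?p x)) + of_real t * s' i (cell n (?p x)) \<noteq> 0"
    if t: "0 \<le> t" "t \<le> 1" and x: "x \<in> ?S" for t x
  proof -
    obtain S y a b where S: "S \<in> pieces n" "y \<in> S" and y: "y \<in> param_set n" and ab: "a \<noteq> 0" "b \<noteq> 0"
      and sc: "scaled n a (fst y) (fst (cell n (?p x)))" "scaled n b (perp n y) (perp n (cell n (?p x)))"
      using bdry[OF maxmod_to_boundary[OF x]] by blast
    have "\<exists>i<m. of_real (1 - t) * std_section n i y + of_real t * s' i y \<noteq> 0"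
    proof (cases "t = 0")
      case True
      then show ?thesis using std_section_piece_nonzero[OF n S] by (simp add: m_def)
    next
      case False
      \<comment> \<open>Dividing by \<open>t\<close> turns the segment into the ray treated in
        \<open>av\<close>.\<close>
      then have "0 \<le> (1 - t) / t" using t by simp
      from av[OF S this] obtain i where i: "i < m" "s' i y + of_real ((1 - t) / t) * std_section n i y \<noteq> 0" by blast
      have "of_real (1 - t) * std_section n i y + of_real t * s' i y
          = of_real t * (s' i y + of_real ((1 - t) / t) * std_section n i y)"
        using False by (simp add: field_simps)
      then show ?thesis using i False by (intro exI[of _ i]) simp
    qed
    then obtain i where i: "i < m" "of_real (1 - t) * std_section n i y + of_real t * s' i y \<noteq> 0" by blast
    define c where "c = (if i < n then a else b)"
    have "std_section n i (cell n (?p x)) = c * std_section n i y"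
      by (rule transfer[OF equivariant_std_section[OF i(1)[unfolded m_def]] y cp[OF x] c_def sc])
    moreover have "s' i (cell n (?p x)) = c * s' i y"
      by (rule transfer[OF conjunct2[OF s'[OF i(1)]] y cp[OF x] c_def sc])
    ultimately have "of_real (1 - t) * std_section n i (cell n (?p x)) + of_real t * s' i (cell n (?p x))
        = c * (of_real (1 - t) * std_section n i y + of_real t * s' i y)"
      by (simp add: algebra_simps)
    moreover have "c \<noteq> 0" using ab by (simp add: c_def)
    ultimately show ?thesis using i by (intro exI[of _ i]) simp
  qed
  have h1: "homotopic_with_canon (\<lambda>_. True) ?S (nonvanishing m)
      (tuple m (\<lambda>i x. to_complex x i)) (tuple m (\<lambda>i x. std_section n i (cell n (?p x))))"
    by (rule std_section_cell_homotopic[OF n m_def])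
  have h2: "homotopic_with_canon (\<lambda>_. True) ?S (nonvanishing m)
      (tuple m (\<lambda>i x. std_section n i (cell n (?p x)))) (tuple m (\<lambda>i x. s' i (cell n (?p x))))"
  proof (rule homotopic_segment)
    show "continuous_on ?S (\<lambda>x. std_section n i (cell n (?p x)))" for i
      by (rule continuous_on_compose2[OF continuous_on_std_section[of UNIV] ccell]) auto
    show "continuous_on ?S (\<lambda>x. s' i (cell n (?p x)))" if "i < m" for i
      by (rule continuous_on_compose2[OF cs'[OF that] ccell]) (use cp in auto)
  qed (rule bnz)
  \<comment> \<open>\<open>s'\<close> differs from \<open>s\<close> by at most
    \<open>\<beta> / 2\<close>, while at every point some component of \<open>s\<close> has modulus
    at least \<open>\<beta>\<close>.\<close>
  have h3: "homotopic_with_canon (\<lambda>_. True) ?S (nonvanishing m)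
      (tuple m (\<lambda>i x. s' i (cell n (?p x)))) (tuple m (\<lambda>i x. s i (cell n (?p x))))"
  proof (rule homotopic_segment)
    show "continuous_on ?S (\<lambda>x. s' i (cell n (?p x)))" if "i < m" for i
      by (rule continuous_on_compose2[OF cs'[OF that] ccell]) (use cp in auto)
    show "continuous_on ?S (\<lambda>x. s i (cell n (?p x)))" if "i < m" for i
      by (rule continuous_on_compose2[OF cont[folded m_def, OF that] ccell]) (use cp in auto)
    fix t x assume t: "0 \<le> (t::real)" "t \<le> 1" and x: "x \<in> ?S"
    let ?y = "cell n (?p x)"
    obtain i where i: "i < m" "\<beta> \<le> cmod (s i ?y)" using \<beta>(2)[OF cp[OF x]] by blast
    have "cmod (of_real (1 - t) * (s' i ?y - s i ?y)) \<le> 1 * (\<beta> / 2)"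
      unfolding norm_mult norm_of_real using near[OF i(1) cp[OF x]] t by (intro mult_mono) auto
    moreover have "of_real (1 - t) * s' i ?y + of_real t * s i ?y = s i ?y + of_real (1 - t) * (s' i ?y - s i ?y)"
      by (simp add: algebra_simps)
    ultimately have "of_real (1 - t) * s' i ?y + of_real t * s i ?y \<noteq> 0"
      using i(2) \<beta>(1) by (smt (verit) add_eq_0_iff field_sum_of_halves norm_minus_cancel)
    then show "\<exists>i<m. of_real (1 - t) * s' i ?y + of_real t * s i ?y \<noteq> 0" using i by blast
  qed
  \<comment> \<open>As \<open>s\<close> has no zero on the whole cell, its boundary values contract
    through the cell to the value at the centre.\<close>
  have h4: "homotopic_with_canon (\<lambda>_. True) ?S (nonvanishing m)
      (tuple m (\<lambda>i x. s i (cell n (?p x)))) (tuple m (\<lambda>i x. s i (cell n (\<lambda>_. 0))))"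
  proof -
    define q where "q p k = of_real (1 - fst p) * ?p (snd p) k" for p :: "real \<times> (nat \<Rightarrow> real)" and k
    have qp: "cell n (q (t, x)) \<in> param_set n" if "0 \<le> t" "t \<le> 1" "x \<in> ?S" for t x
    proof (rule cell_in_param_set[OF n])
      have "maxmod m (q (t, x)) = \<bar>1 - t\<bar> * maxmod m (?p x)"
        using maxmod_scale[of m "of_real (1 - t)" "?p x"] unfolding norm_of_real q_def by simp
      then show "maxmod (2 * n - 1) (q (t, x)) \<le> 1" using maxmod_to_boundary[OF that(3)] that unfolding m_def by simp
    qed
    have qc: "continuous_on ({0..1} \<times> ?S) (\<lambda>p. q p k)" for k
      unfolding q_def
      by (intro continuous_on_mult continuous_on_of_real continuous_on_diff continuous_on_const continuous_on_fst
          continuous_on_id continuous_on_compose2[OF continuous_on_to_boundary continuous_on_snd[OF continuous_on_id]]) auto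
    have "homotopic_with_canon (\<lambda>_. True) ?S (nonvanishing m)
      (tuple m (\<lambda>i x. s i (cell n (q (0, x))))) (tuple m (\<lambda>i x. s i (cell n (q (1, x)))))"
    proof (rule homotopic_tuple[where h = "\<lambda>i p. s i (cell n (q p))"])
      show "continuous_on ({0..1} \<times> ?S) (\<lambda>p. s i (cell n (q p)))" if "i < m" for i
        by (rule continuous_on_compose2[OF cont[folded m_def, OF that] continuous_on_cell[OF qc]]) (use qp in auto)
      show "\<exists>i<m. s i (cell n (q (t, x))) \<noteq> 0" if "0 \<le> t" "t \<le> 1" "x \<in> ?S" for t x
        using nz[OF qp[OF that]] by (simp add: m_def)
    qed
    moreover have "q (0, x) = ?p x" "q (1, x) = (\<lambda>_. 0)" for x by (simp_all add: q_def fun_eq_iff)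
    ultimately show ?thesis by simp
  qed
  have "homotopic_with_canon (\<lambda>_. True) ?S (nonvanishing m)
      (tuple m (\<lambda>i x. to_complex x i)) (tuple m (\<lambda>i x. s i (cell n (\<lambda>_. 0))))"
    using homotopic_with_trans[OF homotopic_with_trans[OF h1 h2] homotopic_with_trans[OF h3 h4]] .
  moreover have "tuple m (\<lambda>i x. s i (cell n (\<lambda>_. 0))) = (\<lambda>_::nat \<Rightarrow> real. \<lambda>i. if i < m then s i (cell n (\<lambda>_. 0)) else 0)"
    by (simp add: tuple_def fun_eq_iff)
  ultimately show False using inclusion_essential[OF m1] by simp
qed

section \<open>Sections from a categorical cover\<close>

definition line_rep :: "nat \<Rightarrow> (nat \<Rightarrow> nat \<Rightarrow> complex) \<Rightarrow> (nat \<Rightarrow> complex) \<Rightarrow> bool" where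
  "line_rep n M y \<longleftrightarrow> nonzero n y \<and> (\<forall>k\<le>n. \<forall>l\<le>n. M k l = proj_entry n k l y)"

text \<open>The trace of the product of two projections; it is zero exactly when the lines are
  orthogonal.\<close>

definition overlap :: "nat \<Rightarrow> (nat \<Rightarrow> nat \<Rightarrow> complex) \<Rightarrow> (nat \<Rightarrow> nat \<Rightarrow> complex) \<Rightarrow> complex" where
  "overlap n A B = (\<Sum>k\<le>n. \<Sum>l\<le>n. A k l * B l k)"

text \<open>Projects \<open>y\<close> onto one line after another. Linearity in \<open>y\<close> is
  what makes the resulting sections equivariant.\<close>

primrec transport :: "nat \<Rightarrow> (nat \<Rightarrow> nat \<Rightarrow> nat \<Rightarrow> complex) \<Rightarrow> nat \<Rightarrow> (nat \<Rightarrow> complex) \<Rightarrow> nat \<Rightarrow> complex" where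
  "transport n M 0 y = y"
| "transport n M (Suc j) y = (\<lambda>k. \<Sum>l\<le>n. M (Suc j) k l * transport n M j y l)"

lemma overlap_line_rep:
  assumes "line_rep n A y" "line_rep n B z"
  shows "overlap n A B = (\<Sum>l\<le>n. cnj (z l) * y l) * (\<Sum>l\<le>n. cnj (y l) * z l) / (sqnorm n y * sqnorm n z)"
proof -
  have "overlap n A B = (\<Sum>k\<le>n. \<Sum>l\<le>n. (cnj (z k) * y k) * (cnj (y l) * z l) / (sqnorm n y * sqnorm n z))"
    using assms unfolding overlap_def line_rep_def
    by (intro sum.cong refl) (simp add: proj_entry_def mult_ac)
  then show ?thesis by (simp add: sum_product sum_divide_distrib)
qed

lemma overlap_self:
  assumes "line_rep n A y" shows "overlap n A A = 1"
proof -
  have "sqnorm n y \<noteq> 0" using assms sqnorm_eq_0_iff unfolding line_rep_def by blast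
  then show ?thesis unfolding overlap_line_rep[OF assms assms] by (simp add: sqnorm_def mult.commute)
qed

text \<open>The projected vector is the generator \<open>z\<close> times \<open>\<alpha>\<close>,
  essentially the inner product of \<open>y\<close> with \<open>z\<close>, which is nonzero when the
  lines are not orthogonal.\<close>

lemma line_rep_project:
  assumes A: "line_rep n A y" and B: "line_rep n B z" and nz: "overlap n A B \<noteq> 0"
  shows "line_rep n B (\<lambda>k. \<Sum>l\<le>n. B k l * y l)"
proof -
  define \<alpha> where "\<alpha> = (\<Sum>l\<le>n. cnj (z l) * y l) / sqnorm n z"
  have "\<alpha> \<noteq> 0" using nz unfolding overlap_line_rep[OF A B] \<alpha>_def by auto
  have eq: "(\<Sum>l\<le>n. B k l * y l) = \<alpha> * z k" if "k \<le> n" for k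
  proof -
    have "(\<Sum>l\<le>n. B k l * y l) = (\<Sum>l\<le>n. z k / sqnorm n z * (cnj (z l) * y l))"
      using B that unfolding line_rep_def by (intro sum.cong refl) (simp add: proj_entry_def)
    also have "\<dots> = z k / sqnorm n z * (\<Sum>l\<le>n. cnj (z l) * y l)" by (rule sum_distrib_left[symmetric])
    finally show ?thesis by (simp add: \<alpha>_def)
  qed
  then have sc: "scaled n \<alpha> z (\<lambda>k. \<Sum>l\<le>n. B k l * y l)" by (simp add: scaled_def)
  have "nonzero n (\<lambda>k. \<Sum>l\<le>n. B k l * y l)"
    using B \<open>\<alpha> \<noteq> 0\<close> eq unfolding line_rep_def nonzero_def by force
  then show ?thesis
    using B proj_entry_scaled[OF sc \<open>\<alpha> \<noteq> 0\<close>] unfolding line_rep_def by simp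
qed

lemma transport_line_rep:
  assumes "line_rep n (M 0) y" and "\<And>j. j \<le> N \<Longrightarrow> \<exists>z. line_rep n (M j) z"
    and "\<And>j. j < N \<Longrightarrow> overlap n (M j) (M (Suc j)) \<noteq> 0"
  shows "line_rep n (M N) (transport n M N y)"
proof -
  have "line_rep n (M j) (transport n M j y)" if "j \<le> N" for j
    using that
  proof (induction j)
    case 0
    then show ?case using assms(1) by simp
  next
    case (Suc j)
    obtain z where "line_rep n (M (Suc j)) z" using assms(2)[OF Suc.prems] by blast
    then show ?case using line_rep_project[OF Suc.IH] assms(3)[of j] Suc.prems by simp
  qed
  then show ?thesis by simp
qed

lemma transport_scaled:
  assumes "scaled n c y y'" shows "scaled n c (transport n M j y) (transport n M j y')"
proof (induction j)
  case (Suc j)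
  then show ?case by (simp add: scaled_def sum_distrib_left mult.left_commute)
qed (use assms in simp)

lemma continuous_on_transport:
  assumes "\<And>j k l. \<lbrakk>j \<le> N; k \<le> n; l \<le> n\<rbrakk> \<Longrightarrow> continuous_on C (\<lambda>x. M x j k l)"
    and "\<And>k. k \<le> n \<Longrightarrow> continuous_on C (\<lambda>x. y x k)"
  shows "k \<le> n \<Longrightarrow> j \<le> N \<Longrightarrow> continuous_on C (\<lambda>x. transport n (M x) j (y x) k)"
proof (induction j arbitrary: k)
  case (Suc j)
  then show ?case using assms(1) by (auto intro!: continuous_on_sum continuous_on_mult)
qed (use assms in simp)

text \<open>By compactness, a homotopy of lines can be subdivided uniformly so that consecutive lines
  are never orthogonal; orthogonal projections then identify them.\<close>

lemma uniform_subdivision: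
  fixes P :: "real \<Rightarrow> 'a::t2_space \<Rightarrow> nat \<Rightarrow> nat \<Rightarrow> complex"
  assumes C: "compact C"
    and cont: "\<And>k l. \<lbrakk>k \<le> n; l \<le> n\<rbrakk> \<Longrightarrow> continuous_on ({0..1} \<times> C) (\<lambda>p. P (fst p) (snd p) k l)"
    and rep: "\<And>t x. \<lbrakk>t \<in> {0..1}; x \<in> C\<rbrakk> \<Longrightarrow> \<exists>y. line_rep n (P t x) y"
  obtains N where "N \<ge> 1" "\<And>j x. \<lbrakk>j < N; x \<in> C\<rbrakk> \<Longrightarrow>
     overlap n (P (real j / real N) x) (P (real (Suc j) / real N) x) \<noteq> 0"
proof -
  define K where "K = ({0..1::real} \<times> {0..1::real}) \<times> C"
  define f where "f q = overlap n (P (fst (fst q)) (snd q)) (P (snd (fst q)) (snd q))" for q :: "(real \<times> real) \<times> 'a"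
  have K: "compact K" unfolding K_def using C by (intro compact_Times) auto
  have c1: "continuous_on K (\<lambda>q. P (fst (fst q)) (snd q) k l)" if "k \<le> n" "l \<le> n" for k l
    by (rule continuous_on_compose2[OF cont[OF that], where f = "\<lambda>q. (fst (fst q), snd q)", simplified])
       (auto simp: K_def intro!: continuous_intros)
  have c2: "continuous_on K (\<lambda>q. P (snd (fst q)) (snd q) k l)" if "k \<le> n" "l \<le> n" for k l
    by (rule continuous_on_compose2[OF cont[OF that], where f = "\<lambda>q. (snd (fst q), snd q)", simplified])
       (auto simp: K_def intro!: continuous_intros)
  have f: "continuous_on K f" unfolding f_def overlap_def
    by (intro continuous_on_sum continuous_on_mult c1 c2) auto
  \<comment> \<open>\<open>Z\<close> collects the pairs of times at which the lines are orthogonal.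
    It misses the diagonal, where the overlap is 1, so by compactness the two times differ by at
    least a fixed \<open>\<delta>\<close> on \<open>Z\<close>.\<close>
  define Z where "Z = K \<inter> f -` {0}"
  have "closedin (top_of_set K) Z" unfolding Z_def by (rule continuous_closedin_preimage[OF f]) simp
  then have Z: "compact Z" using K closedin_compact by blast
  have "continuous_on Z (\<lambda>q. complex_of_real (fst (fst q) - snd (fst q)))"
    by (intro continuous_on_of_real continuous_on_diff continuous_on_fst continuous_on_snd continuous_on_id)
  moreover have "complex_of_real (fst (fst q) - snd (fst q)) \<noteq> 0" if q: "q \<in> Z" for q
  proof
    assume "complex_of_real (fst (fst q) - snd (fst q)) = 0"
    then have eq: "snd (fst q) = fst (fst q)" by simp
    have "fst (fst q) \<in> {0..1}" "snd q \<in> C" using q by (auto simp: Z_def K_def)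
    then obtain y where "line_rep n (P (fst (fst q)) (snd q)) y" using rep by blast
    then have "f q = 1" unfolding f_def eq by (rule overlap_self)
    then show False using q by (simp add: Z_def)
  qed
  ultimately obtain \<delta> where \<delta>: "\<delta> > 0" "\<And>q. q \<in> Z \<Longrightarrow> \<delta> \<le> cmod (complex_of_real (fst (fst q) - snd (fst q)))"
    using compact_bounded_below[OF Z] by blast
  obtain N where N: "N \<noteq> 0" "inverse (real N) < \<delta>" using \<delta>(1) real_arch_inverse[of \<delta>] by auto
  show ?thesis
  proof (rule that[of N])
    show "N \<ge> 1" using N by simp
    fix j x assume j: "j < N" and x: "x \<in> C"
    let ?q = "((real j / real N, real (Suc j) / real N), x)"
    have "?q \<in> K" using j x by (auto simp: K_def divide_simps)
    moreover have "cmod (complex_of_real (fst (fst ?q) - snd (fst ?q))) = inverse (real N)"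
      unfolding norm_of_real using N by (simp add: divide_simps)
    ultimately have "f ?q \<noteq> 0" using \<delta>(2)[of ?q] N(2) by (auto simp: Z_def)
    then show "overlap n (P (real j / real N) x) (P (real (Suc j) / real N) x) \<noteq> 0" by (simp add: f_def)
  qed
qed

definition lines_of :: "nat \<Rightarrow> params \<Rightarrow> nat \<Rightarrow> (nat \<Rightarrow> complex) set" where
  "lines_of n x = conf n (fst x) (perp n x)"

lemma lines_of_in: "x \<in> param_set n \<Longrightarrow> lines_of n x \<in> topspace (confCP n)"
  unfolding lines_of_def topspace_conf using indep_perp by blast

lemma lines_of_eq_iff:
  assumes "x \<in> param_set n" "y \<in> param_set n"
  shows "lines_of n x = lines_of n y \<longleftrightarrow>
    (\<exists>a b. a \<noteq> 0 \<and> b \<noteq> 0 \<and> scaled n a (fst x) (fst y) \<and> scaled n b (perp n x) (perp n y))"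
  unfolding lines_of_def using conf_eq_iff indep_perp assms by blast

lemma continuous_map_lines_of:
  "S \<subseteq> param_set n \<Longrightarrow> continuous_map (top_of_set S) (confCP n) (lines_of n)"
  unfolding lines_of_def
  by (intro continuous_map_conf)
     (auto simp: continuous_map_iff_continuous intro!: continuous_on_perp continuous_on_params_coord indep_perp)

text \<open>The contraction carries the lines over \<open>C\<close> to one fixed line. Transporting
  the generator \<open>pvec n i x\<close> along it and reading off one coordinate gives a functional
  on the line; the transport maps depend on the lines only, whence the rule for rescaling.\<close>

lemma local_section:
  assumes contr: "contractible_within (confCP n) U" and C: "compact C" "C \<subseteq> param_set n" "lines_of n ` C \<subseteq> U"
  obtains g where "continuous_on C g" "\<And>x. x \<in> C \<Longrightarrow> g x \<noteq> 0"
    "\<And>x y a b. \<lbrakk>x \<in> C; y \<in> C; scaled n a (fst x) (fst y); scaled n b (perp n x) (perp n y)\<rbrakk>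
       \<Longrightarrow> g y = (if i < n then a else b) * g x"
proof -
  let ?X = "confCP n"
  \<comment> \<open>Selects the point of the configuration whose line carries the
    \<open>i\<close>-th bundle.\<close>
  define c where "c = (if i < n then 1 else 2 :: nat)"
  obtain a H where a: "a \<in> topspace ?X"
    and H: "continuous_map (prod_topology (top_of_set {0..1::real}) (subtopology ?X U)) ?X H"
    and H0: "\<And>x. H (0, x) = x" and H1: "\<And>x. H (1, x) = a"
    using contr unfolding contractible_within_def homotopic_with_def by auto
  define P where "P t x k l = line_entry n k l (H (t, lines_of n x) c)" for t x k l
  have comp: "\<exists>z. nonzero n z \<and> p c = proj_point n z" if p: "p \<in> topspace ?X" for p
  proof -
    obtain v w where "p = conf n v w" "indep n v w" using p by (auto simp: topspace_conf)
    then show ?thesis using indep_nonzero[of n v w] by (auto simp: c_def)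
  qed
  have rep: "line_rep n (\<lambda>k l. line_entry n k l (p c)) z" if "nonzero n z" "p c = proj_point n z" for p z
    using that line_entry_proj_point[OF that(1)] by (simp add: line_rep_def)
  have lin: "lines_of n x \<in> topspace (subtopology ?X U)" if "x \<in> C" for x
  proof -
    have "lines_of n x \<in> topspace ?X" using that C(2) lines_of_in by blast
    then show ?thesis using that C(3) by auto
  qed
  have Htop: "H (t, lines_of n x) \<in> topspace ?X" if "t \<in> {0..1}" "x \<in> C" for t x
    using continuous_map_image_subset_topspace[OF H] lin[OF that(2)] that(1) by (auto simp: image_subset_iff)
  have Prep: "\<exists>y. line_rep n (P t x) y" if "t \<in> {0..1}" "x \<in> C" for t x
    using comp[OF Htop[OF that]] rep unfolding P_def by blast
  have Pcont: "continuous_on ({0..1} \<times> C) (\<lambda>p. P (fst p) (snd p) k l)" if "k \<le> n" "l \<le> n" for k l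
  proof -
    let ?T = "prod_topology (top_of_set {0..1::real}) (top_of_set C)"
    have "continuous_map (top_of_set C) (subtopology ?X U) (lines_of n)"
      using continuous_map_lines_of[OF C(2)] C(3) by (auto simp: continuous_map_in_subtopology)
    then have "continuous_map ?T (prod_topology (top_of_set {0..1::real}) (subtopology ?X U)) (\<lambda>p. (fst p, lines_of n (snd p)))"
      by (intro continuous_map_paired[THEN iffD2] conjI continuous_map_fst continuous_map_snd_comp)
    from continuous_map_compose[OF this H]
    have "continuous_map ?T ?X (\<lambda>p. H (fst p, lines_of n (snd p)))" by (simp add: o_def)
    from continuous_map_compose[OF this continuous_map_conf_entry[OF that, of c]]
    have "continuous_map ?T euclidean (\<lambda>p. P (fst p) (snd p) k l)" by (simp add: o_def P_def c_def)
    then show ?thesis by (simp add: continuous_map_iff_continuous)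
  qed
  obtain N where N: "N \<ge> 1" and ov: "\<And>j x. \<lbrakk>j < N; x \<in> C\<rbrakk> \<Longrightarrow>
     overlap n (P (real j / real N) x) (P (real (Suc j) / real N) x) \<noteq> 0"
    by (rule uniform_subdivision[OF C(1) Pcont Prep]) blast+
  obtain z where z: "nonzero n z" "a c = proj_point n z" using comp[OF a] by blast
  \<comment> \<open>A coordinate that does not vanish on the end line.\<close>
  then obtain k0 where k0: "k0 \<le> n" "z k0 \<noteq> 0" by (auto simp: nonzero_def)
  define M where "M x j = P (real j / real N) x" for x and j :: nat
  define g where "g x = transport n (M x) N (pvec n i x) k0" for x
  show ?thesis
  proof (rule that[of g])
    have "continuous_on C (\<lambda>x. M x j k l)" if "j \<le> N" "k \<le> n" "l \<le> n" for j k l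
      unfolding M_def
      by (rule continuous_on_compose2[OF Pcont[OF that(2,3)], where f = "\<lambda>x. (real j / real N, x)", simplified])
         (use that N in \<open>auto intro!: continuous_intros simp: divide_simps\<close>)
    then show "continuous_on C g"
      unfolding g_def using k0 by (intro continuous_on_transport[where N = N] continuous_on_pvec) auto
    show "g x \<noteq> 0" if x: "x \<in> C" for x
    proof -
      have "lines_of n x c = proj_point n (pvec n i x)" by (simp add: lines_of_def c_def pvec_def)
      moreover have "nonzero n (pvec n i x)" using pvec_nonzero x C(2) by blast
      ultimately have "line_rep n (M x 0) (pvec n i x)"
        using rep[of "pvec n i x" "lines_of n x"] unfolding M_def P_def by (simp add: H0)
      moreover have "\<exists>z. line_rep n (M x j) z" if "j \<le> N" for j
        unfolding M_def using that N x by (intro Prep) (auto simp: divide_simps)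
      ultimately have tr: "line_rep n (M x N) (transport n (M x) N (pvec n i x))"
        using ov x by (intro transport_line_rep) (auto simp: M_def)
      have "M x N k0 k0 = proj_entry n k0 k0 z"
        using rep[where p = a, OF z] k0 N by (simp add: M_def P_def H1 line_rep_def)
      moreover have "proj_entry n k0 k0 z \<noteq> 0"
        using k0 z sqnorm_eq_0_iff[of n z] by (simp add: proj_entry_def)
      ultimately have "proj_entry n k0 k0 (transport n (M x) N (pvec n i x)) \<noteq> 0"
        using tr k0 by (simp add: line_rep_def)
      then show ?thesis by (auto simp: proj_entry_def g_def)
    qed
    fix x y a' b assume xy: "x \<in> C" "y \<in> C" and sc: "scaled n a' (fst x) (fst y)" "scaled n b (perp n x) (perp n y)"
    have Q: "x \<in> param_set n" "y \<in> param_set n" using xy C by auto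
    have "lines_of n y = lines_of n x"
      using scaled_same_lines(2,3)[OF Q sc] sc lines_of_eq_iff[OF Q] by metis
    then have "M y = M x" unfolding M_def[abs_def] P_def[abs_def] by simp
    moreover have "scaled n (if i < n then a' else b) (pvec n i x) (pvec n i y)" using sc by (simp add: pvec_def)
    ultimately show "g y = (if i < n then a' else b) * g x"
      using transport_scaled[of n _ "pvec n i x" "pvec n i y" "M x" N] k0 unfolding g_def by (metis scaled_def)
  qed
qed

text \<open>Places pairs of lines in a metric function space, so that a distance is available for
  the cutoff.\<close>

definition line_coords :: "nat \<Rightarrow> params \<Rightarrow> nat \<Rightarrow> nat \<Rightarrow> nat \<Rightarrow> complex" where
  "line_coords n x i k l = (if k \<le> n \<and> l \<le> n then proj_entry n k l (pvec n i x) else 0)"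

lemma line_coords_eq_iff: "line_coords n x = line_coords n y \<longleftrightarrow> (\<forall>i. \<forall>k\<le>n. \<forall>l\<le>n.
    proj_entry n k l (pvec n i x) = proj_entry n k l (pvec n i y))"
  by (auto simp: fun_eq_iff line_coords_def)

lemma lines_of_eqI:
  assumes n: "n \<ge> 1" and xy: "x \<in> param_set n" "y \<in> param_set n" and eq: "line_coords n x = line_coords n y"
  shows "lines_of n x = lines_of n y"
proof -
  have "same_lines n x y" using eq unfolding line_coords_eq_iff same_lines_def by blast
  then show ?thesis using same_lines_scaled[OF n xy] lines_of_eq_iff[OF xy] by metis
qed

lemma line_coords_scaled:
  assumes xy: "x \<in> param_set n" "y \<in> param_set n"
    and sc: "scaled n a (fst x) (fst y)" "scaled n b (perp n x) (perp n y)"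
  shows "line_coords n x = line_coords n y"
  using proj_entry_scaled[OF sc(1) scaled_same_lines(2)[OF xy sc]]
    proj_entry_scaled[OF sc(2) scaled_same_lines(3)[OF xy sc]]
  unfolding line_coords_eq_iff pvec_def by simp

lemma continuous_on_line_coords: "continuous_on (param_set n) (line_coords n)"
proof (intro continuous_on_coordinatewise_then_product)
  fix i k l
  show "continuous_on (param_set n) (\<lambda>x. line_coords n x i k l)"
    by (cases "k \<le> n \<and> l \<le> n") (auto simp: line_coords_def continuous_on_proj_entry)
qed

lemma line_coords_nonzero:
  assumes "x \<in> param_set n" shows "line_coords n x \<noteq> (\<lambda>_ _ _. 0)"
proof
  assume 0: "line_coords n x = (\<lambda>_ _ _. 0)"
  obtain k where k: "k \<le> n" "pvec n 0 x k \<noteq> 0" using pvec_nonzero[OF assms] by (auto simp: nonzero_def)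
  have "proj_entry n k k (pvec n 0 x) \<noteq> 0"
    using k pvec_nonzero[OF assms] sqnorm_eq_0_iff[of n "pvec n 0 x"] by (simp add: proj_entry_def)
  then show False using fun_cong[OF fun_cong[OF fun_cong[OF 0]], of 0 k k] k by (simp add: line_coords_def)
qed

text \<open>The cutoff is the distance to the coordinates of the compact set of parameters whose
  lines lie outside \<open>U\<close>; being computed from the projections, it depends on the lines
  only.\<close>

lemma cutoff:
  assumes n: "n \<ge> 1" and U: "openin (confCP n) U"
  obtains \<rho> :: "params \<Rightarrow> real" where "continuous_on (param_set n) \<rho>" "\<And>x. \<rho> x \<ge> 0"
    "\<And>x. x \<in> param_set n \<Longrightarrow> \<rho> x \<noteq> 0 \<longleftrightarrow> lines_of n x \<in> U"
    "\<And>x y a b. \<lbrakk>x \<in> param_set n; y \<in> param_set n; scaled n a (fst x) (fst y); scaled n b (perp n x) (perp n y)\<rbrakk>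
       \<Longrightarrow> \<rho> x = \<rho> y"
proof -
  define A where "A = {x \<in> param_set n. lines_of n x \<notin> U}"
  \<comment> \<open>The zero function keeps \<open>F\<close> nonempty, since the distance to the
    empty set is 0 by convention; it never equals \<open>line_coords n x\<close> for a parameter
    \<open>x\<close>.\<close>
  define F where "F = insert (\<lambda>_ _ _. 0) (line_coords n ` A)"
  have "openin (top_of_set (param_set n)) {x \<in> topspace (top_of_set (param_set n)). lines_of n x \<in> U}"
    by (rule openin_continuous_map_preimage[OF continuous_map_lines_of[OF subset_refl] U])
  then have "closedin (top_of_set (param_set n)) (topspace (top_of_set (param_set n)) -
      {x \<in> topspace (top_of_set (param_set n)). lines_of n x \<in> U})"
    by (rule openin_closedin_eq[THEN iffD1, THEN conjunct2])
  moreover have "topspace (top_of_set (param_set n)) - {x \<in> topspace (top_of_set (param_set n)). lines_of n x \<in> U} = A"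
    unfolding A_def topspace_euclidean_subtopology by blast
  ultimately have "compact A" using closedin_compact[OF compact_param_set] by metis
  then have "compact (line_coords n ` A)"
    by (intro compact_continuous_image continuous_on_subset[OF continuous_on_line_coords]) (auto simp: A_def)
  then have F: "closed F" unfolding F_def by (intro closed_insert compact_imp_closed)
  define \<rho> where "\<rho> x = infdist (line_coords n x) F" for x
  show ?thesis
  proof (rule that[of \<rho>])
    show "continuous_on (param_set n) \<rho>"
      unfolding \<rho>_def by (rule continuous_on_infdist[OF continuous_on_line_coords])
    show "\<rho> x \<ge> 0" for x by (simp add: \<rho>_def infdist_nonneg)
    show "\<rho> x \<noteq> 0 \<longleftrightarrow> lines_of n x \<in> U" if x: "x \<in> param_set n" for x
    proof -
      have "\<rho> x = 0 \<longleftrightarrow> line_coords n x \<in> F"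
        unfolding \<rho>_def using in_closed_iff_infdist_zero[OF F] by (auto simp: F_def)
      also have "\<dots> \<longleftrightarrow> line_coords n x \<in> line_coords n ` A"
        using line_coords_nonzero[OF x] by (simp add: F_def)
      also have "\<dots> \<longleftrightarrow> x \<in> A"
      proof
        assume "line_coords n x \<in> line_coords n ` A"
        then obtain y where "y \<in> A" "line_coords n x = line_coords n y" by blast
        then show "x \<in> A" using lines_of_eqI[OF n x, of y] x unfolding A_def by auto
      qed blast
      finally show ?thesis using x by (auto simp: A_def)
    qed
    show "\<rho> x = \<rho> y" if "x \<in> param_set n" "y \<in> param_set n" "scaled n a (fst x) (fst y)"
      "scaled n b (perp n x) (perp n y)" for x y a b
      unfolding \<rho>_def using line_coords_scaled[OF that] by simp
  qed
qed

text \<open>The two formulas agree where \<open>\<rho> x = \<epsilon>\<close>, so they glue along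
  closed sets. Cutting at \<open>\<epsilon>\<close> rather than at 0 leaves \<open>g\<close> to be
  found on a compact set only.\<close>

lemma extend_by_cutoff:
  fixes \<rho> :: "'a::t2_space \<Rightarrow> real" and g :: "'a \<Rightarrow> complex"
  assumes Q: "compact Q" and \<rho>: "continuous_on Q \<rho>" and g: "continuous_on {x \<in> Q. \<epsilon> \<le> \<rho> x} g"
  shows "continuous_on Q (\<lambda>x. if \<epsilon> \<le> \<rho> x then of_real (\<rho> x - \<epsilon>) * g x else 0)"
proof -
  define C where "C = {x \<in> Q. \<epsilon> \<le> \<rho> x}"
  define D where "D = {x \<in> Q. \<rho> x \<le> \<epsilon>}"
  have "closedin (top_of_set Q) (Q \<inter> \<rho> -` {\<epsilon>..})" "closedin (top_of_set Q) (Q \<inter> \<rho> -` {..\<epsilon>})"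
    by (rule continuous_closedin_preimage[OF \<rho>], simp)+
  moreover have "Q \<inter> \<rho> -` {\<epsilon>..} = C" "Q \<inter> \<rho> -` {..\<epsilon>} = D" by (auto simp: C_def D_def)
  ultimately have cl: "closedin (top_of_set Q) C" "closedin (top_of_set Q) D" by simp_all
  have CD: "Q = C \<union> D" by (auto simp: C_def D_def)
  have "continuous_on (C \<union> D) (\<lambda>x. if \<epsilon> \<le> \<rho> x then of_real (\<rho> x - \<epsilon>) * g x else 0)"
  proof (rule continuous_on_cases_local)
    show "closedin (top_of_set (C \<union> D)) C" "closedin (top_of_set (C \<union> D)) D" using cl CD by simp_all
    show "continuous_on C (\<lambda>x. of_real (\<rho> x - \<epsilon>) * g x)"
      using g continuous_on_subset[OF \<rho>, of C] unfolding C_def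
      by (intro continuous_on_mult continuous_on_of_real continuous_on_diff continuous_on_const) auto
  qed (auto simp: C_def D_def)
  then show ?thesis using CD by simp
qed

text \<open>Each set of the cover serves one summand: the \<open>i\<close>-th bundle has a nonzero
  section over a compact part of \<open>U i\<close>, cut off to vanish elsewhere. At every parameter
  some cutoff is positive, so the sections have no common zero.\<close>

theorem no_small_categorical_cover:
  assumes n: "n \<ge> 1"
    and op: "\<And>i. i < 2 * n - 1 \<Longrightarrow> openin (confCP n) (U i)"
    and contr: "\<And>i. i < 2 * n - 1 \<Longrightarrow> contractible_within (confCP n) (U i)"
    and cover: "topspace (confCP n) \<subseteq> (\<Union>i<2 * n - 1. U i)"
  shows False
proof -
  define m where "m = 2 * n - 1"
  define Q where "Q = param_set n"
  have \<rho>_ex: "\<forall>i<m. \<exists>\<rho>. continuous_on Q \<rho> \<and> (\<forall>x. \<rho> x \<ge> 0) \<and> (\<forall>x\<in>Q. \<rho> x \<noteq> (0::real) \<longleftrightarrow> lines_of n x \<in> U i) \<and>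
    (\<forall>x\<in>Q. \<forall>y\<in>Q. \<forall>a b. scaled n a (fst x) (fst y) \<longrightarrow> scaled n b (perp n x) (perp n y) \<longrightarrow> \<rho> x = \<rho> y)"
    unfolding Q_def
  proof (intro allI impI, goal_cases)
    case (1 i)
    show ?case by (rule cutoff[OF n op[OF 1[unfolded m_def]]]) blast
  qed
  obtain \<rho> where \<rho>: "\<forall>i<m. continuous_on Q (\<rho> i) \<and> (\<forall>x. \<rho> i x \<ge> 0) \<and>
      (\<forall>x\<in>Q. \<rho> i x \<noteq> (0::real) \<longleftrightarrow> lines_of n x \<in> U i) \<and>
      (\<forall>x\<in>Q. \<forall>y\<in>Q. \<forall>a b. scaled n a (fst x) (fst y) \<longrightarrow> scaled n b (perp n x) (perp n y) \<longrightarrow> \<rho> i x = \<rho> i y)"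
    using choice_less[OF \<rho>_ex] by (elim exE)
  have \<rho>c: "continuous_on Q (\<rho> i)" if "i < m" for i using \<rho> that by blast
  have \<rho>0: "\<rho> i x \<ge> 0" if "i < m" for i x using \<rho> that by blast
  have \<rho>U: "\<rho> i x \<noteq> 0 \<longleftrightarrow> lines_of n x \<in> U i" if "i < m" "x \<in> Q" for i x using \<rho> that by blast
  have \<rho>inv: "\<rho> i x = \<rho> i y"
    if "i < m" "x \<in> Q" "y \<in> Q" "scaled n a (fst x) (fst y)" "scaled n b (perp n x) (perp n y)" for i x y a b
    using \<rho> that by blast
  obtain \<beta> where \<beta>: "\<beta> > 0" "\<And>x. x \<in> Q \<Longrightarrow> \<exists>i<m. \<beta> \<le> cmod (complex_of_real (\<rho> i x))"
  proof (rule sections_bounded_below[OF compact_param_set, of m n "\<lambda>i x. complex_of_real (\<rho> i x)"])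
    show "continuous_on (param_set n) (\<lambda>x. complex_of_real (\<rho> i x))" if "i < m" for i
      using \<rho>c[OF that] unfolding Q_def by (rule continuous_on_of_real)
    show "\<exists>i<m. complex_of_real (\<rho> i x) \<noteq> 0" if "x \<in> param_set n" for x
    proof -
      obtain i where "i < m" "lines_of n x \<in> U i" using cover lines_of_in[OF \<open>x \<in> param_set n\<close>] by (auto simp: m_def)
      then show ?thesis using \<rho>U[of i x] \<open>x \<in> param_set n\<close> by (auto simp: Q_def)
    qed
  qed (auto simp: Q_def)
  \<comment> \<open>Below \<open>\<beta>\<close>, so that at every point some cutoff exceeds it
    strictly and the factor \<open>\<rho> i x - \<epsilon>\<close> is nonzero.\<close>
  define \<epsilon> where "\<epsilon> = \<beta> / 2"
  have \<epsilon>: "\<epsilon> > 0" "\<epsilon> < \<beta>" using \<beta> by (auto simp: \<epsilon>_def)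
  define C where "C i = {x \<in> Q. \<epsilon> \<le> \<rho> i x}" for i
  have g_ex: "\<forall>i<m. \<exists>g. continuous_on (C i) g \<and> (\<forall>x\<in>C i. g x \<noteq> 0) \<and>
    (\<forall>x\<in>C i. \<forall>y\<in>C i. \<forall>a b. scaled n a (fst x) (fst y) \<longrightarrow> scaled n b (perp n x) (perp n y) \<longrightarrow>
        g y = (if i < n then a else b) * g x)"
  proof (intro allI impI, goal_cases)
    case i: (1 i)
    have "closedin (top_of_set Q) (Q \<inter> \<rho> i -` {\<epsilon>..})"
      by (rule continuous_closedin_preimage[OF \<rho>c[OF i]]) simp
    moreover have "Q \<inter> \<rho> i -` {\<epsilon>..} = C i" by (auto simp: C_def)
    ultimately have cC: "compact (C i)" using closedin_compact[OF compact_param_set] unfolding Q_def by metis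
    have CQ: "C i \<subseteq> param_set n" by (auto simp: C_def Q_def)
    have CU: "lines_of n ` C i \<subseteq> U i"
    proof
      fix p assume "p \<in> lines_of n ` C i"
      then obtain x where x: "x \<in> C i" "p = lines_of n x" by blast
      then have "\<rho> i x \<noteq> 0" "x \<in> Q" using \<epsilon> by (auto simp: C_def)
      then show "p \<in> U i" using \<rho>U[OF i] x by blast
    qed
    show ?case
      by (rule local_section[OF contr[OF i[unfolded m_def]] cC CQ CU, of i]) blast
  qed
  obtain g where g: "\<forall>i<m. continuous_on (C i) (g i) \<and> (\<forall>x\<in>C i. g i x \<noteq> 0) \<and>
    (\<forall>x\<in>C i. \<forall>y\<in>C i. \<forall>a b. scaled n a (fst x) (fst y) \<longrightarrow> scaled n b (perp n x) (perp n y) \<longrightarrow>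
        g i y = (if i < n then a else b) * g i x)"
    using choice_less[OF g_ex] by (elim exE)
  have gc: "continuous_on (C i) (g i)" if "i < m" for i using g that by blast
  have g0: "g i x \<noteq> 0" if "i < m" "x \<in> C i" for i x using g that by blast
  have geq: "g i y = (if i < n then a else b) * g i x"
    if "i < m" "x \<in> C i" "y \<in> C i" "scaled n a (fst x) (fst y)" "scaled n b (perp n x) (perp n y)" for i x y a b
    using g that by blast
  define s where "s i x = (if \<epsilon> \<le> \<rho> i x then of_real (\<rho> i x - \<epsilon>) * g i x else 0)" for i x
  show False
  proof (rule no_equivariant_sections[OF n, of s])
    fix i assume "i < 2 * n - 1"
    then have i: "i < m" by (simp add: m_def)
    show "continuous_on (param_set n) (s i)"
      unfolding s_def[abs_def] using \<rho>c[OF i] gc[OF i] unfolding Q_def C_def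
      by (rule extend_by_cutoff[OF compact_param_set])
    show "equivariant n i (s i)"
      unfolding equivariant_def
    proof (intro ballI allI impI)
      fix x y a b assume xy: "x \<in> param_set n" "y \<in> param_set n"
        and sc: "scaled n a (fst x) (fst y)" "scaled n b (perp n x) (perp n y)"
      have \<rho>: "\<rho> i x = \<rho> i y" using \<rho>inv[OF i _ _ sc] xy by (simp add: Q_def)
      show "s i y = (if i < n then a else b) * s i x"
      proof (cases "\<epsilon> \<le> \<rho> i x")
        case True
        then have "x \<in> C i" "y \<in> C i" using xy \<rho> by (auto simp: C_def Q_def)
        from geq[OF i this sc] show ?thesis using True \<rho> by (simp add: s_def)
      next
        case False
        then show ?thesis using \<rho> by (simp add: s_def)
      qed
    qed
  next
    fix x assume x: "x \<in> param_set n"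
    then obtain i where i: "i < m" "\<beta> \<le> cmod (complex_of_real (\<rho> i x))" using \<beta>(2)[of x] by (auto simp: Q_def)
    have "\<beta> \<le> \<rho> i x" using i \<rho>0[OF i(1), of x] by simp
    moreover have "x \<in> C i" using \<open>\<beta> \<le> \<rho> i x\<close> \<epsilon> x by (simp add: C_def Q_def)
    ultimately show "\<exists>i<2 * n - 1. s i x \<noteq> 0" using \<epsilon> g0[OF i(1)] i(1)
      by (intro exI[of _ i]) (simp add: s_def m_def)
  qed
qed

theorem LS_category_conf_ge:
  assumes n: "n \<ge> 1"
  shows "enat (2 * n) \<le> LS_category (confCP n)"
  unfolding LS_category_def
proof (rule Inf_greatest, clarify)
  fix m and U :: "nat \<Rightarrow> (nat \<Rightarrow> (nat \<Rightarrow> complex) set) set"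
  assume U: "\<forall>i<m. openin (confCP n) (U i) \<and> contractible_within (confCP n) (U i)"
    and cover: "(\<Union>i<m. U i) = topspace (confCP n)"
  show "enat (2 * n) \<le> enat m"
  proof (rule ccontr)
    assume "\<not> ?thesis"
    then have m: "m \<le> 2 * n - 1" by simp
    have "base_conf n \<in> topspace (confCP n)"
      using base_conf_in_chart_dom[of 0 n 1] n by (auto simp: chart_dom_def)
    then have m0: "0 < m" using cover by (cases m) auto
    \<comment> \<open>A shorter cover is padded to \<open>2 * n - 1\<close> sets by repeating its
      first set, which exists because the space is nonempty.\<close>
    define V where "V i = U (if i < m then i else 0)" for i
    have V: "openin (confCP n) (V i) \<and> contractible_within (confCP n) (V i)" for i
      unfolding V_def using U m0 by (cases "i < m") simp_all
    have "topspace (confCP n) \<subseteq> (\<Union>i<2 * n - 1. V i)"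
    proof
      fix x assume "x \<in> topspace (confCP n)"
      then obtain i where i: "i < m" "x \<in> U i" using cover by blast
      then have "x \<in> V i" "i < 2 * n - 1" using m by (auto simp: V_def)
      then show "x \<in> (\<Union>i<2 * n - 1. V i)" by blast
    qed
    then show False using no_small_categorical_cover[OF n, of V] V by blast
  qed
qed

theorem theorem1p2:
  fixes n :: nat
  assumes "n \<ge> 1"
  shows "LS_category (configuration_space (complex_projective_space n) 2) = enat (2 * n)"
  using LS_category_conf_le[OF assms] LS_category_conf_ge[OF assms] by (rule antisym)

end
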